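(* Let $n\ge1$, $s>0$, $\lambda>1$ and $1\le p\le\infty$. There exists a constant $C=C(n,s,p,\lambda)>0$ such that the following holds. Assume that $u,f\in L^p(\mathbb R^n)$ and that $$(-\Delta)^{s+\ln}u=f\qquad\text{in }\mathbb R^n$$ in the sense of (tempered) distributions, i.e. as an identity in $\mathcal S_\infty'(\mathbb R^n)$, where $(-\Delta)^{s+\ln}u$ is defined. Then $u\in\mathcal L^{p}_{s+\ln,\lambda}(\mathbb R^n)$ and $$\|u\|_{\mathcal L^{p}_{s+\ln,\lambda}(\mathbb R^n)}\le C\bigl(\|f\|_{L^p(\mathbb R^n)}+\|u\|_{L^p(\mathbb R^n)}\bigr).$$
   Context: The Fourier transform is $\mathcal F u(\xi)=\widehat u(\xi)=\int_{\mathbb{R}^n}u(x)e^{-2\pi i x\cdot\xi}\,dx$, extended to $\mathcal S'(\mathbb R^n)$. Let $\mathcal S_\infty(\mathbb R^n)=\{\varphi\in\mathcal S(\mathbb R^n):\int x^\gamma\varphi(x)\,dx=0\ \forall\gamma\in\mathbb N_0^n\}$ and $\mathcal S_0(\mathbb R^n)=\{\psi\in\mathcal S(\mathbb R^n):\partial^\gamma\psi(0)=0\ \forall\gamma\in\mathbb N_0^n\}$, with topologies induced from $\mathcal S(\mathbb R^n)$ and continuous duals $\mathcal S_\infty'$, $\mathcal S_0'$ (so $\mathcal S_\infty'\cong\mathcal S'/\{\text{polynomials}\}$). The Fourier transform is a homeomorphism $\mathcal S_\infty\to\mathcal S_0$, and $\mathcal F:\mathcal S_\infty'\to\mathcal S_0'$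 is defined by $\langle\widehat u,\psi\rangle=\langle u,\mathcal F^{-1}\psi\rangle$, $\psi\in\mathcal S_0$. Functions in $L^p(\mathbb R^n)$ are regarded as elements of $\mathcal S_\infty'$ by restriction. With $m_{s+\ln}(\xi)=(4\pi^2|\xi|^2)^s\ln(4\pi^2|\xi|^2)$ for $\xi\ne0$, $m_{s+\ln}(0)=0$ (multiplication by which maps $\mathcal S_0$ continuously into itself), the fractional-logarithmic Laplacian of $u\in\mathcal S_\infty'(\mathbb R^n)$ is the element $(-\Delta)^{s+\ln}u\in\mathcal S_\infty'(\mathbb R^n)$ with $\langle\mathcal F((-\Delta)^{s+\ln}u),\psi\rangle=\langle\widehat u,m_{s+\ln}\psi\rangle$ for all $\psi\in\mathcal S_0(\mathbb R^n)$. For $\lambda>1$, $(\lambda I-\Delta)^{s+\ln}$ is the Fourier multiplier on $\mathcal S'(\mathbb R^n)$ with symbol $(\lambda+4\pi^2|\xi|^2)^s\ln(\lambda+4\pi^2|\xi|^2)$, and $$\mathcal L^{p}_{s+\ln,\lambda}(\mathbb R^n)=\{u\in\mathcal S'(\mathbb R^n):(\lambda I-\Delta)^{s+\ln}u\in L^p(\mathbb R^n)\},\qquad \|u\|_{\mathcal L^{p}_{s+\ln,\lambda}(\mathbb R^n)}=\|(\lambda I-\Delta)^{s+\ln}u\|_{L^p(\mathbb R^n)}.$$ *)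

theory Defs
  imports "HOL-Analysis.Analysis" "HOL-Probability.Essential_Supremum"
begin

section \<open>Lebesgue spaces\<close>

definition Lp :: "ereal \<Rightarrow> (real^'n \<Rightarrow> complex) set" where
  "Lp p = {f \<in> borel_measurable lebesgue.
     if p = \<infinity> then esssup lebesgue (\<lambda>x. ereal (norm (f x))) < \<infinity>
     else integrable lebesgue (\<lambda>x. norm (f x) powr real_of_ereal p)}"

text \<open>Only meaningful for members of \<^term>\<open>Lp p\<close>.\<close>

definition Lp_norm :: "ereal \<Rightarrow> (real^'n \<Rightarrow> complex) \<Rightarrow> real" where
  "Lp_norm p f =
     (if p = \<infinity> then real_of_ereal (esssup lebesgue (\<lambda>x. ereal (norm (f x))))
      else (LINT x|lebesgue. norm (f x) powr real_of_ereal p) powr (1 / real_of_ereal p))"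


section \<open>Schwartz functions\<close>

text \<open>
  Iterated partial derivatives are indexed by lists of coordinate directions. For smooth
  functions the order of differentiation is irrelevant, so the lists give exactly the operators
  \<open>\<partial>\<^sup>\<gamma>\<close> for multi-indices \<open>\<gamma>\<close>.
\<close>

fun partials :: "'n list \<Rightarrow> (real^'n \<Rightarrow> complex) \<Rightarrow> real^'n \<Rightarrow> complex" where
  "partials [] f = f"
| "partials (i # is) f = (\<lambda>x. frechet_derivative (partials is f) (at x) (axis i 1))"

definition mono_pow :: "('n \<Rightarrow> nat) \<Rightarrow> real^'n \<Rightarrow> real" where
  "mono_pow \<gamma> x = (\<Prod>i\<in>UNIV. (x $ i) ^ \<gamma> i)"

text \<open>
  Smoothness is expressed by differentiability of every iterated partial derivative.
\<close>

definition schwartz :: "(real^'n \<Rightarrow> complex) set" where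
  "schwartz = {f. (\<forall>is x. partials is f differentiable (at x)) \<and>
                  (\<forall>\<gamma> is. bounded (range (\<lambda>x. mono_pow \<gamma> x *\<^sub>R partials is f x)))}"

definition schwartz_seminorm ::
    "('n \<Rightarrow> nat) \<Rightarrow> 'n list \<Rightarrow> (real^'n \<Rightarrow> complex) \<Rightarrow> real" where
  "schwartz_seminorm \<gamma> is f = (SUP x. norm (mono_pow \<gamma> x *\<^sub>R partials is f x))"

definition schwartz_topology :: "(real^'n \<Rightarrow> complex) topology" where
  "schwartz_topology = topology_generated_by
     {{g \<in> schwartz. schwartz_seminorm \<gamma> is (\<lambda>x. g x - f x) < e} | \<gamma> is f e.
        f \<in> schwartz \<and> 0 < e}"

definition schwartz_inf :: "(real^'n \<Rightarrow> complex) set" where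
  "schwartz_inf = {f \<in> schwartz. \<forall>\<gamma>. (LINT x|lebesgue. mono_pow \<gamma> x *\<^sub>R f x) = 0}"

definition schwartz_zero :: "(real^'n \<Rightarrow> complex) set" where
  "schwartz_zero = {f \<in> schwartz. \<forall>is. partials is f 0 = 0}"


section \<open>Distributions\<close>

text \<open>
  Continuous linear functionals on a subspace \<open>V\<close> of the Schwartz space, with the induced
  topology. They are represented by total functions of which only the values on \<open>V\<close> matter:
  restriction to a smaller subspace is the identity on representatives, and an identity
  between functionals on \<open>V\<close> means agreement of their values on \<open>V\<close>.
\<close>

definition dual :: "(real^'n \<Rightarrow> complex) set \<Rightarrow> ((real^'n \<Rightarrow> complex) \<Rightarrow> complex) set" where
  "dual V = {T. (\<forall>\<phi>\<in>V. \<forall>\<psi>\<in>V. \<forall>a b. T (\<lambda>x. a * \<phi> x + b * \<psi> x) = a * T \<phi> + b * T \<psi>) \<and>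
                continuous_map (subtopology schwartz_topology V) euclidean T}"

definition distr_of :: "(real^'n \<Rightarrow> complex) \<Rightarrow> (real^'n \<Rightarrow> complex) \<Rightarrow> complex" where
  "distr_of u \<phi> = (LINT x|lebesgue. u x * \<phi> x)"

definition mult_distr ::
    "(real^'n \<Rightarrow> real) \<Rightarrow> ((real^'n \<Rightarrow> complex) \<Rightarrow> complex) \<Rightarrow> (real^'n \<Rightarrow> complex) \<Rightarrow> complex" where
  "mult_distr m T \<phi> = T (\<lambda>x. of_real (m x) * \<phi> x)"


section \<open>Fourier transform\<close>

definition fourier :: "(real^'n \<Rightarrow> complex) \<Rightarrow> real^'n \<Rightarrow> complex" where
  "fourier \<phi> \<xi> = (LINT x|lebesgue. \<phi> x * exp (- 2 * of_real pi * \<i> * of_real (x \<bullet> \<xi>)))"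

definition inv_fourier :: "(real^'n \<Rightarrow> complex) \<Rightarrow> real^'n \<Rightarrow> complex" where
  "inv_fourier \<psi> x = (LINT \<xi>|lebesgue. \<psi> \<xi> * exp (2 * of_real pi * \<i> * of_real (x \<bullet> \<xi>)))"

definition fourier_distr ::
    "((real^'n \<Rightarrow> complex) \<Rightarrow> complex) \<Rightarrow> (real^'n \<Rightarrow> complex) \<Rightarrow> complex" where
  "fourier_distr T \<phi> = T (fourier \<phi>)"

definition inv_fourier_distr ::
    "((real^'n \<Rightarrow> complex) \<Rightarrow> complex) \<Rightarrow> (real^'n \<Rightarrow> complex) \<Rightarrow> complex" where
  "inv_fourier_distr T \<phi> = T (inv_fourier \<phi>)"

definition fourier_multiplier ::
    "(real^'n \<Rightarrow> real) \<Rightarrow> ((real^'n \<Rightarrow> complex) \<Rightarrow> complex) \<Rightarrow> (real^'n \<Rightarrow> complex) \<Rightarrow> complex" where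
  "fourier_multiplier m T = inv_fourier_distr (mult_distr m (fourier_distr T))"

text \<open>
  On the dual of \<^const>\<open>schwartz_inf\<close> the Fourier transform is taken with the convention
  \<open>\<langle>\<F> T, \<psi>\<rangle> = \<langle>T, \<F>\<^sup>-\<^sup>1 \<psi>\<rangle>\<close> for \<open>\<psi>\<close> in \<^const>\<open>schwartz_zero\<close>. This differs by the
  reflection \<open>\<xi> \<mapsto> -\<xi>\<close> from \<^const>\<open>fourier_distr\<close>, which does not affect multipliers with an
  even symbol.
\<close>

definition fourier_distr_inf ::
    "((real^'n \<Rightarrow> complex) \<Rightarrow> complex) \<Rightarrow> (real^'n \<Rightarrow> complex) \<Rightarrow> complex" where
  "fourier_distr_inf T \<psi> = T (inv_fourier \<psi>)"


section \<open>The fractional-logarithmic Laplacian\<close>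

definition m_slog :: "real \<Rightarrow> real^'n \<Rightarrow> real" where
  "m_slog s \<xi> = (if \<xi> = 0 then 0
     else (4 * pi^2 * (norm \<xi>)^2) powr s * ln (4 * pi^2 * (norm \<xi>)^2))"

text \<open>
  \<open>w = (-\<Delta>)\<^bsup>s+ln\<^esup> u\<close> in the dual of \<^const>\<open>schwartz_inf\<close>. As the inverse Fourier transform
  maps \<^const>\<open>schwartz_zero\<close> onto \<^const>\<open>schwartz_inf\<close>, this determines \<open>w\<close> on
  \<^const>\<open>schwartz_inf\<close>.
\<close>

definition is_frac_log_laplacian ::
    "real \<Rightarrow> ((real^'n \<Rightarrow> complex) \<Rightarrow> complex) \<Rightarrow> ((real^'n \<Rightarrow> complex) \<Rightarrow> complex) \<Rightarrow> bool" where
  "is_frac_log_laplacian s u w \<longleftrightarrow>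
     u \<in> dual schwartz_inf \<and> w \<in> dual schwartz_inf \<and>
     (\<forall>\<psi>\<in>schwartz_zero.
        fourier_distr_inf w \<psi> = mult_distr (m_slog s) (fourier_distr_inf u) \<psi>)"


section \<open>Potential spaces\<close>

definition shifted_symbol :: "real \<Rightarrow> real \<Rightarrow> real^'n \<Rightarrow> real" where
  "shifted_symbol s lam \<xi> =
     (lam + 4 * pi^2 * (norm \<xi>)^2) powr s * ln (lam + 4 * pi^2 * (norm \<xi>)^2)"

definition shifted_laplacian ::
    "real \<Rightarrow> real \<Rightarrow> ((real^'n \<Rightarrow> complex) \<Rightarrow> complex) \<Rightarrow> (real^'n \<Rightarrow> complex) \<Rightarrow> complex" where
  "shifted_laplacian s lam = fourier_multiplier (shifted_symbol s lam)"

text \<open>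
  The tempered distribution \<open>T\<close> is given by the \<open>L\<^sup>p\<close> function \<open>g\<close>, which is then unique up to
  null sets.
\<close>

definition is_Lp_density ::
    "ereal \<Rightarrow> ((real^'n \<Rightarrow> complex) \<Rightarrow> complex) \<Rightarrow> (real^'n \<Rightarrow> complex) \<Rightarrow> bool" where
  "is_Lp_density p T g \<longleftrightarrow> g \<in> Lp p \<and> (\<forall>\<phi>\<in>schwartz. T \<phi> = distr_of g \<phi>)"

definition potential_space ::
    "ereal \<Rightarrow> real \<Rightarrow> real \<Rightarrow> ((real^'n \<Rightarrow> complex) \<Rightarrow> complex) set" where
  "potential_space p s lam =
     {u \<in> dual schwartz. \<exists>g. is_Lp_density p (shifted_laplacian s lam u) g}"

definition potential_norm ::
    "ereal \<Rightarrow> real \<Rightarrow> real \<Rightarrow> ((real^'n \<Rightarrow> complex) \<Rightarrow> complex) \<Rightarrow> real" where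
  "potential_norm p s lam u =
     Lp_norm p (SOME g. is_Lp_density p (shifted_laplacian s lam u) g)"

end

theory Submission
  imports Defs "HOL-Probability.Probability"
begin

text \<open>
  Write \<open>r = 4\<pi>\<^sup>2|\<xi>|\<^sup>2\<close> and \<open>\<rho> = \<lambda> + r\<close>, and let \<open>m = r^s ln r\<close> and \<open>M = \<rho>^s ln \<rho>\<close> be the symbols of
  the two operators. The estimate holds because \<open>M = A m + B\<close> with \<open>A\<close> and \<open>B\<close> Fourier transforms of
  finite signed measures: convolution with a finite measure is bounded on \<open>L^p\<close> for every
  \<open>1 \<le> p \<le> \<infinity>\<close>, endpoints included, and formally \<open>M(D)u = A(D)f + B(D)u\<close>.

  To find \<open>A\<close> and \<open>B\<close>, put \<open>w = \<lambda>/\<rho>\<close>, which lies in \<open>(0,1]\<close> and equals \<open>1\<close> only at the origin. Since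
  \<open>r = \<rho>(1-w)\<close>,
  \<open>(1-w) m = M (1 - w\<sigma>)\<close> with \<open>1 - w\<sigma> = (1-w)^(s+1) (1 + ln (1-w) / ln \<rho>)\<close>.
  Here \<open>\<sigma>\<close> is a multiplier (\<open>exists_quotient_symbol\<close>); the factor \<open>1-w\<close> on the left is what
  compensates the singularity of \<open>ln (1-w)\<close> at the origin. Summing a geometric progression in \<open>w\<sigma>\<close>,
  \<open>M = (1-w) \<Sum>_{k<N} (w\<sigma>)^k m + M (w\<sigma>)^N\<close>, where \<open>M (w\<sigma>)^N = \<lambda>^N \<rho>^(s-N) ln \<rho> \<sigma>^N\<close>,
  and the last symbol is a multiplier as soon as \<open>N \<ge> s+1\<close>.

  All multipliers are generated, by sums and products, from functions of \<open>r\<close> that are Laplace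
  transforms of finite positive measures on the half-line. These are Fourier transforms of positive
  integrable superpositions of heat kernels, because \<open>e^(-\<tau>r)\<close> is the Fourier transform of a heat
  kernel (\<open>Lp_multiplier_laplace\<close>). The functions in question are the powers \<open>\<rho>^(-a)\<close>, by Euler's
  integral; \<open>1 / ln \<rho>\<close>, which is the integral of \<open>\<rho>^(-t)\<close> over \<open>t > 0\<close>; \<open>ln \<rho> / (\<rho>-1)\<close>, which is
  the integral of \<open>1/((1+t)(\<rho>+t))\<close> over \<open>t > 0\<close>; and power series in \<open>w\<close> with absolutely summable
  coefficients, of which the positive and the negative ones are treated separately. Two such series
  occur, the binomial series of \<open>(1-w)^s\<close> and the series of \<open>(1-w) ln (1-w) / w\<close>.

  The formal identity has to be justified at low frequencies. The equation for \<open>u\<close> holds only modulo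
  polynomials, that is, when tested against functions vanishing to infinite order at \<open>\<xi> = 0\<close>. As
  \<open>M(D)u\<close> is not yet known to be a function, growth cannot exclude polynomials directly. The
  equation is therefore first multiplied by the smooth symbol \<open>R = (1-w) \<rho>^(-N)\<close>, chosen such that
  both \<open>R\<close> and \<open>Rm\<close> are multipliers: then \<open>v = R(D)f - (Rm)(D)u\<close> belongs to \<open>L^p\<close> and is orthogonal
  to the Fourier transforms of all Schwartz functions flat at the origin. Such a \<open>v\<close> is constant
  (\<open>constant_if_orthogonal_to_schwartz_zero\<close>). Multiplying the equation for \<open>v\<close> by \<open>\<rho>^N\<close> and by
  \<open>\<Sum>_{k<N} (w\<sigma>)^k\<close> yields the formal identity up to a constant, and as that constant is a multiple
  of the image of \<open>v\<close> under a bounded operator, its norm is controlled (\<open>a_priori_estimate\<close>).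
\<close>

section \<open>Affine changes of variables\<close>

lemma lborel_nn_integral_affine:
  fixes f :: "'a::euclidean_space \<Rightarrow> ennreal"
  assumes [measurable]: "f \<in> borel_measurable borel" and c: "c \<noteq> 0"
  shows "(\<integral>\<^sup>+x. f x \<partial>lborel) = ennreal (\<bar>c\<bar> ^ DIM('a)) * (\<integral>\<^sup>+x. f (t + c *\<^sub>R x) \<partial>lborel)"
  by (subst lborel_affine[OF c, of t])
     (simp add: nn_integral_density nn_integral_distr nn_integral_cmult)

lemma lborel_integrable_affine:
  fixes f :: "'a::euclidean_space \<Rightarrow> 'b::{banach, second_countable_topology}"
  assumes f: "integrable lborel f" and c: "c \<noteq> 0"
  shows "integrable lborel (\<lambda>x. f (t + c *\<^sub>R x))"
proof -
  have [measurable]: "f \<in> borel_measurable borel"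
    using f by auto
  have "(\<integral>\<^sup>+x. norm (f x) \<partial>lborel) < \<infinity>"
    using f by (simp add: integrable_iff_bounded)
  then have "(\<integral>\<^sup>+x. norm (f (t + c *\<^sub>R x)) \<partial>lborel) < \<infinity>"
    using c by (subst (asm) lborel_nn_integral_affine[OF _ c, of _ t])
      (auto simp: ennreal_mult_less_top)
  then show ?thesis
    by (simp add: integrable_iff_bounded)
qed

lemma lborel_integral_affine:
  fixes f :: "'a::euclidean_space \<Rightarrow> 'b::{banach, second_countable_topology}"
  assumes f[measurable]: "f \<in> borel_measurable borel" and c: "c \<noteq> 0"
  shows "(LBINT x. f x) = \<bar>c\<bar> ^ DIM('a) *\<^sub>R (LBINT x. f (t + c *\<^sub>R x))"
  by (subst lborel_affine[OF c, of t])
     (simp add: integral_density integral_distr)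

lemma lborel_AE_affine:
  fixes P :: "'a::euclidean_space \<Rightarrow> bool"
  assumes c: "c \<noteq> 0" and [measurable]: "Measurable.pred borel P" and ae: "AE x in lborel. P x"
  shows "AE x in lborel. P (t + c *\<^sub>R x)"
proof -
  have "AE x in density (distr lborel borel (\<lambda>x. t + c *\<^sub>R x)) (\<lambda>_. ennreal (\<bar>c\<bar>^DIM('a))). P x"
    using ae by (subst (asm) lborel_affine[OF c, of t])
  then show ?thesis
    using c by (simp add: AE_density AE_distr_iff)
qed

lemma lborel_integrable_shift:
  fixes f :: "'a::euclidean_space \<Rightarrow> 'b::{banach, second_countable_topology}"
  shows "integrable lborel f \<Longrightarrow> integrable lborel (\<lambda>x. f (x + a))"
  using lborel_integrable_affine[of f 1 a] by (simp add: add.commute)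

lemma lborel_integral_shift:
  fixes f :: "'a::euclidean_space \<Rightarrow> 'b::{banach, second_countable_topology}"
  shows "f \<in> borel_measurable borel \<Longrightarrow> (LBINT x. f (x + a)) = (LBINT x. f x)"
  using lborel_integral_affine[of f 1 a] by (simp add: add.commute)

section \<open>Lebesgue spaces with Borel measurable representatives\<close>

text \<open>
  Fubini's theorem is applied to functions such as \<open>(x,y) \<mapsto> v (x - y)\<close>, whose
  measurability with respect to the product sigma-algebra requires \<open>v\<close> to be Borel, not only
  Lebesgue, measurable.
\<close>

definition Lp_borel :: "ereal \<Rightarrow> (real^'n \<Rightarrow> complex) set" where
  "Lp_borel p = Lp p \<inter> borel_measurable borel"

lemma Lp_borel_measurable: "v \<in> Lp_borel p \<Longrightarrow> v \<in> borel_measurable borel"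
  by (simp add: Lp_borel_def)

lemma borel_imp_lebesgue: "f \<in> borel_measurable borel \<Longrightarrow> f \<in> borel_measurable lebesgue"
  by (metis measurable_completion measurable_lborel2)

lemma Lp_borel_finite_iff:
  assumes [measurable]: "v \<in> borel_measurable borel"
  shows "v \<in> Lp_borel (ereal q) \<longleftrightarrow> integrable lborel (\<lambda>x. norm (v x) powr q)"
  using assms borel_imp_lebesgue[OF assms]
  by (simp add: Lp_borel_def Lp_def integrable_completion)

lemma Lp_norm_finite:
  assumes [measurable]: "v \<in> borel_measurable borel"
  shows "Lp_norm (ereal q) v = (LBINT x. norm (v x) powr q) powr (1 / q)"
  by (simp add: Lp_norm_def integral_completion)

lemma Lp_norm_nonneg:
  fixes v :: "real^'n \<Rightarrow> complex"
  shows "0 \<le> Lp_norm p v"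
proof (cases "p = \<infinity>")
  case True
  have "0 \<le> esssup lebesgue (\<lambda>x. ereal (norm (v x)))"
  proof -
    have "esssup lebesgue (\<lambda>x::real^'n. 0::ereal) = 0"
      by (rule esssup_const) simp
    moreover have "esssup lebesgue (\<lambda>x::real^'n. 0::ereal) \<le> esssup lebesgue (\<lambda>x. ereal (norm (v x)))"
    proof (cases "(\<lambda>x. ereal (norm (v x))) \<in> borel_measurable lebesgue")
      case False then show ?thesis by (simp add: esssup_non_measurable)
    next
      case True then show ?thesis using esssup_AE_mono[of "\<lambda>x::real^'n. 0::ereal" lebesgue "\<lambda>x. ereal (norm (v x))"] by simp
    qed
    ultimately show ?thesis by simp
  qed
  then show ?thesis using True by (simp add: Lp_norm_def real_of_ereal_pos)
qed (simp add: Lp_norm_def)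

lemma AE_lebesgue_lborel: "(AE x in lebesgue. P x) \<longleftrightarrow> (AE x in lborel. P x)"
  by (rule AE_completion_iff)

lemma Lp_infinity_bound:
  fixes v :: "real^'n \<Rightarrow> complex"
  assumes "v \<in> Lp \<infinity>"
  shows "AE x in lborel. norm (v x) \<le> Lp_norm \<infinity> v"
proof -
  let ?e = "esssup lebesgue (\<lambda>x. ereal (norm (v x)))"
  have fin: "?e < \<infinity>" using assms by (simp add: Lp_def)
  have ae: "AE x in lebesgue. ereal (norm (v x)) \<le> ?e" by (rule esssup_AE)
  have "?e \<noteq> -\<infinity>"
  proof
    assume "?e = -\<infinity>"
    then have "AE x::real^'n in lebesgue. False" using ae by simp
    then have "AE x::real^'n in lborel. False" by (simp only: AE_lebesgue_lborel)
    then have "UNIV \<in> null_sets (lborel :: (real^'n) measure)" by (simp add: AE_iff_null_sets)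
    then show False by (simp add: null_sets_def)
  qed
  with fin have "ereal (real_of_ereal ?e) = ?e" by (cases ?e) auto
  then have "AE x in lebesgue. norm (v x) \<le> real_of_ereal ?e"
    using ae by (metis (mono_tags, lifting) AE_mp AE_I2 ereal_less_eq(3))
  then show ?thesis by (simp add: Lp_norm_def AE_lebesgue_lborel)
qed

lemma Lp_infinityI:
  assumes v: "v \<in> borel_measurable borel" and b: "AE x in lborel. norm (v x) \<le> B"
  shows "v \<in> Lp_borel \<infinity>" "0 \<le> B \<Longrightarrow> Lp_norm \<infinity> v \<le> B"
proof -
  note [measurable] = borel_imp_lebesgue[OF v]
  have le: "esssup lebesgue (\<lambda>x. ereal (norm (v x))) \<le> ereal B"
    using b by (intro esssup_I) (auto simp: AE_lebesgue_lborel)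
  then show "v \<in> Lp_borel \<infinity>" using v borel_imp_lebesgue[OF v] by (auto simp: Lp_borel_def Lp_def)
  show "Lp_norm \<infinity> v \<le> B" if "0 \<le> B"
    using that le by (cases "esssup lebesgue (\<lambda>x. ereal (norm (v x)))") (auto simp: Lp_norm_def)
qed

lemma Lp_norm_cong_AE:
  assumes "AE x in lborel. u x = v x" "u \<in> borel_measurable lebesgue" "v \<in> borel_measurable lebesgue"
  shows "Lp_norm p u = Lp_norm p v" "u \<in> Lp p \<longleftrightarrow> v \<in> Lp p"
proof -
  note [measurable] = assms(2,3)
  have ae: "AE x in lebesgue. u x = v x" using assms(1) by (simp add: AE_lebesgue_lborel)
  have 1: "esssup lebesgue (\<lambda>x. ereal (norm (u x))) = esssup lebesgue (\<lambda>x. ereal (norm (v x)))"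
    using ae by (intro esssup_AE_cong) auto
  have 2: "(LINT x|lebesgue. norm (u x) powr q) = (LINT x|lebesgue. norm (v x) powr q)" for q
    using ae by (intro integral_cong_AE) auto
  have 3: "integrable lebesgue (\<lambda>x. norm (u x) powr q) = integrable lebesgue (\<lambda>x. norm (v x) powr q)" for q
    using ae by (intro integrable_cong_AE) auto
  show "Lp_norm p u = Lp_norm p v" by (simp add: Lp_norm_def 1 2)
  show "u \<in> Lp p \<longleftrightarrow> v \<in> Lp p" using assms(2,3) by (simp add: Lp_def 1 3)
qed

lemma borel_representative:
  fixes u :: "real^'n \<Rightarrow> complex"
  assumes u: "u \<in> borel_measurable lebesgue"
  obtains v where "v \<in> borel_measurable borel" "AE x in lborel. u x = v x"
proof -
  note [measurable] = u
  obtain a where a: "a \<in> borel_measurable lborel" "AE x in lborel. Re (u x) = a x"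
    using completion_ex_borel_measurable_real[of "\<lambda>x. Re (u x)" lborel] u by auto
  obtain b where b: "b \<in> borel_measurable lborel" "AE x in lborel. Im (u x) = b x"
    using completion_ex_borel_measurable_real[of "\<lambda>x. Im (u x)" lborel] u by auto
  note [measurable] = a(1) b(1)
  have "(\<lambda>x. Complex (a x) (b x)) \<in> borel_measurable borel"
    by (subst borel_measurable_complex_iff) (use a b in auto)
  moreover have "AE x in lborel. u x = Complex (a x) (b x)"
    using a(2) b(2) by eventually_elim (simp add: complex_eq_iff)
  ultimately show ?thesis by (rule that)
qed

lemma Lp_representative:
  assumes "u \<in> Lp p"
  obtains v where "v \<in> Lp_borel p" "AE x in lborel. u x = v x" "Lp_norm p v = Lp_norm p u"
proof -
  have u: "u \<in> borel_measurable lebesgue" using assms by (simp add: Lp_def)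
  obtain v where v: "v \<in> borel_measurable borel" "AE x in lborel. u x = v x"
    using borel_representative[OF u] by blast
  note c = Lp_norm_cong_AE[OF v(2) u borel_imp_lebesgue[OF v(1)]]
  show ?thesis using that[of v] v c assms by (simp add: Lp_borel_def)
qed

lemma distr_of_borel:
  assumes "u \<in> borel_measurable lebesgue" "v \<in> borel_measurable borel" "AE x in lborel. u x = v x"
    and \<phi>: "\<phi> \<in> borel_measurable borel"
  shows "distr_of u \<phi> = (LBINT x. v x * \<phi> x)"
proof -
  note [measurable] = assms(1,2) borel_imp_lebesgue[OF assms(2)] \<phi> borel_imp_lebesgue[OF \<phi>]
  have "distr_of u \<phi> = (LINT x|lebesgue. v x * \<phi> x)"
    unfolding distr_of_def using assms(3)
    by (intro integral_cong_AE) (auto simp: AE_lebesgue_lborel)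
  then show ?thesis by (simp add: integral_completion)
qed

lemma Lp_cases:
  assumes "1 \<le> (p::ereal)"
  obtains "p = \<infinity>" | q where "p = ereal q" "1 \<le> q"
  using assms by (cases p) auto

lemma add_powr_le:
  fixes a b q :: real
  assumes "0 \<le> a" "0 \<le> b" "0 \<le> q"
  shows "(a + b) powr q \<le> 2 powr q * (a powr q + b powr q)"
proof -
  have "(a + b) powr q \<le> (2 * max a b) powr q" using assms by (intro powr_mono2) auto
  also have "\<dots> = 2 powr q * max a b powr q" using assms by (simp add: powr_mult)
  also have "\<dots> \<le> 2 powr q * (a powr q + b powr q)"
    by (intro mult_left_mono) (auto simp: max_def)
  finally show ?thesis .
qed

lemma powr_subadditive:
  fixes a b t :: real
  assumes "0 \<le> a" "0 \<le> b" "0 < t" "t \<le> 1"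
  shows "(a + b) powr t \<le> a powr t + b powr t"
proof (cases "a + b = 0")
  case False
  then have pos: "a + b > 0" using assms by auto
  have *: "x \<le> x powr t" if "0 \<le> x" "x \<le> 1" for x :: real
    using that powr_mono'[of t 1 x] assms by (cases "x = 0") auto
  have "1 = a / (a+b) + b / (a+b)" using pos by (simp add: add_divide_distrib[symmetric])
  also have "\<dots> \<le> (a / (a+b)) powr t + (b / (a+b)) powr t"
    using pos assms by (intro add_mono *) (auto simp: field_simps)
  also have "\<dots> = (a powr t + b powr t) / (a+b) powr t"
    using pos assms by (simp add: powr_divide add_divide_distrib)
  finally show ?thesis using pos by (simp add: field_simps)
qed (use assms in auto)

text \<open>
  A quasi-triangle inequality suffices where constants do not matter; the factor \<open>2\<close> makes it a
  consequence of the pointwise bound for \<open>(a + b) powr q\<close>.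
\<close>

lemma Lp_norm_add:
  assumes p: "1 \<le> p" and u: "u \<in> Lp_borel p" and v: "v \<in> Lp_borel p"
  shows "(\<lambda>x. u x + v x) \<in> Lp_borel p" "Lp_norm p (\<lambda>x. u x + v x) \<le> 2 * (Lp_norm p u + Lp_norm p v)"
proof -
  note [measurable] = Lp_borel_measurable[OF u] Lp_borel_measurable[OF v]
  have "(\<lambda>x. u x + v x) \<in> Lp_borel p \<and> Lp_norm p (\<lambda>x. u x + v x) \<le> 2 * (Lp_norm p u + Lp_norm p v)"
    using p
  proof (cases rule: Lp_cases)
    case 1
    have "AE x in lborel. norm (u x) \<le> Lp_norm p u" "AE x in lborel. norm (v x) \<le> Lp_norm p v"
      using u v 1 Lp_infinity_bound by (auto simp: Lp_borel_def)
    then have "AE x in lborel. norm (u x + v x) \<le> 2 * (Lp_norm p u + Lp_norm p v)"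
    proof eventually_elim
      case (elim x)
      then show ?case
        using norm_triangle_ineq[of "u x" "v x"] Lp_norm_nonneg[of p u] Lp_norm_nonneg[of p v]
        by simp
    qed
    from Lp_infinityI[OF _ this] show ?thesis
      using Lp_norm_nonneg[of p u] Lp_norm_nonneg[of p v] 1 by auto
  next
    case (2 q)
    have iu: "integrable lborel (\<lambda>x. norm (u x) powr q)" and iv: "integrable lborel (\<lambda>x. norm (v x) powr q)"
      using u v 2 Lp_borel_finite_iff[of u q] Lp_borel_finite_iff[of v q] Lp_borel_measurable[OF u] Lp_borel_measurable[OF v] by auto
    have le: "norm (u x + v x) powr q \<le> 2 powr q * (norm (u x) powr q + norm (v x) powr q)" for x
    proof -
      have "norm (u x + v x) powr q \<le> (norm (u x) + norm (v x)) powr q"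
        using 2 by (intro powr_mono2) (auto simp: norm_triangle_ineq)
      also have "\<dots> \<le> 2 powr q * (norm (u x) powr q + norm (v x) powr q)"
        using 2 by (intro add_powr_le) auto
      finally show ?thesis .
    qed
    have i: "integrable lborel (\<lambda>x. norm (u x + v x) powr q)"
      by (rule Bochner_Integration.integrable_bound[where f="\<lambda>x. 2 powr q * (norm (u x) powr q + norm (v x) powr q)"])
         (use iu iv le in auto)
    let ?U = "\<integral>x. norm (u x) powr q \<partial>lborel" and ?V = "\<integral>x. norm (v x) powr q \<partial>lborel"
    have "(LBINT x. norm (u x + v x) powr q) \<le> (LBINT x. 2 powr q * (norm (u x) powr q + norm (v x) powr q))"
      using iu iv le i by (intro integral_mono) auto
    also have "\<dots> = 2 powr q * (?U + ?V)" using iu iv by simp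
    finally have "(LBINT x. norm (u x + v x) powr q) powr (1/q) \<le> (2 powr q * (?U + ?V)) powr (1/q)"
      using 2 by (intro powr_mono2) auto
    also have "\<dots> = 2 * (?U + ?V) powr (1/q)" using 2 by (simp add: powr_mult powr_powr)
    also have "\<dots> \<le> 2 * (?U powr (1/q) + ?V powr (1/q))"
      using 2 by (intro mult_left_mono powr_subadditive) auto
    finally show ?thesis using i 2 by (simp add: Lp_borel_finite_iff Lp_norm_finite)
  qed
  then show "(\<lambda>x. u x + v x) \<in> Lp_borel p" "Lp_norm p (\<lambda>x. u x + v x) \<le> 2 * (Lp_norm p u + Lp_norm p v)"
    by auto
qed

lemma Lp_norm_scale:
  assumes p: "1 \<le> p" and u: "u \<in> Lp_borel p"
  shows "(\<lambda>x. c * u x) \<in> Lp_borel p" "Lp_norm p (\<lambda>x. c * u x) \<le> norm c * Lp_norm p u"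
proof -
  note [measurable] = Lp_borel_measurable[OF u]
  have "(\<lambda>x. c * u x) \<in> Lp_borel p \<and> Lp_norm p (\<lambda>x. c * u x) \<le> norm c * Lp_norm p u"
    using p
  proof (cases rule: Lp_cases)
    case 1
    have "AE x in lborel. norm (u x) \<le> Lp_norm p u"
      using u 1 Lp_infinity_bound by (auto simp: Lp_borel_def)
    then have "AE x in lborel. norm (c * u x) \<le> norm c * Lp_norm p u"
      by eventually_elim (simp add: norm_mult mult_left_mono)
    from Lp_infinityI[OF _ this] show ?thesis
      using Lp_norm_nonneg[of p u] 1 by auto
  next
    case (2 q)
    have iu: "integrable lborel (\<lambda>x. norm (u x) powr q)"
      using u 2 Lp_borel_finite_iff[of u q] Lp_borel_measurable[OF u] by auto
    have eq: "norm (c * u x) powr q = norm c powr q * norm (u x) powr q" for x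
      by (simp add: norm_mult powr_mult)
    show ?thesis using iu 2
      by (simp add: Lp_borel_finite_iff Lp_norm_finite eq powr_mult powr_powr)
  qed
  then show "(\<lambda>x. c * u x) \<in> Lp_borel p" "Lp_norm p (\<lambda>x. c * u x) \<le> norm c * Lp_norm p u"
    by auto
qed

lemma le_one_plus_powr:
  fixes t q :: real
  assumes "0 \<le> t" "1 \<le> q"
  shows "t \<le> 1 + t powr q"
proof (cases "t \<le> 1")
  case False
  then have "t powr 1 \<le> t powr q" using assms by (intro powr_mono) auto
  then show ?thesis using False by auto
qed (use assms in \<open>auto intro: order_trans\<close>)

text \<open>
  Since \<open>t \<le> 1 + t^q\<close>, every \<open>L^p\<close> function is the sum of a bounded and an integrable one, whence
  it pairs with all functions that are both bounded and integrable. This treats all \<open>p\<close> alike and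
  replaces Hoelder's inequality.
\<close>

lemma Lp_pairing:
  fixes v :: "real^'n \<Rightarrow> complex"
  assumes p: "1 \<le> p" and v: "v \<in> Lp_borel p"
  shows "\<exists>C\<ge>0. \<forall>\<Phi>::real^'n\<Rightarrow>complex. \<forall>B. integrable lborel \<Phi> \<longrightarrow> (\<forall>x. norm (\<Phi> x) \<le> B) \<longrightarrow>
     integrable lborel (\<lambda>x. v x * \<Phi> x) \<and>
     norm (LBINT x. v x * \<Phi> x) \<le> C * (B + (LBINT x. norm (\<Phi> x)))"
proof -
  note [measurable] = Lp_borel_measurable[OF v]
  obtain W b where W: "integrable lborel W" "0 \<le> b" and Wnn: "\<And>x. 0 \<le> W x"
    and ae: "AE x in lborel. norm (v x) \<le> b + (W x::real)"
    using p
  proof (cases rule: Lp_cases)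
    case 1
    show ?thesis
      using that[of "\<lambda>_. 0" "Lp_norm p v"] Lp_infinity_bound[of v] v 1 Lp_norm_nonneg[of p v]
      by (auto simp: Lp_borel_def)
  next
    case (2 q)
    have "integrable lborel (\<lambda>x. norm (v x) powr q)"
      using v 2 Lp_borel_finite_iff[of v q] Lp_borel_measurable[OF v] by auto
    then show ?thesis
      using that[of "\<lambda>x. norm (v x) powr q" 1] le_one_plus_powr[of _ q] 2 by auto
  qed
  note [measurable] = borel_measurable_integrable[OF W(1)]
  define C where "C = b + (LBINT x. W x)"
  have W0: "0 \<le> (LBINT x. W x)" using Wnn by simp
  show ?thesis
  proof (intro exI[of _ C] conjI allI impI)
    show "0 \<le> C" using W0 W(2) by (simp add: C_def)
    fix \<Phi> :: "real^'n\<Rightarrow>complex" and B assume \<Phi>: "integrable lborel \<Phi>" and B: "\<forall>x. norm (\<Phi> x) \<le> B"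
    note [measurable] = borel_measurable_integrable[OF \<Phi>]
    have B0: "0 \<le> B" using B norm_ge_zero order_trans by blast
    have ae2: "AE x in lborel. norm (v x * \<Phi> x) \<le> b * norm (\<Phi> x) + B * W x"
      using ae
    proof eventually_elim
      case (elim x)
      have "norm (v x * \<Phi> x) \<le> (b + W x) * norm (\<Phi> x)"
        using elim by (simp add: norm_mult mult_right_mono)
      also have "\<dots> \<le> b * norm (\<Phi> x) + B * W x"
        using B Wnn by (simp add: distrib_right mult.commute[of B] mult_left_mono)
      finally show ?case .
    qed
    have i2: "integrable lborel (\<lambda>x. b * norm (\<Phi> x) + B * W x)" using \<Phi> W by simp
    show i: "integrable lborel (\<lambda>x. v x * \<Phi> x)"
      by (rule Bochner_Integration.integrable_bound[OF i2]) (use ae2 in auto)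
    have N0: "0 \<le> (LBINT x. norm (\<Phi> x))" by simp
    have "norm (LBINT x. v x * \<Phi> x) \<le> (LBINT x. norm (v x * \<Phi> x))" by simp
    also have "\<dots> \<le> (LBINT x. b * norm (\<Phi> x) + B * W x)"
      using i i2 ae2 by (intro integral_mono_AE) auto
    also have "\<dots> = b * (LBINT x. norm (\<Phi> x)) + B * (LBINT x. W x)"
      using \<Phi> W by simp
    also have "\<dots> \<le> C * (B + (LBINT x. norm (\<Phi> x)))"
      using B0 N0 W0 W(2) by (auto simp: C_def algebra_simps)
    finally show "norm (LBINT x. v x * \<Phi> x) \<le> C * (B + (LBINT x. norm (\<Phi> x)))" .
  qed
qed

lemma Lp_pairing_integrable:
  fixes v \<Phi> :: "real^'n \<Rightarrow> complex"
  assumes "1 \<le> p" "v \<in> Lp_borel p" "integrable lborel \<Phi>" "\<And>x. norm (\<Phi> x) \<le> B"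
  shows "integrable lborel (\<lambda>x. v x * \<Phi> x)"
  using Lp_pairing[OF assms(1,2)] assms(3,4) by blast

section \<open>Convolution with positive integrable kernels\<close>

lemma powr_above_tangent:
  fixes t c q :: real
  assumes "0 \<le> t" "0 < c" "1 \<le> q"
  shows "c powr q + q * c powr (q - 1) * (t - c) \<le> t powr q"
proof (cases "t = 0")
  case True
  have "c powr q = c powr (q - 1) * c" using assms by (simp add: powr_diff)
  then have "c powr q + q * c powr (q - 1) * (t - c) = (1 - q) * c powr (q - 1) * c"
    using True by (simp add: algebra_simps)
  also have "\<dots> \<le> 0" using assms by (simp add: mult_nonpos_nonneg)
  finally show ?thesis using True by simp
next
  case False
  have "q * c powr (q - 1) * (t - c) \<le> t powr q - c powr q"
    by (rule convex_on_imp_above_tangent[where A="{0<..}" and f="\<lambda>x. x powr q"])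
       (use assms False in \<open>auto intro!: powr_convex derivative_eq_intros simp: interior_open\<close>)
  then show ?thesis by simp
qed

text \<open>
  Young's inequality by way of Jensen's inequality for the measure \<open>K dy\<close> of mass \<open>k\<close>: integrating
  the tangent line of \<open>t^q\<close> at the mean \<open>c\<close> of \<open>norm (v (x - y))\<close> gives \<open>k c^q \<le> I x\<close>, and the
  integral over \<open>x\<close> is computed with Fubini.
\<close>

lemma Lp_convolution_finite:
  fixes K :: "real^'n \<Rightarrow> real" and v :: "real^'n \<Rightarrow> complex"
  assumes q: "1 \<le> q" and K: "integrable lborel K" and K0: "\<And>y. 0 \<le> K y"
    and vb[measurable]: "v \<in> borel_measurable borel"
    and v: "integrable lborel (\<lambda>x. norm (v x) powr q)"
  defines "g \<equiv> \<lambda>x. LBINT y. of_real (K y) * v (x - y)"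
  shows "g \<in> Lp_borel (ereal q)" "Lp_norm (ereal q) g \<le> (LBINT y. K y) * Lp_norm (ereal q) v"
proof -
  note Kb[measurable] = borel_measurable_integrable[OF K]
  define k where "k = (LBINT y. K y)"
  have k0: "0 \<le> k" using K0 by (simp add: k_def)
  have gb[measurable]: "g \<in> borel_measurable borel" unfolding g_def by measurable
  define V where "V = (LBINT x. norm (v x) powr q)"
  have V0: "0 \<le> V" by (simp add: V_def)
  define I where "I = (\<lambda>x. LBINT y. K y * norm (v (x - y)) powr q)"
  have ish: "integrable lborel (\<lambda>x. norm (v (x - y)) powr q)" for y
    using lborel_integrable_shift[OF v, of "-y"] by simp
  have ish_eq: "(LBINT x. norm (v (x - y)) powr q) = V" for y
    using lborel_integral_shift[of "\<lambda>x. norm (v x) powr q" "-y"] by (simp add: V_def)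
  have pint: "integrable (lborel \<Otimes>\<^sub>M lborel) (\<lambda>(y,x). K y * norm (v (x - y)) powr q)"
    by (rule lborel_pair.Fubini_integrable)
       (use K K0 ish in \<open>simp_all add: abs_mult ish_eq\<close>)
  have I_int: "integrable lborel I"
    unfolding I_def by (rule lborel_pair.integrable_snd[OF pint])
  have I_eq: "(LBINT x. I x) = k * V"
    unfolding I_def using lborel_pair.Fubini_integral[OF pint] by (simp add: ish_eq k_def)
  have ae: "AE x in lborel. integrable lborel (\<lambda>y. K y * norm (v (x - y)) powr q)"
    by (rule lborel_pair.AE_integrable_snd[OF pint])
  have ae_bound: "AE x in lborel. norm (g x) powr q \<le> k powr (q - 1) * I x"
    using ae
  proof eventually_elim
    case (elim x)
    have iK: "integrable lborel (\<lambda>y. K y * norm (v (x - y)))"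
    proof (rule Bochner_Integration.integrable_bound[where f="\<lambda>y. K y + K y * norm (v (x - y)) powr q"])
      show "AE y in lborel. norm (K y * norm (v (x - y))) \<le> norm (K y + K y * norm (v (x - y)) powr q)"
      proof (rule AE_I2)
        fix y
        have "K y * norm (v (x - y)) \<le> K y * (1 + norm (v (x - y)) powr q)"
          using K0 q by (intro mult_left_mono le_one_plus_powr) auto
        then show "norm (K y * norm (v (x - y))) \<le> norm (K y + K y * norm (v (x - y)) powr q)"
          using K0[of y] by (simp add: abs_mult distrib_left)
      qed
    qed (use K elim in auto)
    define m where "m = (LBINT y. K y * norm (v (x - y)))"
    have m0: "0 \<le> m" using K0 by (simp add: m_def)
    have gm: "norm (g x) \<le> m"
    proof -
      have "norm (g x) \<le> (LBINT y. norm (of_real (K y) * v (x - y)))"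
        unfolding g_def by (rule integral_norm_bound)
      then show ?thesis using K0 by (simp add: m_def norm_mult)
    qed
    show ?case
    proof (cases "m = 0")
      case True
      have "0 \<le> I x" unfolding I_def using K0 by (intro integral_nonneg_AE) auto
      then show ?thesis using gm True by simp
    next
      case False
      then have mpos: "0 < m" using m0 by simp
      have kpos: "0 < k"
      proof (rule ccontr)
        assume "\<not> 0 < k"
        then have "k = 0" using k0 by simp
        then have "AE y in lborel. K y = 0"
          using integral_nonneg_eq_0_iff_AE[OF K] K0 by (simp add: k_def)
        then have "m = 0" unfolding m_def by (intro integral_eq_zero_AE) auto
        then show False using mpos by simp
      qed
      \<comment> \<open>With this \<open>c\<close>, the linear term of the tangent integrates to zero.\<close>
      define c where "c = m / k"
      have cpos: "0 < c" using mpos kpos by (simp add: c_def)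
      have "(LBINT y. K y * c powr q + q * c powr (q - 1) * (K y * norm (v (x - y)) - K y * c)) \<le> I x"
        unfolding I_def
      proof (rule integral_mono)
        fix y
        have "K y * (c powr q + q * c powr (q - 1) * (norm (v (x - y)) - c)) \<le> K y * norm (v (x - y)) powr q"
          using K0 powr_above_tangent[of "norm (v (x - y))" c q] cpos q by (intro mult_left_mono) auto
        then show "K y * c powr q + q * c powr (q - 1) * (K y * norm (v (x - y)) - K y * c) \<le> K y * norm (v (x - y)) powr q"
          by (simp add: algebra_simps)
      qed (use K iK elim in auto)
      also have "(LBINT y. K y * c powr q + q * c powr (q - 1) * (K y * norm (v (x - y)) - K y * c))
         = k * c powr q + q * c powr (q - 1) * (m - k * c)"
        using K iK by (simp add: k_def m_def)
      also have "m - k * c = 0" using kpos by (simp add: c_def)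
      finally have *: "k * c powr q \<le> I x" by simp
      have "norm (g x) powr q \<le> m powr q" using gm q by (intro powr_mono2) auto
      also have "m powr q = (k * c) powr q" using kpos by (simp add: c_def)
      also have "\<dots> = k powr (q - 1) * (k * c powr q)"
        using kpos cpos by (simp add: powr_mult powr_diff)
      also have "\<dots> \<le> k powr (q - 1) * I x" using * by (intro mult_left_mono) auto
      finally show ?thesis .
    qed
  qed
  have i2: "integrable lborel (\<lambda>x. k powr (q - 1) * I x)" using I_int by simp
  have ig: "integrable lborel (\<lambda>x. norm (g x) powr q)"
    by (rule Bochner_Integration.integrable_bound[OF i2]) (use ae_bound in auto)
  show "g \<in> Lp_borel (ereal q)" using ig by (simp add: Lp_borel_finite_iff)
  have "(LBINT x. norm (g x) powr q) \<le> (LBINT x. k powr (q - 1) * I x)"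
    using ig i2 ae_bound by (intro integral_mono_AE) auto
  also have "\<dots> = k powr q * V"
    using k0 by (cases "k = 0") (simp_all add: I_eq powr_diff)
  finally have "(LBINT x. norm (g x) powr q) powr (1/q) \<le> (k powr q * V) powr (1/q)"
    using q by (intro powr_mono2) auto
  also have "\<dots> = k * V powr (1/q)" using q k0 by (simp add: powr_mult powr_powr)
  finally show "Lp_norm (ereal q) g \<le> k * Lp_norm (ereal q) v"
    by (simp add: Lp_norm_finite V_def)
qed

lemma Lp_convolution_infinite:
  fixes K :: "real^'n \<Rightarrow> real" and v :: "real^'n \<Rightarrow> complex"
  assumes K: "integrable lborel K" and K0: "\<And>y. 0 \<le> K y" and v: "v \<in> Lp_borel \<infinity>"
  defines "g \<equiv> \<lambda>x. LBINT y. of_real (K y) * v (x - y)"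
  shows "g \<in> Lp_borel \<infinity>" "Lp_norm \<infinity> g \<le> (LBINT y. K y) * Lp_norm \<infinity> v"
proof -
  note [measurable] = borel_measurable_integrable[OF K] Lp_borel_measurable[OF v]
  have gb: "g \<in> borel_measurable borel" unfolding g_def by measurable
  let ?B = "Lp_norm \<infinity> v"
  have vB: "AE x in lborel. norm (v x) \<le> ?B" using v by (intro Lp_infinity_bound) (simp add: Lp_borel_def)
  have "norm (g x) \<le> (LBINT y. K y) * ?B" for x
  proof -
    have ae: "AE y in lborel. norm (v (x - y)) \<le> ?B"
      using lborel_AE_affine[of "-1" "\<lambda>y. norm (v y) \<le> ?B" x] vB by simp
    have "norm (g x) \<le> (LBINT y. norm (of_real (K y) * v (x - y)))"
      unfolding g_def by (rule integral_norm_bound)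
    also have "\<dots> \<le> (LBINT y. K y * ?B)"
    proof (rule integral_mono_AE')
      show "AE y in lborel. norm (of_real (K y) * v (x - y)) \<le> K y * ?B"
        using ae K0 by (auto simp: norm_mult intro!: mult_left_mono)
    qed (use K K0 Lp_norm_nonneg[of \<infinity> v] in auto)
    finally show ?thesis by simp
  qed
  then have b: "AE x in lborel. norm (g x) \<le> (LBINT y. K y) * ?B" by simp
  have "0 \<le> (LBINT y. K y) * ?B" using K0 Lp_norm_nonneg[of \<infinity> v] by simp
  with Lp_infinityI[OF gb b] show "g \<in> Lp_borel \<infinity>" "Lp_norm \<infinity> g \<le> (LBINT y. K y) * Lp_norm \<infinity> v"
    by auto
qed

lemma Lp_convolution:
  fixes K :: "real^'n \<Rightarrow> real" and v :: "real^'n \<Rightarrow> complex"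
  assumes p: "1 \<le> p" and K: "integrable lborel K" and K0: "\<And>y. 0 \<le> K y" and v: "v \<in> Lp_borel p"
  defines "g \<equiv> \<lambda>x. LBINT y. of_real (K y) * v (x - y)"
  shows "g \<in> Lp_borel p" "Lp_norm p g \<le> (LBINT y. K y) * Lp_norm p v"
proof -
  have "g \<in> Lp_borel p \<and> Lp_norm p g \<le> (LBINT y. K y) * Lp_norm p v"
    using p
  proof (cases rule: Lp_cases)
    case 1
    then show ?thesis using Lp_convolution_infinite[OF K K0] v unfolding g_def by simp
  next
    case (2 q)
    have "integrable lborel (\<lambda>x. norm (v x) powr q)"
      using v 2 Lp_borel_finite_iff[of v q] Lp_borel_measurable[OF v] by auto
    then show ?thesis using Lp_convolution_finite[OF _ K K0 Lp_borel_measurable[OF v]] 2 unfolding g_def by simp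
  qed
  then show "g \<in> Lp_borel p" "Lp_norm p g \<le> (LBINT y. K y) * Lp_norm p v" by auto
qed

lemma reflected_product_integrable:
  fixes K :: "real^'n \<Rightarrow> real" and \<Phi> :: "real^'n \<Rightarrow> complex"
  assumes K: "integrable lborel K" and K0: "\<And>y. 0 \<le> K y" and \<Phi>: "integrable lborel \<Phi>"
  shows "integrable (lborel \<Otimes>\<^sub>M lborel) (\<lambda>(y,z). of_real (K y) * \<Phi> (z + y))"
proof -
  note [measurable] = borel_measurable_integrable[OF K] borel_measurable_integrable[OF \<Phi>]
  have sh: "integrable lborel (\<lambda>z. \<Phi> (z + y))" for y by (rule lborel_integrable_shift[OF \<Phi>])
  have sh_eq: "(LBINT z. norm (\<Phi> (z + y))) = (LBINT z. norm (\<Phi> z))" for y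
    using lborel_integral_shift[of "\<lambda>z. norm (\<Phi> z)" y] by simp
  show ?thesis
    by (rule lborel_pair.Fubini_integrable) (use K K0 sh in \<open>simp_all add: norm_mult sh_eq\<close>)
qed

text \<open>
  Fubini's theorem applies because the double integral of absolute values converges when taken
  over \<open>y\<close> first: that inner integral \<open>H z\<close> is bounded and integrable, so it pairs with \<open>v\<close>.
\<close>

lemma Lp_convolution_adjoint:
  fixes K :: "real^'n \<Rightarrow> real" and v \<Phi> :: "real^'n \<Rightarrow> complex"
  assumes p: "1 \<le> p" and K: "integrable lborel K" and K0: "\<And>y. 0 \<le> K y" and v: "v \<in> Lp_borel p"
    and \<Phi>: "integrable lborel \<Phi>" and B: "\<And>x. norm (\<Phi> x) \<le> B"
  shows "(LBINT x. (LBINT y. of_real (K y) * v (x - y)) * \<Phi> x)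
       = (LBINT z. v z * (LBINT y. of_real (K y) * \<Phi> (z + y)))"
proof -
  note [measurable] = borel_measurable_integrable[OF K] Lp_borel_measurable[OF v] borel_measurable_integrable[OF \<Phi>]
  note 1 = reflected_product_integrable[OF K K0 \<Phi>]
  define H where "H = (\<lambda>z. LBINT y. K y * norm (\<Phi> (z + y)))"
  have 2: "integrable (lborel \<Otimes>\<^sub>M lborel) (\<lambda>(y,z). K y * norm (\<Phi> (z + y)))"
    using integrable_norm[OF 1] K0 by (simp add: case_prod_unfold norm_mult)
  have H_int: "integrable lborel H"
    unfolding H_def by (rule lborel_pair.integrable_snd[OF 2])
  have iKb: "integrable lborel (\<lambda>y. K y * norm (\<Phi> (z + y)))" for z
    by (rule Bochner_Integration.integrable_bound[where f="\<lambda>y. K y * B"])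
       (use K K0 B order_trans[OF norm_ge_zero B] in \<open>auto simp: abs_mult intro!: mult_left_mono\<close>)
  have H0: "0 \<le> H z" for z unfolding H_def using K0 by (intro integral_nonneg_AE) auto
  have HB: "norm (complex_of_real (H z)) \<le> (LBINT y. K y) * B" for z
  proof -
    have "H z \<le> (LBINT y. K y * B)"
      unfolding H_def using iKb K B K0 by (intro integral_mono) (auto intro!: mult_left_mono)
    then show ?thesis using H0[of z] by simp
  qed
  have 3: "integrable lborel (\<lambda>z. v z * complex_of_real (H z))"
    by (rule Lp_pairing_integrable[OF p v _ HB]) (use H_int in simp)
  have iK: "integrable lborel (\<lambda>y. of_real (K y) * \<Phi> (z + y))" for z
    by (rule Bochner_Integration.integrable_bound[OF iKb[of z]]) (auto simp: norm_mult)
  have 4: "integrable (lborel \<Otimes>\<^sub>M lborel) (\<lambda>(z,y). of_real (K y) * v z * \<Phi> (z + y))"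
  proof (rule lborel_pair.Fubini_integrable)
    have "(\<lambda>z. LBINT y. norm (case (z,y) of (z,y) \<Rightarrow> of_real (K y) * v z * \<Phi> (z + y)))
       = (\<lambda>z. norm (v z * complex_of_real (H z)))"
    proof
      fix z
      have "(LBINT y. norm (case (z,y) of (z,y) \<Rightarrow> of_real (K y) * v z * \<Phi> (z + y)))
         = (LBINT y. norm (v z) * (K y * norm (\<Phi> (z + y))))"
        using K0 by (intro Bochner_Integration.integral_cong) (auto simp: norm_mult)
      also have "\<dots> = norm (v z) * H z" by (simp add: H_def)
      finally show "(LBINT y. norm (case (z,y) of (z,y) \<Rightarrow> of_real (K y) * v z * \<Phi> (z + y)))
         = norm (v z * complex_of_real (H z))" using H0[of z] by (simp add: norm_mult)
    qed
    then show "integrable lborel (\<lambda>z. LBINT y. norm (case (z,y) of (z,y) \<Rightarrow> of_real (K y) * v z * \<Phi> (z + y)))"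
      using integrable_norm[OF 3] by simp
    show "AE z in lborel. integrable lborel (\<lambda>y. case (z,y) of (z,y) \<Rightarrow> of_real (K y) * v z * \<Phi> (z + y))"
      using iK by (simp add: mult.assoc mult.left_commute[of _ "v _"])
  qed measurable
  have 5: "integrable (lborel \<Otimes>\<^sub>M lborel) (\<lambda>(y,z). of_real (K y) * v z * \<Phi> (z + y))"
    using lborel_pair.integrable_product_swap[OF 4] by (simp add: case_prod_beta)
  have shy: "(LBINT z. of_real (K y) * v z * \<Phi> (z + y)) = (LBINT x. of_real (K y) * v (x - y) * \<Phi> x)" for y
    using lborel_integral_shift[of "\<lambda>x. of_real (K y) * v (x - y) * \<Phi> x" y] by simp
  have shn: "(LBINT z. norm (of_real (K y) * v z * \<Phi> (z + y))) = (LBINT x. norm (of_real (K y) * v (x - y) * \<Phi> x))" for y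
    using lborel_integral_shift[of "\<lambda>x. norm (of_real (K y) * v (x - y) * \<Phi> x)" y] by simp
  have 6: "integrable (lborel \<Otimes>\<^sub>M lborel) (\<lambda>(y,x). of_real (K y) * v (x - y) * \<Phi> x)"
  proof (rule lborel_pair.Fubini_integrable)
    show "integrable lborel (\<lambda>y. LBINT x. norm (case (y,x) of (y,x) \<Rightarrow> of_real (K y) * v (x - y) * \<Phi> x))"
      using lborel_pair.integrable_fst'[OF integrable_norm[OF 5]] by (simp add: shn)
    show "AE y in lborel. integrable lborel (\<lambda>x. case (y,x) of (y,x) \<Rightarrow> of_real (K y) * v (x - y) * \<Phi> x)"
      using lborel_pair.AE_integrable_fst'[OF 5]
    proof eventually_elim
      case (elim y)
      then show ?case using lborel_integrable_shift[OF elim, of "-y"] by simp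
    qed
  qed measurable
  have "(LBINT x. (LBINT y. of_real (K y) * v (x - y)) * \<Phi> x)
     = (LBINT x. (LBINT y. of_real (K y) * v (x - y) * \<Phi> x))" by simp
  also have "\<dots> = (LBINT y. (LBINT x. of_real (K y) * v (x - y) * \<Phi> x))"
    by (rule lborel_pair.Fubini_integral[OF 6])
  also have "\<dots> = (LBINT y. (LBINT z. of_real (K y) * v z * \<Phi> (z + y)))"
    by (simp add: shy)
  also have "\<dots> = (LBINT z. (LBINT y. of_real (K y) * v z * \<Phi> (z + y)))"
    by (rule lborel_pair.Fubini_integral[OF 4])
  also have "\<dots> = (LBINT z. v z * (LBINT y. of_real (K y) * \<Phi> (z + y)))"
    by (simp add: mult.assoc mult.left_commute[of _ "v _"])
  finally show "(LBINT x. (LBINT y. of_real (K y) * v (x - y)) * \<Phi> x)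
       = (LBINT z. v z * (LBINT y. of_real (K y) * \<Phi> (z + y)))" .
qed

section \<open>Plane waves, Gaussians and Fourier inversion\<close>

definition plane_wave :: "'a::euclidean_space \<Rightarrow> 'a \<Rightarrow> complex" where
  "plane_wave x \<xi> = cis (2 * pi * (x \<bullet> \<xi>))"

lemma norm_plane_wave [simp]: "norm (plane_wave x \<xi>) = 1"
  by (simp add: plane_wave_def)

lemma plane_wave_measurable [measurable (raw)]:
  assumes [measurable]: "f \<in> borel_measurable M" "g \<in> borel_measurable M"
  shows "(\<lambda>x. plane_wave (f x) (g x)) \<in> borel_measurable M"
  unfolding plane_wave_def cis_conv_exp by measurable

lemma plane_wave_add: "plane_wave (x + y) \<xi> = plane_wave x \<xi> * plane_wave y \<xi>"
  by (simp add: plane_wave_def inner_add_left distrib_left cis_mult)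

lemma plane_wave_zero [simp]: "plane_wave 0 \<xi> = 1" "plane_wave x 0 = 1"
  by (simp_all add: plane_wave_def)

lemma plane_wave_commute: "plane_wave x \<xi> = plane_wave \<xi> x"
  by (simp add: plane_wave_def inner_commute)

lemma plane_wave_minus: "plane_wave (-x) \<xi> = plane_wave x (-\<xi>)"
  by (simp add: plane_wave_def)

lemma inv_fourier_eq:
  fixes \<psi> :: "real^'n \<Rightarrow> complex"
  assumes "\<psi> \<in> borel_measurable borel"
  shows "inv_fourier \<psi> x = (LBINT \<xi>. \<psi> \<xi> * plane_wave x \<xi>)"
proof -
  have e: "exp (2 * of_real pi * \<i> * of_real (x \<bullet> \<xi>)) = plane_wave x \<xi>" for \<xi>
    by (simp add: plane_wave_def cis_conv_exp mult_ac)
  note [measurable] = assms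
  show ?thesis unfolding inv_fourier_def e
    by (rule integral_completion) measurable
qed

lemma fourier_eq:
  fixes \<phi> :: "real^'n \<Rightarrow> complex"
  assumes "\<phi> \<in> borel_measurable borel"
  shows "fourier \<phi> \<xi> = (LBINT x. \<phi> x * plane_wave (-\<xi>) x)"
proof -
  have e: "exp (- 2 * of_real pi * \<i> * of_real (x \<bullet> \<xi>)) = plane_wave (-\<xi>) x" for x
    by (simp add: plane_wave_def cis_conv_exp mult_ac inner_commute)
  note [measurable] = assms
  show ?thesis unfolding fourier_def e
    by (rule integral_completion) measurable
qed

lemma fourier_eq_inv_fourier:
  fixes \<phi> :: "real^'n \<Rightarrow> complex"
  assumes "\<phi> \<in> borel_measurable borel"
  shows "fourier \<phi> \<xi> = inv_fourier \<phi> (-\<xi>)"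
  using assms by (simp add: fourier_eq inv_fourier_eq)

lemma inv_fourier_measurable [measurable]:
  fixes \<psi> :: "real^'n \<Rightarrow> complex"
  assumes [measurable]: "\<psi> \<in> borel_measurable borel"
  shows "inv_fourier \<psi> \<in> borel_measurable borel"
proof -
  have "inv_fourier \<psi> = (\<lambda>x. LBINT \<xi>. \<psi> \<xi> * plane_wave x \<xi>)"
    using assms by (intro ext inv_fourier_eq)
  then show ?thesis by simp
qed

abbreviation symbol_mult :: "('a \<Rightarrow> real) \<Rightarrow> ('a \<Rightarrow> complex) \<Rightarrow> 'a \<Rightarrow> complex"  (infixl "\<odot>" 70) where
  "h \<odot> \<psi> \<equiv> \<lambda>\<xi>. of_real (h \<xi>) * \<psi> \<xi>"

text \<open>
  This is the pairing of the Fourier transform of \<open>v\<close> with \<open>\<psi>\<close>, so that \<open>\<langle>v, h \<odot> \<psi>\<rangle>\<close> is the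
  pairing of \<open>h(D) v\<close> with the inverse transform of \<open>\<psi>\<close>.
\<close>

abbreviation pairing :: "(real^'n \<Rightarrow> complex) \<Rightarrow> (real^'n \<Rightarrow> complex) \<Rightarrow> complex"  ("\<langle>_,/ _\<rangle>") where
  "\<langle>v, \<psi>\<rangle> \<equiv> (LBINT x. v x * inv_fourier \<psi> x)"

lemma integrable_mult_plane_wave:
  fixes \<psi> :: "'a::euclidean_space \<Rightarrow> complex"
  assumes "integrable lborel \<psi>"
  shows "integrable lborel (\<lambda>\<xi>. \<psi> \<xi> * plane_wave x \<xi>)"
  by (rule Bochner_Integration.integrable_bound[OF assms])
     (use borel_measurable_integrable[OF assms] in \<open>auto simp: norm_mult\<close>)

lemma norm_inv_fourier_le:
  fixes \<psi> :: "real^'n \<Rightarrow> complex"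
  assumes "integrable lborel \<psi>"
  shows "norm (inv_fourier \<psi> x) \<le> (LBINT \<xi>. norm (\<psi> \<xi>))"
proof -
  have "norm (inv_fourier \<psi> x) \<le> (LBINT \<xi>. norm (\<psi> \<xi> * plane_wave x \<xi>))"
    using borel_measurable_integrable[OF assms] by (subst inv_fourier_eq) (auto intro!: integral_norm_bound)
  then show ?thesis by (simp add: norm_mult)
qed

lemma lborel_product_integral:
  fixes g :: "'a::euclidean_space \<Rightarrow> real \<Rightarrow> complex"
  assumes g: "\<And>b. b \<in> Basis \<Longrightarrow> integrable lborel (g b)"
  shows "integrable lborel (\<lambda>x::'a. \<Prod>b\<in>Basis. g b (x \<bullet> b))"
    and "(LBINT x. (\<Prod>b\<in>Basis. g b ((x::'a) \<bullet> b))) = (\<Prod>b\<in>Basis. \<integral>t. g b t \<partial>lborel)"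
proof -
  interpret product_sigma_finite "\<lambda>b::'a. lborel :: real measure" by standard
  define F where "F = (\<lambda>x::'a. \<Prod>b\<in>Basis. g b (x \<bullet> b))"
  have gm: "g b \<in> borel_measurable borel" if "b \<in> Basis" for b
    using borel_measurable_integrable[OF g[OF that]] by simp
  have Fm[measurable]: "F \<in> borel_measurable borel"
    unfolding F_def by (intro borel_measurable_prod measurable_compose[OF _ gm]) auto
  have Tm[measurable]: "(\<lambda>f. \<Sum>b\<in>Basis. f b *\<^sub>R b) \<in> measurable (\<Pi>\<^sub>M b\<in>Basis. lborel) (borel :: 'a measure)"
    by measurable
  have FT: "F (\<Sum>b\<in>Basis. f b *\<^sub>R b) = (\<Prod>b\<in>Basis. g b (f b))" for f
    unfolding F_def by (intro prod.cong) auto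
  have int: "integrable (\<Pi>\<^sub>M b\<in>Basis. lborel) (\<lambda>f. \<Prod>b\<in>(Basis::'a set). g b (f b))"
    by (rule product_integrable_prod) (use g in auto)
  have "integrable lborel F"
    unfolding lborel_eq[where 'a='a] by (subst integrable_distr_eq) (use int in \<open>simp_all add: FT\<close>)
  moreover have "integral\<^sup>L lborel F = (\<Prod>b\<in>Basis. \<integral>t. g b t \<partial>lborel)"
    unfolding lborel_eq[where 'a='a]
    by (subst integral_distr) (use product_integral_prod[of Basis g] g in \<open>simp_all add: FT\<close>)
  ultimately show "integrable lborel (\<lambda>x::'a. \<Prod>b\<in>Basis. g b (x \<bullet> b))"
    "(LBINT x. (\<Prod>b\<in>Basis. g b ((x::'a) \<bullet> b))) = (\<Prod>b\<in>Basis. \<integral>t. g b t \<partial>lborel)"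
    by (auto simp: F_def)
qed

lemma gaussian_fourier_1d:
  fixes a b :: real
  assumes a: "0 < a"
  shows "integrable lborel (\<lambda>x. of_real (exp (- a * x\<^sup>2)) * cis (b * x))"
    and "(LBINT x. of_real (exp (- a * x\<^sup>2)) * cis (b * x)) = of_real (sqrt (pi / a) * exp (- b\<^sup>2 / (4 * a)))"
proof -
  define c where "c = sqrt (2 * a)"
  have c: "c \<noteq> 0" "0 < c" "c\<^sup>2 = 2 * a" using a by (auto simp: c_def)
  have em[measurable]: "(\<lambda>x. exp (\<i> * complex_of_real (b / c * x))) \<in> borel_measurable borel"
    by (intro borel_measurable_continuous_onI continuous_intros)
  define F where "F = (\<lambda>x. std_normal_density x *\<^sub>R cis (b / c * x))"
  have Fm[measurable]: "F \<in> borel_measurable borel"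
    unfolding F_def cis_conv_exp by (intro borel_measurable_scaleR em borel_measurable_normal_density)
  have iF: "integrable lborel F"
  proof (rule Bochner_Integration.integrable_bound[OF integrable_normal_density[of 1 0]])
    show "F \<in> borel_measurable lborel" using Fm by simp
    show "AE x in lborel. norm (F x) \<le> norm (std_normal_density x)" by (simp add: F_def)
  qed simp
  have "char std_normal_distribution (b / c) = (LBINT x. F x)"
    unfolding char_def F_def
    by (subst integral_density) (use em borel_measurable_normal_density[of 0 1] in \<open>auto simp: cis_conv_exp mult_ac\<close>)
  then have intF: "(LBINT x. F x) = of_real (exp (- ((b / c)\<^sup>2) / 2))"
    by (simp add: char_std_normal_distribution)
  have Fc: "F (c * x) = of_real (1 / sqrt (2 * pi)) * (of_real (exp (- a * x\<^sup>2)) * cis (b * x))" for x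
    using c by (simp add: F_def std_normal_density_def power_mult_distrib scaleR_conv_of_real)
  have "integrable lborel (\<lambda>x. F (0 + c * x))"
    using lborel_integrable_real_affine[OF iF c(1)] .
  then have "integrable lborel (\<lambda>x. of_real (sqrt (2 * pi)) * F (c * x))" by simp
  then show 1: "integrable lborel (\<lambda>x. of_real (exp (- a * x\<^sup>2)) * cis (b * x))"
    unfolding Fc by (simp add: mult.assoc[symmetric])
  have "(LBINT x. F x) = \<bar>c\<bar> *\<^sub>R (LBINT x. F (0 + c * x))"
    by (rule lborel_integral_real_affine[OF c(1)])
  also have "\<dots> = of_real (c / sqrt (2 * pi)) * (LBINT x. of_real (exp (- a * x\<^sup>2)) * cis (b * x))"
    using c by (simp add: Fc scaleR_conv_of_real)
  finally have "(LBINT x. of_real (exp (- a * x\<^sup>2)) * cis (b * x))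
      = of_real (sqrt (2 * pi) / c) * of_real (exp (- ((b / c)\<^sup>2) / 2))"
    using c intF by (simp add: field_simps)
  also have "sqrt (2 * pi) / c = sqrt (pi / a)"
    using a by (simp add: c_def real_sqrt_divide[symmetric])
  also have "- ((b / c)\<^sup>2) / 2 = - b\<^sup>2 / (4 * a)"
    using c by (simp add: power_divide)
  finally show "(LBINT x. of_real (exp (- a * x\<^sup>2)) * cis (b * x)) = of_real (sqrt (pi / a) * exp (- b\<^sup>2 / (4 * a)))"
    by simp
qed

lemma norm_sq_Basis: "(norm (x::'a::euclidean_space))\<^sup>2 = (\<Sum>b\<in>Basis. (x \<bullet> b)\<^sup>2)"
  by (subst power2_norm_eq_inner, subst euclidean_inner) (simp add: power2_eq_square)

lemma gaussian_fourier:
  fixes z :: "'a::euclidean_space"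
  assumes a: "0 < a"
  shows "integrable lborel (\<lambda>\<xi>::'a. of_real (exp (- a * (norm \<xi>)\<^sup>2)) * plane_wave z \<xi>)"
    and "(LBINT \<xi>. of_real (exp (- a * (norm \<xi>)\<^sup>2)) * plane_wave z \<xi>)
       = of_real ((pi / a) powr (DIM('a) / 2) * exp (- pi\<^sup>2 * (norm z)\<^sup>2 / a))"
proof -
  define g where "g = (\<lambda>(b::'a) t. complex_of_real (exp (- a * t\<^sup>2)) * cis ((2 * pi * (z \<bullet> b)) * t))"
  have g: "integrable lborel (g b)" for b
    unfolding g_def by (rule gaussian_fourier_1d[OF a])
  have eq: "(\<Prod>b\<in>Basis. g b (\<xi> \<bullet> b)) = of_real (exp (- a * (norm \<xi>)\<^sup>2)) * plane_wave z \<xi>" for \<xi> :: 'a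
  proof -
    have "(\<Prod>b\<in>Basis. g b (\<xi> \<bullet> b)) = (\<Prod>b\<in>Basis. complex_of_real (exp (- a * (\<xi> \<bullet> b)\<^sup>2))) * (\<Prod>b\<in>Basis. cis ((2 * pi * (z \<bullet> b)) * (\<xi> \<bullet> b)))"
      by (simp add: g_def prod.distrib)
    also have "(\<Prod>b\<in>Basis. complex_of_real (exp (- a * (\<xi> \<bullet> b)\<^sup>2))) = of_real (exp (- a * (norm \<xi>)\<^sup>2))"
      by (simp add: norm_sq_Basis exp_sum[symmetric] sum_distrib_left of_real_prod[symmetric] sum_negf del: of_real_prod)
    also have "(\<Prod>b\<in>Basis. cis ((2 * pi * (z \<bullet> b)) * (\<xi> \<bullet> b))) = plane_wave z \<xi>"
      by (simp add: plane_wave_def cis_conv_exp exp_sum[symmetric] euclidean_inner[of z \<xi>] sum_distrib_left mult_ac)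
    finally show ?thesis .
  qed
  show "integrable lborel (\<lambda>\<xi>::'a. of_real (exp (- a * (norm \<xi>)\<^sup>2)) * plane_wave z \<xi>)"
    using lborel_product_integral(1)[of g] g by (simp add: eq)
  have "(LBINT \<xi>. of_real (exp (- a * (norm \<xi>)\<^sup>2)) * plane_wave z \<xi>) = (\<Prod>b\<in>Basis. \<integral>t. g b t \<partial>lborel)"
    using lborel_product_integral(2)[of g] g by (simp add: eq)
  also have "\<dots> = (\<Prod>b\<in>Basis. complex_of_real (sqrt (pi / a) * exp (- pi\<^sup>2 * (z \<bullet> b)\<^sup>2 / a)))"
  proof (rule prod.cong)
    fix b :: 'a
    have e: "- (2 * pi * (z \<bullet> b))\<^sup>2 / (4 * a) = - pi\<^sup>2 * (z \<bullet> b)\<^sup>2 / a"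
      using a by (simp add: power_mult_distrib field_simps)
    show "(LBINT t. g b t) = complex_of_real (sqrt (pi / a) * exp (- pi\<^sup>2 * (z \<bullet> b)\<^sup>2 / a))"
      unfolding g_def gaussian_fourier_1d(2)[OF a] e ..
  qed simp
  also have "\<dots> = of_real (\<Prod>b\<in>(Basis::'a set). sqrt (pi / a) * exp (- pi\<^sup>2 * (z \<bullet> b)\<^sup>2 / a))"
    by simp
  also have "(\<Prod>b\<in>(Basis::'a set). sqrt (pi / a) * exp (- pi\<^sup>2 * (z \<bullet> b)\<^sup>2 / a))
      = sqrt (pi / a) ^ DIM('a) * exp (- pi\<^sup>2 * (norm z)\<^sup>2 / a)"
    by (simp add: prod.distrib exp_sum[symmetric] norm_sq_Basis sum_distrib_left sum_divide_distrib sum_negf)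
  also have "sqrt (pi / a) ^ DIM('a) = (pi / a) powr (DIM('a) / 2)"
    using a by (simp add: powr_half_sqrt[symmetric] powr_realpow[symmetric] powr_powr)
  finally show "(LBINT \<xi>. of_real (exp (- a * (norm \<xi>)\<^sup>2)) * plane_wave z \<xi>)
       = of_real ((pi / a) powr (DIM('a) / 2) * exp (- pi\<^sup>2 * (norm z)\<^sup>2 / a))" .
qed

text \<open>
  The heat kernel at time \<open>\<tau>\<close>, normalised so that its Fourier transform is \<open>e^(-4\<pi>\<^sup>2\<tau>|\<xi>|\<^sup>2)\<close>.
\<close>

definition heat :: "real \<Rightarrow> 'a::euclidean_space \<Rightarrow> real" where
  "heat \<tau> x = (4 * pi * \<tau>) powr (- (DIM('a) / 2)) * exp (- (norm x)\<^sup>2 / (4 * \<tau>))"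

lemma heat_nonneg [simp]: "0 \<le> heat \<tau> x"
  by (simp add: heat_def)

lemma heat_measurable [measurable (raw)]:
  assumes [measurable]: "f \<in> borel_measurable M" "g \<in> borel_measurable M"
  shows "(\<lambda>x. heat (f x) (g x)) \<in> borel_measurable M"
  unfolding heat_def by measurable

lemma heat_minus [simp]: "heat \<tau> (-x) = heat \<tau> x"
  by (simp add: heat_def)

lemma heat_fourier:
  fixes \<xi> :: "'a::euclidean_space"
  assumes \<tau>: "0 < \<tau>"
  shows "integrable lborel (\<lambda>x::'a. of_real (heat \<tau> x) * plane_wave \<xi> x)"
    and "(LBINT x. of_real (heat \<tau> x) * plane_wave \<xi> x) = of_real (exp (- 4 * pi\<^sup>2 * \<tau> * (norm \<xi>)\<^sup>2))"
proof -
  define a where "a = 1 / (4 * \<tau>)"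
  have a: "0 < a" using \<tau> by (simp add: a_def)
  have h: "heat \<tau> x = (pi / a) powr (- (DIM('a) / 2)) * exp (- a * (norm x)\<^sup>2)" for x :: 'a
    by (simp add: heat_def a_def mult_ac)
  note G = gaussian_fourier[OF a, of \<xi>]
  show "integrable lborel (\<lambda>x::'a. of_real (heat \<tau> x) * plane_wave \<xi> x)"
    using integrable_mult_right[OF G(1), of "of_real ((pi / a) powr (- (DIM('a) / 2)))"]
    by (simp add: h mult.assoc)
  have "(LBINT x. of_real (heat \<tau> x) * plane_wave \<xi> x)
     = of_real ((pi / a) powr (- (DIM('a) / 2))) * (LBINT x. of_real (exp (- a * (norm x)\<^sup>2)) * plane_wave \<xi> x)"
    by (simp add: h mult.assoc)
  also have "\<dots> = of_real (exp (- pi\<^sup>2 * (norm \<xi>)\<^sup>2 / a))"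
    unfolding G(2) using a by (simp add: powr_minus)
  also have "- pi\<^sup>2 * (norm \<xi>)\<^sup>2 / a = - 4 * pi\<^sup>2 * \<tau> * (norm \<xi>)\<^sup>2"
    using \<tau> by (simp add: a_def)
  finally show "(LBINT x. of_real (heat \<tau> x) * plane_wave \<xi> x) = of_real (exp (- 4 * pi\<^sup>2 * \<tau> * (norm \<xi>)\<^sup>2))" .
qed

lemma heat_eq_gaussian_fourier:
  fixes z :: "'a::euclidean_space"
  assumes \<tau>: "0 < \<tau>"
  shows "integrable lborel (\<lambda>\<xi>::'a. of_real (exp (- 4 * pi\<^sup>2 * \<tau> * (norm \<xi>)\<^sup>2)) * plane_wave z \<xi>)"
    and "(LBINT \<xi>. of_real (exp (- 4 * pi\<^sup>2 * \<tau> * (norm \<xi>)\<^sup>2)) * plane_wave z \<xi>) = of_real (heat \<tau> z)"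
proof -
  define a where "a = 4 * pi\<^sup>2 * \<tau>"
  have a: "0 < a" using \<tau> by (simp add: a_def)
  have a': "- 4 * pi\<^sup>2 * \<tau> * (norm \<xi>)\<^sup>2 = - a * (norm \<xi>)\<^sup>2" for \<xi> :: 'a by (simp add: a_def)
  note G = gaussian_fourier[OF a, of z]
  show "integrable lborel (\<lambda>\<xi>::'a. of_real (exp (- 4 * pi\<^sup>2 * \<tau> * (norm \<xi>)\<^sup>2)) * plane_wave z \<xi>)"
    using G(1) by (simp only: a')
  have "pi / a = inverse (4 * pi * \<tau>)" using \<tau> by (simp add: a_def field_simps power2_eq_square)
  then have "(pi / a) powr (DIM('a) / 2) = (4 * pi * \<tau>) powr (- (DIM('a) / 2))"
    using \<tau> by (simp only: powr_minus inverse_powr)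
  moreover have "- pi\<^sup>2 * (norm z)\<^sup>2 / a = - (norm z)\<^sup>2 / (4 * \<tau>)" using \<tau> by (simp add: a_def)
  ultimately show "(LBINT \<xi>. of_real (exp (- 4 * pi\<^sup>2 * \<tau> * (norm \<xi>)\<^sup>2)) * plane_wave z \<xi>) = of_real (heat \<tau> z)"
    using G(2) unfolding a' by (simp only: heat_def)
qed

lemma heat_integrable: "0 < \<tau> \<Longrightarrow> integrable lborel (heat \<tau> :: 'a::euclidean_space \<Rightarrow> real)"
  using heat_fourier(1)[of \<tau> "0::'a"] by (simp add: complex_of_real_integrable_eq)

lemma heat_integral: "0 < \<tau> \<Longrightarrow> (LBINT x. heat \<tau> (x::'a::euclidean_space)) = 1"
  using heat_fourier(2)[of \<tau> "0::'a"] by (simp add: integral_complex_of_real)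

text \<open>
  Substituting \<open>y = x + c z\<close> with \<open>c = sqrt \<tau>\<close> turns the convolution into an average of
  \<open>F (x + c z)\<close> over a fixed Gaussian weight, to which dominated convergence applies. Times of the
  form \<open>1/(k+1)\<^sup>2\<close> make the limit a sequential one.
\<close>

lemma heat_approximates_identity:
  fixes F :: "'a::euclidean_space \<Rightarrow> complex"
  assumes cont: "continuous_on UNIV F" and B: "\<And>x. norm (F x) \<le> B"
  shows "(\<lambda>k. LBINT y. of_real (heat ((1 / real (Suc k))\<^sup>2) (x - y)) * F y) \<longlonglongrightarrow> F x"
proof -
  have Fm[measurable]: "F \<in> borel_measurable borel" using cont by (rule borel_measurable_continuous_onI)
  have eq: "(LBINT y. of_real (heat (c\<^sup>2) (x - y)) * F y) = (LBINT z. of_real (heat 1 z) * F (x + c *\<^sub>R z))"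
    if c: "0 < c" for c
  proof -
    have h: "c ^ DIM('a) * heat (c\<^sup>2) (c *\<^sub>R z) = heat 1 z" for z :: 'a
    proof -
      have "(c\<^sup>2) powr (DIM('a) / 2) = (c powr 2) powr (DIM('a) / 2)" using c by simp
      also have "\<dots> = c powr (2 * (DIM('a) / 2))" by (rule powr_powr)
      also have "\<dots> = c ^ DIM('a)" using c by (simp add: powr_realpow)
      finally have "c ^ DIM('a) = (c\<^sup>2) powr (DIM('a) / 2)" ..
      note cD = this
      have pm: "(4 * pi * c\<^sup>2) powr (- (DIM('a) / 2)) = (4 * pi) powr (- (DIM('a) / 2)) * (c\<^sup>2) powr (- (DIM('a) / 2))"
        by (rule powr_mult)
      have one: "(c\<^sup>2) powr (DIM('a) / 2) * (c\<^sup>2) powr (- (DIM('a) / 2)) = 1"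
        using c by (simp add: powr_add[symmetric])
      have "(norm (c *\<^sub>R z))\<^sup>2 = c\<^sup>2 * (norm z)\<^sup>2"
        by (simp add: power_mult_distrib)
      then have ex: "- (norm (c *\<^sub>R z))\<^sup>2 / (4 * c\<^sup>2) = - (norm z)\<^sup>2 / (4 * 1)"
        using c by (simp del: norm_scaleR)
      have "c ^ DIM('a) * heat (c\<^sup>2) (c *\<^sub>R z)
        = ((c\<^sup>2) powr (DIM('a) / 2) * (c\<^sup>2) powr (- (DIM('a) / 2))) * heat 1 z"
        unfolding heat_def cD pm ex by (simp add: mult_ac)
      then show ?thesis unfolding one by simp
    qed
    have "(LBINT y. of_real (heat (c\<^sup>2) (x - y)) * F y)
      = \<bar>c\<bar> ^ DIM('a) *\<^sub>R (LBINT z. of_real (heat (c\<^sup>2) (c *\<^sub>R z)) * F (x + c *\<^sub>R z))"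
      using c by (subst lborel_integral_affine[where c=c and t=x]) simp_all
    also have "\<dots> = (LBINT z. of_real (c ^ DIM('a) * heat (c\<^sup>2) (c *\<^sub>R z)) * F (x + c *\<^sub>R z))"
      using c by (simp add: scaleR_conv_of_real mult.assoc)
    finally show ?thesis by (simp only: h)
  qed
  have "(\<lambda>k. LBINT z. of_real (heat 1 z) * F (x + (1 / real (Suc k)) *\<^sub>R z)) \<longlonglongrightarrow> (LBINT z. of_real (heat 1 (z::'a)) * F x)"
  proof (rule integral_dominated_convergence)
    show "integrable lborel (\<lambda>z::'a. B * heat 1 z)" using heat_integrable[of 1, where 'a='a] by simp
    show "AE z in lborel. (\<lambda>k. of_real (heat 1 z) * F (x + (1 / real (Suc k)) *\<^sub>R z)) \<longlonglongrightarrow> of_real (heat 1 z) * F x"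
    proof (rule AE_I2)
      fix z :: 'a
      have "(\<lambda>k. x + (1 / real (Suc k)) *\<^sub>R z) \<longlonglongrightarrow> x + 0 *\<^sub>R z"
        by (intro tendsto_intros LIMSEQ_Suc[OF lim_1_over_n])
      then have "(\<lambda>k. F (x + (1 / real (Suc k)) *\<^sub>R z)) \<longlonglongrightarrow> F x"
        using cont by (intro continuous_on_tendsto_compose[OF cont]) auto
      then show "(\<lambda>k. of_real (heat 1 z) * F (x + (1 / real (Suc k)) *\<^sub>R z)) \<longlonglongrightarrow> of_real (heat 1 z) * F x"
        by (intro tendsto_intros)
    qed
    show "AE z in lborel. norm (of_real (heat 1 z) * F (x + (1 / real (Suc k)) *\<^sub>R z)) \<le> B * heat 1 z" for k
      using B by (auto simp: norm_mult mult.commute[of B] intro!: mult_left_mono)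
  qed measurable
  moreover have "(LBINT z. of_real (heat 1 (z::'a)) * F x) = F x"
    using heat_integral[of 1, where 'a='a] heat_integrable[of 1, where 'a='a] by simp
  ultimately have "(\<lambda>k. LBINT z. of_real (heat 1 z) * F (x + (1 / real (Suc k)) *\<^sub>R z)) \<longlonglongrightarrow> F x"
    by (simp only:)
  then show ?thesis by (simp add: eq)
qed

text \<open>
  Heat regularisation in terms of the Fourier transform of \<open>k\<close> alone. It yields both the inversion
  formula, when the transform is integrable, and injectivity, when the transform vanishes.
\<close>

lemma heat_convolution_eq:
  fixes k :: "real^'n \<Rightarrow> complex"
  assumes k: "integrable lborel k" and \<tau>: "0 < \<tau>"
  shows "(LBINT y. of_real (heat \<tau> (x - y)) * k y)
       = (LBINT \<xi>. of_real (exp (- 4 * pi\<^sup>2 * \<tau> * (norm \<xi>)\<^sup>2)) * fourier k \<xi> * plane_wave x \<xi>)"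
proof -
  note km[measurable] = borel_measurable_integrable[OF k]
  let ?G = "\<lambda>\<xi>::real^'n. exp (- 4 * pi\<^sup>2 * \<tau> * (norm \<xi>)\<^sup>2)"
  have gi: "integrable lborel ?G"
    using heat_eq_gaussian_fourier(1)[OF \<tau>, of "0::real^'n"]
    by (simp only: plane_wave_zero mult_1_right complex_of_real_integrable_eq)
  have int: "integrable (lborel \<Otimes>\<^sub>M lborel) (\<lambda>(y,\<xi>). k y * (of_real (?G \<xi>) * plane_wave (x - y) \<xi>))"
  proof (rule lborel_pair.Fubini_integrable)
    show "AE y in lborel. integrable lborel (\<lambda>\<xi>. case (y,\<xi>) of (y,\<xi>) \<Rightarrow> k y * (of_real (?G \<xi>) * plane_wave (x - y) \<xi>))"
      by (intro AE_I2, simp only: prod.case, intro integrable_mult_right heat_eq_gaussian_fourier(1)[OF \<tau>])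
  qed (use k gi in \<open>simp_all add: norm_mult\<close>)
  have "(LBINT y. of_real (heat \<tau> (x - y)) * k y) = (LBINT y. (LBINT \<xi>. k y * (of_real (?G \<xi>) * plane_wave (x - y) \<xi>)))"
    unfolding integral_mult_right_zero heat_eq_gaussian_fourier(2)[OF \<tau>] by (simp add: mult.commute)
  also have "\<dots> = (LBINT \<xi>. (LBINT y. k y * (of_real (?G \<xi>) * plane_wave (x - y) \<xi>)))"
    using lborel_pair.Fubini_integral[OF int] by simp
  also have "\<dots> = (LBINT \<xi>. of_real (?G \<xi>) * fourier k \<xi> * plane_wave x \<xi>)"
  proof (rule Bochner_Integration.integral_cong)
    fix \<xi>
    have e: "k y * (of_real (?G \<xi>) * plane_wave (x - y) \<xi>) = (of_real (?G \<xi>) * plane_wave x \<xi>) * (k y * plane_wave (-\<xi>) y)" for y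
      using plane_wave_add[of x "-y" \<xi>] by (simp add: plane_wave_minus plane_wave_commute[of \<xi> "-y"])
    then show "(LBINT y. k y * (of_real (?G \<xi>) * plane_wave (x - y) \<xi>)) = of_real (?G \<xi>) * fourier k \<xi> * plane_wave x \<xi>"
      unfolding e integral_mult_right_zero using km by (simp add: fourier_eq mult_ac)
  qed simp
  finally show ?thesis .
qed

lemma fourier_inversion:
  fixes k :: "real^'n \<Rightarrow> complex"
  assumes k: "integrable lborel k" and cont: "continuous_on UNIV k" and B: "\<And>x. norm (k x) \<le> B"
    and fk: "integrable lborel (fourier k)"
  shows "inv_fourier (fourier k) x = k x"
proof -
  note [measurable] = borel_measurable_integrable[OF fk]
  define t where "t = (\<lambda>j::nat. (1 / real (Suc j))\<^sup>2)"
  have t: "0 < t j" for j by (simp add: t_def)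
  have t0: "t \<longlonglongrightarrow> 0"
    using tendsto_power[OF LIMSEQ_Suc[OF lim_1_over_n], of 2] by (simp only: zero_power2 t_def)
  have "(\<lambda>j. LBINT \<xi>. of_real (exp (- 4 * pi\<^sup>2 * t j * (norm \<xi>)\<^sup>2)) * fourier k \<xi> * plane_wave x \<xi>) \<longlonglongrightarrow>
     (LBINT \<xi>. of_real (exp (- 4 * pi\<^sup>2 * 0 * (norm \<xi>)\<^sup>2)) * fourier k \<xi> * plane_wave x \<xi>)"
  proof (rule integral_dominated_convergence)
    show "integrable lborel (\<lambda>\<xi>. norm (fourier k \<xi>))" using fk by simp
    show "AE \<xi> in lborel. (\<lambda>j. of_real (exp (- 4 * pi\<^sup>2 * t j * (norm \<xi>)\<^sup>2)) * fourier k \<xi> * plane_wave x \<xi>) \<longlonglongrightarrow>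
       of_real (exp (- 4 * pi\<^sup>2 * 0 * (norm \<xi>)\<^sup>2)) * fourier k \<xi> * plane_wave x \<xi>"
      by (intro AE_I2 tendsto_intros t0)
    show "AE \<xi> in lborel. norm (of_real (exp (- 4 * pi\<^sup>2 * t j * (norm \<xi>)\<^sup>2)) * fourier k \<xi> * plane_wave x \<xi>) \<le> norm (fourier k \<xi>)" for j
      using t[of j] by (auto simp: norm_mult intro!: mult_left_le_one_le)
  qed measurable
  then have "(\<lambda>j. LBINT y. of_real (heat (t j) (x - y)) * k y) \<longlonglongrightarrow> inv_fourier (fourier k) x"
    using t by (simp add: heat_convolution_eq[OF k] inv_fourier_eq)
  with heat_approximates_identity[OF cont B, of x] show ?thesis
    unfolding t_def by (blast intro: LIMSEQ_unique)
qed

section \<open>Schwartz functions and slowly increasing functions\<close>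

definition pd :: "'n \<Rightarrow> (real^'n \<Rightarrow> complex) \<Rightarrow> real^'n \<Rightarrow> complex" where
  "pd i f = (\<lambda>x. frechet_derivative f (at x) (axis i 1))"

lemma partials_Cons_pd: "partials (i # is) f = pd i (partials is f)"
  by (simp add: pd_def)

lemma partials_snoc: "partials (is @ [i]) f = partials is (pd i f)"
  by (induction "is") (simp_all add: pd_def)

lemma pd_eqI: "(f has_derivative f') (at x) \<Longrightarrow> pd i f x = f' (axis i 1)"
  unfolding pd_def by (metis frechet_derivative_at)

lemma has_derivative_frechet: "f differentiable (at x) \<Longrightarrow> (f has_derivative frechet_derivative f (at x)) (at x)"
  by (simp add: frechet_derivative_works)

lemma pd_add:
  assumes "f differentiable (at x)" "g differentiable (at x)"
  shows "pd i (\<lambda>x. f x + g x) x = pd i f x + pd i g x"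
  using pd_eqI[OF has_derivative_add[OF assms[THEN has_derivative_frechet]]] by (simp add: pd_def)

lemma pd_mult:
  assumes "f differentiable (at x)" "g differentiable (at x)"
  shows "pd i (\<lambda>x. f x * g x) x = pd i f x * g x + f x * pd i g x"
  using pd_eqI[OF has_derivative_mult[OF assms[THEN has_derivative_frechet]]] by (simp add: pd_def add.commute)

text \<open>
  Smoothness statements are proved by coinduction: a class of differentiable functions that is
  closed under first-order partial derivatives contains all iterated ones, so a bound that holds
  throughout the class is automatically a bound for all derivatives.
\<close>

definition pd_closed :: "(real^'n \<Rightarrow> complex) set \<Rightarrow> bool" where
  "pd_closed X \<longleftrightarrow> (\<forall>f\<in>X. (\<forall>x. f differentiable (at x)) \<and> (\<forall>i. pd i f \<in> X))"

lemma pd_closedD: "pd_closed X \<Longrightarrow> f \<in> X \<Longrightarrow> f differentiable (at x)" "pd_closed X \<Longrightarrow> f \<in> X \<Longrightarrow> pd i f \<in> X"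
  by (auto simp: pd_closed_def)

lemma pd_closed_partials: "pd_closed X \<Longrightarrow> f \<in> X \<Longrightarrow> partials is f \<in> X"
  by (induction "is") (auto simp: partials_Cons_pd pd_closedD simp del: partials.simps(2))

text \<open>
  The product rule leads out of any class of products, but not out of the finite sums of products.
\<close>

inductive_set prods :: "('a \<Rightarrow> complex) set \<Rightarrow> ('a \<Rightarrow> complex) set \<Rightarrow> ('a \<Rightarrow> complex) set" for A B where
  mult: "a \<in> A \<Longrightarrow> b \<in> B \<Longrightarrow> (\<lambda>x. a x * b x) \<in> prods A B"
| add: "f \<in> prods A B \<Longrightarrow> g \<in> prods A B \<Longrightarrow> (\<lambda>x. f x + g x) \<in> prods A B"

text \<open>
  The derivatives of the generators in \<open>F\<close> may have coefficients from the algebra \<open>A\<close>: this covers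
  functions like a Gaussian, which is its own derivative up to a polynomial factor.
\<close>

lemma pd_closed_prods_module:
  assumes A: "pd_closed A" and Am: "\<And>a b. a \<in> A \<Longrightarrow> b \<in> A \<Longrightarrow> (\<lambda>x. a x * b x) \<in> A"
    and F: "\<And>f x. f \<in> F \<Longrightarrow> f differentiable (at x)" "\<And>f i. f \<in> F \<Longrightarrow> pd i f \<in> prods A F"
  shows "pd_closed (prods A F)"
proof -
  have mod: "a \<in> A \<Longrightarrow> (\<lambda>x. a x * f x) \<in> prods A F" if "f \<in> prods A F" for a f
    using that
  proof (induction rule: prods.induct)
    case (mult b c)
    then show ?case using prods.mult[OF Am[of a b] mult(2)] by (simp add: mult.assoc)
  next
    case (add f g)
    then show ?case using prods.add[OF add.IH] by (simp add: distrib_left)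
  qed
  have "(\<forall>x. f differentiable (at x)) \<and> (\<forall>i. pd i f \<in> prods A F)" if "f \<in> prods A F" for f
    using that
  proof (induction rule: prods.induct)
    case (mult a b)
    have "pd i (\<lambda>x. a x * b x) \<in> prods A F" for i
    proof -
      have "pd i (\<lambda>x. a x * b x) = (\<lambda>x. pd i a x * b x + a x * pd i b x)"
        using mult A F by (intro ext pd_mult) (auto simp: pd_closedD)
      also have "\<dots> \<in> prods A F"
        using mult A F by (intro prods.add prods.mult mod) (auto simp: pd_closedD)
      finally show ?thesis .
    qed
    then show ?case using mult A F by (auto simp: pd_closedD)
  next
    case (add f g)
    have "pd i (\<lambda>x. f x + g x) = (\<lambda>x. pd i f x + pd i g x)" for i
      using add by (intro ext pd_add) auto
    then show ?case using add by (auto intro: prods.add)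
  qed
  then show ?thesis by (simp add: pd_closed_def)
qed

lemma pd_closed_prods:
  assumes A: "pd_closed A" and F: "pd_closed F"
  shows "pd_closed (prods A F)"
proof -
  have "(\<forall>x. f differentiable (at x)) \<and> (\<forall>i. pd i f \<in> prods A F)" if "f \<in> prods A F" for f
    using that
  proof (induction rule: prods.induct)
    case (mult a b)
    have "pd i (\<lambda>x. a x * b x) = (\<lambda>x. pd i a x * b x + a x * pd i b x)" for i
      using mult A F by (intro ext pd_mult) (auto simp: pd_closedD)
    moreover have "(\<lambda>x. pd i a x * b x + a x * pd i b x) \<in> prods A F" for i
        using mult A F by (intro prods.add prods.mult) (auto simp: pd_closedD)
    ultimately show ?case using mult A F by (auto simp: pd_closedD)
  next
    case (add f g)
    have "pd i (\<lambda>x. f x + g x) = (\<lambda>x. pd i f x + pd i g x)" for i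
      using add by (intro ext pd_add) auto
    then show ?case using add by (auto intro: prods.add)
  qed
  then show ?thesis by (simp add: pd_closed_def)
qed

definition poly_bounded :: "(real^'n \<Rightarrow> complex) \<Rightarrow> bool" where
  "poly_bounded f \<longleftrightarrow> (\<exists>C k. \<forall>x. norm (f x) \<le> C * (1 + norm x) ^ k)"

definition rapid :: "(real^'n \<Rightarrow> complex) \<Rightarrow> bool" where
  "rapid f \<longleftrightarrow> (\<forall>k. \<exists>C. \<forall>x. (1 + norm x) ^ k * norm (f x) \<le> C)"

lemma poly_bounded_add:
  assumes "poly_bounded f" "poly_bounded g"
  shows "poly_bounded (\<lambda>x. f x + g x)"
proof -
  obtain C k D l where C: "\<And>x. norm (f x) \<le> C * (1 + norm x) ^ k" and D: "\<And>x. norm (g x) \<le> D * (1 + norm x) ^ l"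
    using assms unfolding poly_bounded_def by blast
  have C0: "0 \<le> C" using order_trans[OF norm_ge_zero C[of 0]] by simp
  have D0: "0 \<le> D" using order_trans[OF norm_ge_zero D[of 0]] by simp
  have "norm (f x + g x) \<le> (C + D) * (1 + norm x) ^ (k + l)" for x
  proof -
    have "norm (f x + g x) \<le> C * (1 + norm x) ^ k + D * (1 + norm x) ^ l"
      using norm_triangle_ineq[of "f x" "g x"] C[of x] D[of x] by simp
    also have "\<dots> \<le> C * (1 + norm x) ^ (k + l) + D * (1 + norm x) ^ (k + l)"
      using C0 D0 by (intro add_mono mult_left_mono power_increasing) auto
    finally show ?thesis by (simp add: distrib_right)
  qed
  then show ?thesis unfolding poly_bounded_def by blast
qed

lemma poly_bounded_mult:
  assumes "poly_bounded f" "poly_bounded g"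
  shows "poly_bounded (\<lambda>x. f x * g x)"
proof -
  obtain C k D l where C: "\<And>x. norm (f x) \<le> C * (1 + norm x) ^ k" and D: "\<And>x. norm (g x) \<le> D * (1 + norm x) ^ l"
    using assms unfolding poly_bounded_def by blast
  have "norm (f x * g x) \<le> (C * D) * (1 + norm x) ^ (k + l)" for x
    using mult_mono'[OF C[of x] D[of x]] by (simp add: norm_mult power_add mult_ac)
  then show ?thesis unfolding poly_bounded_def by blast
qed

lemma rapid_add:
  assumes "rapid f" "rapid g"
  shows "rapid (\<lambda>x. f x + g x)"
  unfolding rapid_def
proof
  fix k
  obtain C D where C: "\<And>x. (1 + norm x) ^ k * norm (f x) \<le> C" and D: "\<And>x. (1 + norm x) ^ k * norm (g x) \<le> D"
    using assms unfolding rapid_def by blast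
  have "(1 + norm x) ^ k * norm (f x + g x) \<le> C + D" for x
  proof -
    have "(1 + norm x) ^ k * norm (f x + g x) \<le> (1 + norm x) ^ k * (norm (f x) + norm (g x))"
      by (intro mult_left_mono norm_triangle_ineq) auto
    then show ?thesis using C[of x] D[of x] by (simp add: distrib_left)
  qed
  then show "\<exists>C. \<forall>x. (1 + norm x) ^ k * norm (f x + g x) \<le> C" by blast
qed

lemma rapid_mult:
  assumes "poly_bounded a" "rapid f"
  shows "rapid (\<lambda>x. a x * f x)"
  unfolding rapid_def
proof
  fix k
  obtain C l where C: "\<And>x. norm (a x) \<le> C * (1 + norm x) ^ l"
    using assms unfolding poly_bounded_def by blast
  obtain D where D: "\<And>x. (1 + norm x) ^ (k + l) * norm (f x) \<le> D"
    using assms unfolding rapid_def by blast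
  have C0: "0 \<le> C" using order_trans[OF norm_ge_zero C[of 0]] by simp
  have "(1 + norm x) ^ k * norm (a x * f x) \<le> C * D" for x
  proof -
    have "(1 + norm x) ^ k * norm (a x * f x) \<le> (1 + norm x) ^ k * (C * (1 + norm x) ^ l * norm (f x))"
      using C[of x] by (intro mult_left_mono) (auto simp: norm_mult intro!: mult_right_mono)
    also have "\<dots> = C * ((1 + norm x) ^ (k + l) * norm (f x))" by (simp add: power_add mult_ac)
    also have "\<dots> \<le> C * D" using C0 D by (intro mult_left_mono) auto
    finally show ?thesis .
  qed
  then show "\<exists>C. \<forall>x. (1 + norm x) ^ k * norm (a x * f x) \<le> C" by blast
qed

text \<open>
  Compares the weights \<open>(1 + |x|)^k\<close> with powers of single coordinates, which are the monomials
  that occur in the Schwartz seminorms.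
\<close>

lemma one_plus_norm_power_le:
  fixes x :: "real^'n"
  shows "(1 + norm x) ^ k \<le> (1 + real CARD('n)) ^ k * (1 + (\<Sum>i\<in>UNIV. \<bar>x $ i\<bar> ^ k))"
proof -
  define m where "m = Max (insert 1 (range (\<lambda>i. \<bar>x $ i\<bar>)))"
  have m1: "1 \<le> m" and mi: "\<bar>x $ i\<bar> \<le> m" for i
    unfolding m_def by (rule Max_ge; auto)+
  have "norm x \<le> (\<Sum>i\<in>UNIV. \<bar>x $ i\<bar>)" by (rule norm_le_l1_cart)
  also have "\<dots> \<le> (\<Sum>i\<in>(UNIV::'n set). m)" by (intro sum_mono mi)
  finally have "1 + norm x \<le> (1 + real CARD('n)) * m" using m1 by (simp add: distrib_right)
  then have "(1 + norm x) ^ k \<le> ((1 + real CARD('n)) * m) ^ k" by (intro power_mono) auto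
  also have "\<dots> = (1 + real CARD('n)) ^ k * m ^ k" by (rule power_mult_distrib)
  also have "m ^ k \<le> 1 + (\<Sum>i\<in>UNIV. \<bar>x $ i\<bar> ^ k)"
  proof -
    have "m \<in> insert 1 (range (\<lambda>i. \<bar>x $ i\<bar>))" unfolding m_def by (intro Max_in) auto
    then consider "m = 1" | i where "m = \<bar>x $ i\<bar>" by auto
    then show ?thesis
    proof cases
      case 1 then show ?thesis by (simp add: sum_nonneg)
    next
      case (2 i)
      have "\<bar>x $ i\<bar> ^ k \<le> (\<Sum>i\<in>UNIV. \<bar>x $ i\<bar> ^ k)" by (rule member_le_sum) auto
      then show ?thesis using 2 by simp
    qed
  qed
  finally show ?thesis by simp
qed

lemma rapidI:
  fixes f :: "real^'n \<Rightarrow> complex"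
  assumes b: "\<And>i k. \<exists>C. \<forall>x. \<bar>x $ i\<bar> ^ k * norm (f x) \<le> C"
  shows "rapid f"
  unfolding rapid_def
proof
  fix k
  obtain C where C: "\<And>i x. \<bar>x $ i\<bar> ^ k * norm (f x) \<le> C i" using b[of _ k] by metis
  obtain D where D: "\<And>x. norm (f x) \<le> D" using b[of _ 0] by auto
  have "(1 + norm x) ^ k * norm (f x) \<le> (1 + real CARD('n)) ^ k * (D + (\<Sum>i\<in>UNIV. C i))" for x
  proof -
    have "(1 + norm x) ^ k * norm (f x) \<le> (1 + real CARD('n)) ^ k * (1 + (\<Sum>i\<in>UNIV. \<bar>x $ i\<bar> ^ k)) * norm (f x)"
      by (intro mult_right_mono one_plus_norm_power_le) auto
    also have "\<dots> = (1 + real CARD('n)) ^ k * (norm (f x) + (\<Sum>i\<in>UNIV. \<bar>x $ i\<bar> ^ k * norm (f x)))"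
      by (simp add: distrib_right sum_distrib_right mult.assoc)
    also have "\<dots> \<le> (1 + real CARD('n)) ^ k * (D + (\<Sum>i\<in>UNIV. C i))"
      by (intro mult_left_mono add_mono sum_mono C D) auto
    finally show ?thesis .
  qed
  then show "\<exists>C. \<forall>x. (1 + norm x) ^ k * norm (f x) \<le> C" by blast
qed

lemma mono_pow_single: "mono_pow ((\<lambda>_. 0)(i := k)) x = (x $ i) ^ k"
proof -
  have "mono_pow ((\<lambda>_. 0)(i := k)) x = (\<Prod>j\<in>UNIV. if j = i then (x $ i) ^ k else 1)"
    unfolding mono_pow_def by (intro prod.cong) auto
  then show ?thesis by simp
qed

lemma abs_mono_pow_le: "\<bar>mono_pow \<gamma> x\<bar> \<le> (1 + norm x) ^ (\<Sum>i\<in>UNIV. \<gamma> i)"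
proof -
  have "\<bar>mono_pow \<gamma> x\<bar> = (\<Prod>i\<in>UNIV. \<bar>x $ i\<bar> ^ \<gamma> i)"
    by (simp add: mono_pow_def abs_prod power_abs)
  also have "\<dots> \<le> (\<Prod>i\<in>UNIV. (1 + norm x) ^ \<gamma> i)"
    by (intro prod_mono) (auto intro!: power_mono simp: component_le_norm_cart add_increasing)
  finally show ?thesis by (simp add: power_sum)
qed

lemma rapid_iff: "rapid f \<longleftrightarrow> (\<forall>\<gamma>. bounded (range (\<lambda>x. mono_pow \<gamma> x *\<^sub>R f x)))"
proof
  assume f: "rapid f"
  show "\<forall>\<gamma>. bounded (range (\<lambda>x. mono_pow \<gamma> x *\<^sub>R f x))"
  proof
    fix \<gamma> :: "'a \<Rightarrow> nat"
    obtain C where C: "\<And>x. (1 + norm x) ^ (\<Sum>i\<in>UNIV. \<gamma> i) * norm (f x) \<le> C"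
      using f unfolding rapid_def by blast
    have "norm (mono_pow \<gamma> x *\<^sub>R f x) \<le> C" for x
      using order_trans[OF mult_right_mono[OF abs_mono_pow_le norm_ge_zero] C] by simp
    then show "bounded (range (\<lambda>x. mono_pow \<gamma> x *\<^sub>R f x))" by (auto simp: bounded_iff)
  qed
next
  assume b: "\<forall>\<gamma>. bounded (range (\<lambda>x. mono_pow \<gamma> x *\<^sub>R f x))"
  show "rapid f"
  proof (rule rapidI)
    fix i k
    have "bounded (range (\<lambda>x. mono_pow ((\<lambda>_. 0)(i := k)) x *\<^sub>R f x))" using b by blast
    then show "\<exists>C. \<forall>x. \<bar>x $ i\<bar> ^ k * norm (f x) \<le> C"
      by (auto simp: bounded_iff mono_pow_single power_abs)
  qed
qed

lemma schwartz_iff: "f \<in> schwartz \<longleftrightarrow> (\<forall>is. rapid (partials is f) \<and> (\<forall>x. partials is f differentiable (at x)))"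
  by (auto simp: schwartz_def rapid_iff)

lemma schwartz_subsetI: "pd_closed X \<Longrightarrow> (\<And>f. f \<in> X \<Longrightarrow> rapid f) \<Longrightarrow> X \<subseteq> schwartz"
  by (auto simp: schwartz_iff pd_closed_partials pd_closedD)

lemma pd_closed_schwartz: "pd_closed schwartz"
  unfolding pd_closed_def
proof (intro ballI conjI allI)
  fix f x i assume f: "f \<in> schwartz"
  show "f differentiable at x" using f unfolding schwartz_iff by (metis partials.simps(1))
  show "pd i f \<in> schwartz" using f unfolding schwartz_iff by (metis partials_snoc)
qed

lemma schwartzD:
  assumes "f \<in> schwartz"
  shows "rapid f" "f differentiable (at x)" "pd i f \<in> schwartz" "continuous_on UNIV f" "f \<in> borel_measurable borel"
proof -
  show "rapid f" using assms unfolding schwartz_iff by (metis partials.simps(1))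
  show d: "f differentiable (at x)" for x by (rule pd_closedD(1)[OF pd_closed_schwartz assms])
  show "pd i f \<in> schwartz" by (rule pd_closedD(2)[OF pd_closed_schwartz assms])
  show c: "continuous_on UNIV f" using d by (simp add: continuous_at_imp_continuous_on differentiable_imp_continuous_within)
  show "f \<in> borel_measurable borel" by (rule borel_measurable_continuous_onI[OF c])
qed

text \<open>
  The greatest class of polynomially bounded functions closed under partial derivatives, that is,
  the smooth functions all of whose derivatives grow at most polynomially. These are the functions
  that multiply Schwartz functions to Schwartz functions.
\<close>

definition slow :: "(real^'n \<Rightarrow> complex) set" where
  "slow = \<Union>{X. pd_closed X \<and> (\<forall>f\<in>X. poly_bounded f)}"

lemma slow_subsetI: "pd_closed X \<Longrightarrow> (\<And>f. f \<in> X \<Longrightarrow> poly_bounded f) \<Longrightarrow> X \<subseteq> slow"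
  unfolding slow_def by blast

lemma pd_closed_slow: "pd_closed slow"
  unfolding pd_closed_def
proof (intro ballI conjI allI)
  fix f :: "real^'n \<Rightarrow> complex" and x i assume "f \<in> slow"
  then obtain X where X: "pd_closed X" "\<forall>f\<in>X. poly_bounded f" "f \<in> X" by (auto simp: slow_def)
  show "f differentiable at x" by (rule pd_closedD(1)[OF X(1,3)])
  show "pd i f \<in> slow" using slow_subsetI[OF X(1)] X(2) pd_closedD(2)[OF X(1,3)] by blast
qed

lemma slow_poly_bounded: "f \<in> slow \<Longrightarrow> poly_bounded f"
  by (auto simp: slow_def)

lemma slowD: "f \<in> slow \<Longrightarrow> poly_bounded f" "f \<in> slow \<Longrightarrow> f differentiable (at x)" "f \<in> slow \<Longrightarrow> pd i f \<in> slow"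
  by (fact slow_poly_bounded pd_closedD[OF pd_closed_slow])+

lemma prods_slow: "prods slow slow \<subseteq> slow"
proof (rule slow_subsetI[OF pd_closed_prods[OF pd_closed_slow pd_closed_slow]])
  fix f :: "real^'n \<Rightarrow> complex" assume "f \<in> prods slow slow"
  then show "poly_bounded f"
    by induction (auto intro: poly_bounded_mult poly_bounded_add slowD)
qed

lemma prods_slow_schwartz: "prods slow schwartz \<subseteq> schwartz"
proof (rule schwartz_subsetI[OF pd_closed_prods[OF pd_closed_slow pd_closed_schwartz]])
  fix f :: "real^'n \<Rightarrow> complex" assume "f \<in> prods slow schwartz"
  then show "rapid f"
    by induction (auto intro: rapid_mult rapid_add slowD schwartzD)
qed

lemma pd_const: "pd i (\<lambda>x. c) = (\<lambda>x. 0)"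
  by (intro ext pd_eqI[OF has_derivative_const, THEN trans]) simp

lemma slow_const: "(\<lambda>x. c) \<in> slow"
proof -
  have "{f. \<exists>c. f = (\<lambda>x::real^'n. c::complex)} \<subseteq> slow"
  proof (rule slow_subsetI)
    show "pd_closed {f. \<exists>c. f = (\<lambda>x::real^'n. c::complex)}" by (auto simp: pd_closed_def pd_const)
    fix f :: "real^'n \<Rightarrow> complex" assume "f \<in> {f. \<exists>c. f = (\<lambda>x. c)}"
    then obtain c where "f = (\<lambda>x. c)" by blast
    then have "\<forall>x. norm (f x) \<le> norm c * (1 + norm x) ^ 0" by simp
    then show "poly_bounded f" unfolding poly_bounded_def by blast
  qed
  then show ?thesis by blast
qed

lemma slow_mult: "a \<in> slow \<Longrightarrow> b \<in> slow \<Longrightarrow> (\<lambda>x. a x * b x) \<in> slow"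
  using prods_slow prods.mult by blast

lemma slow_add: assumes "a \<in> slow" "b \<in> slow" shows "(\<lambda>x. a x + b x) \<in> slow"
  using prods.add[OF prods.mult[OF slow_const[of 1] assms(1)] prods.mult[OF slow_const[of 1] assms(2)]] prods_slow
  by auto

lemma slow_schwartz: "a \<in> slow \<Longrightarrow> f \<in> schwartz \<Longrightarrow> (\<lambda>x. a x * f x) \<in> schwartz"
  using prods_slow_schwartz prods.mult by blast

lemma schwartz_add: assumes "f \<in> schwartz" "g \<in> schwartz" shows "(\<lambda>x. f x + g x) \<in> schwartz"
  using prods.add[OF prods.mult[OF slow_const[of 1] assms(1)] prods.mult[OF slow_const[of 1] assms(2)]] prods_slow_schwartz
  by auto

lemma schwartz_cmult: "f \<in> schwartz \<Longrightarrow> (\<lambda>x. c * f x) \<in> schwartz"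
  by (rule slow_schwartz[OF slow_const])

lemma schwartz_diff: assumes "f \<in> schwartz" "g \<in> schwartz" shows "(\<lambda>x. f x - g x) \<in> schwartz"
  using schwartz_add[OF assms(1) schwartz_cmult[OF assms(2), of "-1"]] by simp

lemma slow_sum: "finite I \<Longrightarrow> (\<And>i. i \<in> I \<Longrightarrow> a i \<in> slow) \<Longrightarrow> (\<lambda>x. \<Sum>i\<in>I. a i x) \<in> slow"
  by (induction I rule: finite_induct) (auto intro: slow_add slow_const)

lemma slow_power: "a \<in> slow \<Longrightarrow> (\<lambda>x. a x ^ k) \<in> slow"
  by (induction k) (auto intro: slow_mult slow_const)

lemma has_derivative_of_real_component: "((\<lambda>x::real^'n. complex_of_real (x $ j)) has_derivative (\<lambda>h. of_real (h $ j))) (at x)"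
  by (intro has_derivative_of_real bounded_linear.has_derivative[OF bounded_linear_vec_nth] has_derivative_ident)

lemma slow_component: "(\<lambda>x::real^'n. complex_of_real (x $ j)) \<in> slow"
proof -
  let ?X = "{\<lambda>x::real^'n. complex_of_real (x $ j)} \<union> slow"
  have pd: "pd i (\<lambda>x::real^'n. complex_of_real (x $ j)) = (\<lambda>x. of_real (axis i 1 $ j))" for i
    by (rule ext) (rule pd_eqI[OF has_derivative_of_real_component])
  have "?X \<subseteq> slow"
  proof (rule slow_subsetI)
    have "(\<lambda>x::real^'n. complex_of_real (x $ j)) differentiable (at x)" for x
      using has_derivative_of_real_component[of j x] unfolding differentiable_def by blast
    then show "pd_closed ?X" using pd_closed_slow by (auto simp: pd_closed_def pd slow_const)
    fix f :: "real^'n \<Rightarrow> complex" assume "f \<in> ?X"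
    moreover have "poly_bounded (\<lambda>x::real^'n. complex_of_real (x $ j))"
    proof -
      have "norm (complex_of_real (x $ j)) \<le> 1 * (1 + norm x) ^ 1" for x :: "real^'n"
        using component_le_norm_cart[of x j] by simp
      then show ?thesis unfolding poly_bounded_def by blast
    qed
    ultimately show "poly_bounded f" by (auto simp: slowD)
  qed
  then show ?thesis by blast
qed

lemma slow_norm_sq: "(\<lambda>x::real^'n. complex_of_real ((norm x)\<^sup>2)) \<in> slow"
proof -
  have "(\<lambda>x::real^'n. complex_of_real ((norm x)\<^sup>2)) = (\<lambda>x. \<Sum>i\<in>UNIV. complex_of_real (x $ i) ^ 2)"
    by (simp add: norm_vec_def L2_set_def sum_nonneg)
  then show ?thesis by (simp only:) (intro slow_sum slow_power slow_component finite)
qed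

lemma slow_module:
  fixes F :: "(real^'n \<Rightarrow> complex) set"
  assumes F: "\<And>f x. f \<in> F \<Longrightarrow> f differentiable (at x)" "\<And>f i. f \<in> F \<Longrightarrow> pd i f \<in> prods slow F"
  shows "pd_closed (prods slow F)"
  using pd_closed_prods_module[OF pd_closed_slow slow_mult F] .

lemma slow_moduleI:
  fixes F :: "(real^'n \<Rightarrow> complex) set"
  assumes F: "\<And>f x. f \<in> F \<Longrightarrow> f differentiable (at x)" "\<And>f i. f \<in> F \<Longrightarrow> pd i f \<in> prods slow F"
    and b: "\<And>f. f \<in> F \<Longrightarrow> poly_bounded f"
  shows "prods slow F \<subseteq> slow" "F \<subseteq> slow"
proof -
  show 1: "prods slow F \<subseteq> slow"
  proof (rule slow_subsetI[OF slow_module[OF F]])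
    fix f :: "real^'n \<Rightarrow> complex" assume "f \<in> prods slow F"
    then show "poly_bounded f"
      by induction (auto intro: poly_bounded_mult poly_bounded_add slowD b)
  qed
  show "F \<subseteq> slow"
    using 1 prods.mult[OF slow_const[of 1]] by fastforce
qed

lemma schwartz_moduleI:
  fixes F :: "(real^'n \<Rightarrow> complex) set"
  assumes F: "\<And>f x. f \<in> F \<Longrightarrow> f differentiable (at x)" "\<And>f i. f \<in> F \<Longrightarrow> pd i f \<in> prods slow F"
    and b: "\<And>f. f \<in> F \<Longrightarrow> rapid f"
  shows "F \<subseteq> schwartz"
proof -
  have 1: "prods slow F \<subseteq> schwartz"
  proof (rule schwartz_subsetI[OF slow_module[OF F]])
    fix f :: "real^'n \<Rightarrow> complex" assume "f \<in> prods slow F"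
    then show "rapid f"
      by induction (auto intro: rapid_mult rapid_add slowD b)
  qed
  show "F \<subseteq> schwartz"
    using 1 prods.mult[OF slow_const[of 1]] by fastforce
qed

lemma has_derivative_norm_sq: "((\<lambda>x::real^'n. (norm x)\<^sup>2) has_derivative (\<lambda>h. 2 * (x \<bullet> h))) (at x)"
  unfolding power2_norm_eq_inner
  by (rule has_derivative_eq_rhs[OF has_derivative_inner[OF has_derivative_ident has_derivative_ident]])
     (simp add: inner_commute)

section \<open>The Fourier transform on the Schwartz space\<close>

definition decay :: "real^'n \<Rightarrow> real" where
  "decay x = 1 / (1 + norm x) ^ (2 * CARD('n))"

lemma decay_pos [simp]: "0 < decay x"
  by (simp add: decay_def add_pos_nonneg)

lemma decay_measurable [measurable]: "decay \<in> borel_measurable borel"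
  unfolding decay_def by measurable

text \<open>
  Each factor \<open>1 + (x\<bullet>b)\<^sup>2\<close> is at most \<open>(1 + |x|)\<^sup>2\<close>, so \<open>decay\<close> is dominated by a product
  of one-dimensional integrable functions. This is why its exponent is \<open>2n\<close>.
\<close>

lemma decay_integrable: "integrable lborel (decay :: real^'n \<Rightarrow> real)"
proof -
  define q where "q = (\<lambda>(b::real^'n) t::real. complex_of_real (inverse (1 + t\<^sup>2)))"
  have "integrable lborel (\<lambda>t::real. inverse (1 + t\<^sup>2))"
    using integrable_inverse_1_plus_square by (simp add: set_integrable_def)
  then have q: "integrable lborel (q b)" for b unfolding q_def by (subst complex_of_real_integrable_eq)
  have Q: "integrable lborel (\<lambda>x::real^'n. \<Prod>b\<in>Basis. q b (x \<bullet> b))"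
    by (rule lborel_product_integral(1)) (rule q)
  show ?thesis
  proof (rule Bochner_Integration.integrable_bound[OF Q])
    show "AE x in lborel. norm (decay x) \<le> norm (\<Prod>b\<in>Basis. q b (x \<bullet> b :: real))"
    proof (rule AE_I2)
      fix x :: "real^'n"
      have "(\<Prod>b\<in>Basis. 1 + (x \<bullet> b)\<^sup>2) \<le> (\<Prod>b\<in>(Basis::(real^'n) set). (1 + norm x)\<^sup>2)"
      proof (rule prod_mono)
        fix b :: "real^'n" assume "b \<in> Basis"
        then have "\<bar>x \<bullet> b\<bar> \<le> norm x" by (rule Basis_le_norm)
        then have "(x \<bullet> b)\<^sup>2 \<le> (norm x)\<^sup>2" using abs_le_square_iff[of "x \<bullet> b" "norm x"] by simp
        then show "0 \<le> 1 + (x \<bullet> b)\<^sup>2 \<and> 1 + (x \<bullet> b)\<^sup>2 \<le> (1 + norm x)\<^sup>2"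
          by (simp add: power2_sum add_increasing2)
      qed
      also have "\<dots> = (1 + norm x) ^ (2 * CARD('n))" by (simp add: power_mult)
      finally have le: "(\<Prod>b\<in>Basis. 1 + (x \<bullet> b)\<^sup>2) \<le> (1 + norm x) ^ (2 * CARD('n))" .
      have pos: "0 < (\<Prod>b\<in>Basis. 1 + (x \<bullet> b)\<^sup>2)" by (intro prod_pos) (simp add: add_pos_nonneg)
      have "norm (\<Prod>b\<in>Basis. q b (x \<bullet> b :: real)) = 1 / (\<Prod>b\<in>Basis. 1 + (x \<bullet> b)\<^sup>2)"
      proof -
        have "norm (\<Prod>b\<in>Basis. q b (x \<bullet> b :: real)) = (\<Prod>b\<in>Basis. inverse (1 + (x \<bullet> b)\<^sup>2))"
          unfolding prod_norm[symmetric] q_def norm_of_real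
          by (intro prod.cong refl abs_of_nonneg) (simp add: add_nonneg_nonneg)
        then show ?thesis by (simp add: inverse_eq_divide prod_dividef)
      qed
      moreover have "1 / (1 + norm x) ^ (2 * CARD('n)) \<le> 1 / (\<Prod>b\<in>Basis. 1 + (x \<bullet> b)\<^sup>2)"
        using le pos by (intro divide_left_mono) (auto intro!: mult_pos_pos zero_less_power add_pos_nonneg)
      ultimately show "norm (decay x) \<le> norm (\<Prod>b\<in>Basis. q b (x \<bullet> b :: real))"
        using decay_pos[of x] by (simp add: decay_def)
    qed
  qed simp
qed

text \<open>
  Translates by a bounded amount are dominated uniformly.
\<close>

lemma decay_shift: "decay (x + h) \<le> (1 + norm h) ^ (2 * CARD('n)) * decay (x::real^'n)"
proof -
  have "1 + norm x \<le> (1 + norm (x + h)) * (1 + norm h)"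
  proof -
    have "norm x \<le> norm (x + h) + norm h"
      using norm_triangle_ineq4[of "x + h" h] by simp
    moreover have "0 \<le> norm (x + h) * norm h" by simp
    moreover have "(1 + norm (x + h)) * (1 + norm h) = 1 + norm (x + h) + norm h + norm (x + h) * norm h"
      by (simp add: algebra_simps)
    ultimately show ?thesis by linarith
  qed
  then have "(1 + norm x) ^ (2 * CARD('n)) \<le> ((1 + norm (x + h)) * (1 + norm h)) ^ (2 * CARD('n))"
    by (intro power_mono) auto
  then have le: "(1 + norm x) ^ (2 * CARD('n)) \<le> (1 + norm (x + h)) ^ (2 * CARD('n)) * (1 + norm h) ^ (2 * CARD('n))"
    by (simp only: power_mult_distrib)
  have p: "0 < (1 + norm x) ^ (2 * CARD('n))" "0 < (1 + norm (x+h)) ^ (2 * CARD('n))"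
    by (intro zero_less_power add_pos_nonneg; simp)+
  show ?thesis unfolding decay_def using le p by (simp add: field_simps)
qed

lemma rapid_le_decay:
  fixes f :: "real^'n \<Rightarrow> complex"
  assumes "rapid f"
  obtains C where "0 \<le> C" "\<And>x. norm (f x) \<le> C * decay x"
proof -
  obtain C where C: "\<And>x. (1 + norm x) ^ (2 * CARD('n)) * norm (f x) \<le> C"
    using assms unfolding rapid_def by blast
  have p: "0 < (1 + norm x) ^ (2 * CARD('n))" for x :: "real^'n"
    by (intro zero_less_power add_pos_nonneg; simp)
  have "0 \<le> C" using C[of 0] by (auto intro: order_trans[OF norm_ge_zero])
  moreover have "norm (f x) \<le> C * decay x" for x
    using C[of x] p[of x] by (simp add: decay_def field_simps)
  ultimately show ?thesis using that by blast
qed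

lemma rapid_integrable:
  fixes f :: "real^'n \<Rightarrow> complex"
  assumes "rapid f" and [measurable]: "f \<in> borel_measurable borel"
  shows "integrable lborel f"
proof -
  obtain C where C: "0 \<le> C" "\<And>x. norm (f x) \<le> C * decay x" using rapid_le_decay[OF assms(1)] by blast
  have "integrable lborel (\<lambda>x::real^'n. C * decay x)" using decay_integrable[where 'n='n] by simp
  then show ?thesis
    by (rule Bochner_Integration.integrable_bound) (use C in \<open>auto intro!: AE_I2 intro: order_trans[OF C(2)]\<close>)
qed

lemma schwartz_integrable: "f \<in> schwartz \<Longrightarrow> integrable lborel f"
  by (rule rapid_integrable) (auto dest: schwartzD)

lemma rapid_bounded: "rapid f \<Longrightarrow> \<exists>B. \<forall>x. norm (f x) \<le> B"
  unfolding rapid_def by (drule spec[of _ 0]) simp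

lemma has_vector_derivative_line:
  fixes \<phi> :: "real^'n \<Rightarrow> complex"
  assumes d: "\<And>x. \<phi> differentiable (at x)"
  shows "((\<lambda>s. \<phi> (x + s *\<^sub>R axis i 1)) has_vector_derivative pd i \<phi> (x + s *\<^sub>R axis i 1)) (at s within S)"
proof -
  let ?D = "frechet_derivative \<phi> (at (x + s *\<^sub>R axis i 1))"
  have D: "(\<phi> has_derivative ?D) (at (x + s *\<^sub>R axis i 1))" by (rule has_derivative_frechet[OF d])
  have "((\<lambda>s. x + s *\<^sub>R axis i 1) has_derivative (\<lambda>h. h *\<^sub>R axis i 1)) (at s within S)"
    by (auto intro!: derivative_eq_intros)
  from has_derivative_compose[OF this D]
  have "((\<lambda>s. \<phi> (x + s *\<^sub>R axis i 1)) has_derivative (\<lambda>h. ?D (h *\<^sub>R axis i 1))) (at s within S)" .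
  moreover have "(\<lambda>h. ?D (h *\<^sub>R axis i 1)) = (\<lambda>h. h *\<^sub>R pd i \<phi> (x + s *\<^sub>R axis i 1))"
    using linear_scale[OF has_derivative_linear[OF D]] by (simp add: pd_def)
  ultimately show ?thesis by (simp add: has_vector_derivative_def)
qed

text \<open>
  By the fundamental theorem of calculus, the integral of the derivative along a unit segment is a
  difference of \<open>\<phi>\<close> and a translate; integrating this over the whole space gives zero on one side
  and the integral of the derivative on the other.
\<close>

lemma integral_pd_zero:
  fixes \<phi> :: "real^'n \<Rightarrow> complex"
  assumes \<phi>: "\<phi> \<in> schwartz"
  shows "(LBINT x. pd i \<phi> x) = 0"
proof -
  define e where "e = (axis i 1 :: real^'n)"
  note p = schwartzD(3)[OF \<phi>, of i]
  note [measurable] = schwartzD(5)[OF \<phi>] schwartzD(5)[OF p]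
  have sh: "integrable lborel (\<lambda>x. pd i \<phi> (x + s *\<^sub>R e))" for s
    by (rule lborel_integrable_shift[OF schwartz_integrable[OF p]])
  have shn: "(LBINT x. norm (pd i \<phi> (x + s *\<^sub>R e))) = (LBINT x. norm (pd i \<phi> x))" for s
    using lborel_integral_shift[of "\<lambda>x. norm (pd i \<phi> x)" "s *\<^sub>R e"] by simp
  have int: "integrable (lborel \<Otimes>\<^sub>M lborel) (\<lambda>(s,x). indicator {0..1::real} s *\<^sub>R pd i \<phi> (x + s *\<^sub>R e))"
    by (rule lborel_pair.Fubini_integrable) (use sh in \<open>simp_all add: shn\<close>)
  have ftc: "(LBINT s. indicator {0..1::real} s *\<^sub>R pd i \<phi> (x + s *\<^sub>R e)) = \<phi> (x + e) - \<phi> x" for x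
  proof -
    have "continuous_on {0..1} (\<lambda>s. pd i \<phi> (x + s *\<^sub>R e))"
      by (rule continuous_on_compose2[OF schwartzD(4)[OF p]]) (auto intro!: continuous_intros)
    from integral_FTC_atLeastAtMost[OF _ has_vector_derivative_line[OF schwartzD(2)[OF \<phi>], of x i, folded e_def] this]
    show ?thesis by simp
  qed
  have "(LBINT x. pd i \<phi> x) = (LBINT s. indicator {0..1::real} s *\<^sub>R (LBINT x. pd i \<phi> x))"
    by simp
  also have "\<dots> = (LBINT s. (LBINT x. indicator {0..1::real} s *\<^sub>R pd i \<phi> (x + s *\<^sub>R e)))"
    by (simp add: lborel_integral_shift)
  also have "\<dots> = (LBINT x. (LBINT s. indicator {0..1::real} s *\<^sub>R pd i \<phi> (x + s *\<^sub>R e)))"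
    using lborel_pair.Fubini_integral[OF int] by simp
  also have "\<dots> = (LBINT x. \<phi> (x + e) - \<phi> x)" by (simp add: ftc)
  also have "\<dots> = 0"
    using lborel_integrable_shift[OF schwartz_integrable[OF \<phi>], of e] schwartz_integrable[OF \<phi>]
    by (simp add: lborel_integral_shift)
  finally show ?thesis .
qed

lemma plane_wave_has_derivative:
  "((\<lambda>\<xi>. plane_wave x \<xi>) has_derivative (\<lambda>h. (2 * pi * \<i> * of_real (x \<bullet> h)) * plane_wave x \<xi>)) (at \<xi>)"
proof -
  have "((\<lambda>\<xi>. \<i> * complex_of_real (2 * pi * (x \<bullet> \<xi>))) has_derivative (\<lambda>h. \<i> * complex_of_real (2 * pi * (x \<bullet> h)))) (at \<xi>)"
    by (intro has_derivative_mult_right has_derivative_of_real bounded_linear.has_derivative[OF bounded_linear_inner_right] has_derivative_ident)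
  from has_derivative_compose[OF this DERIV_exp[unfolded has_field_derivative_def]]
  show ?thesis by (simp add: plane_wave_def cis_conv_exp mult_ac)
qed

lemma pd_plane_wave: "pd i (plane_wave x) = (\<lambda>\<xi>. (2 * pi * \<i> * of_real (x $ i)) * plane_wave x \<xi>)"
  by (intro ext pd_eqI[OF plane_wave_has_derivative, THEN trans]) (simp add: inner_axis)

lemma plane_wave_slow: "plane_wave (x::real^'n) \<in> slow"
proof -
  have "{plane_wave x} \<subseteq> slow"
  proof (rule slow_moduleI(2))
    fix f i assume f: "f \<in> {plane_wave x}"
    show "f differentiable (at y)" for y
      using f plane_wave_has_derivative[of x y] by (auto simp: differentiable_def)
    show "pd i f \<in> prods slow {plane_wave x}"
      using f by (auto simp: pd_plane_wave intro!: prods.mult slow_const)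
    have "\<forall>y. norm (plane_wave x y) \<le> 1 * (1 + norm y) ^ 0" by simp
    then show "poly_bounded f" using f unfolding poly_bounded_def by blast
  qed
  then show ?thesis by simp
qed

lemma norm_power_schwartz_integrable:
  assumes \<phi>: "\<phi> \<in> schwartz"
  shows "integrable lborel (\<lambda>\<xi>. norm \<xi> ^ k * norm (\<phi> \<xi>))"
proof -
  note [measurable] = schwartzD(5)[OF \<phi>]
  have "integrable lborel (\<lambda>\<xi>. complex_of_real (norm \<xi> ^ k) * \<phi> \<xi>)"
  proof (rule rapid_integrable)
    show "rapid (\<lambda>\<xi>. complex_of_real (norm \<xi> ^ k) * \<phi> \<xi>)"
    proof (rule rapid_mult)
      have "norm (complex_of_real (norm x ^ k)) \<le> 1 * (1 + norm x) ^ k" for x :: "real^'n"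
        by (simp add: norm_power power_mono)
      then show "poly_bounded (\<lambda>\<xi>::real^'n. complex_of_real (norm \<xi> ^ k))" unfolding poly_bounded_def by blast
    qed (use \<phi> in \<open>auto dest: schwartzD\<close>)
  qed measurable
  from integrable_norm[OF this] show ?thesis by (simp add: norm_mult norm_power)
qed

lemma norm_cis_remainder_le: "norm (cis t - 1 - \<i> * of_real t) \<le> t\<^sup>2 / 2"
  using iexp_approx1[of t 1] by (simp add: cis_conv_exp numeral_2_eq_2 diff_diff_eq power2_eq_square)

text \<open>
  A quadratic error bound is what integration of the second-order remainder of \<open>cis\<close> provides, and
  what the flatness of \<open>e^(-1/|x|\<^sup>2)\<close> at the origin provides.
\<close>

lemma has_derivative_quadraticI:
  fixes f :: "'a::real_normed_vector \<Rightarrow> 'b::real_normed_vector"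
  assumes L: "bounded_linear L" and b: "\<And>h. norm (f (x + h) - f x - L h) \<le> C * (norm h)\<^sup>2"
  shows "(f has_derivative L) (at x)"
  unfolding has_derivative_at
proof (intro conjI L)
  have "((\<lambda>h::'a. C * norm h) \<longlongrightarrow> C * norm (0::'a)) (at 0)" by (intro tendsto_intros)
  then have lim: "((\<lambda>h::'a. C * norm h) \<longlongrightarrow> 0) (at 0)" by simp
  show "(\<lambda>h. norm (f (x + h) - f x - L h) / norm h) \<midarrow>0\<rightarrow> 0"
  proof (rule tendsto_sandwich[OF _ _ tendsto_const lim])
    show "\<forall>\<^sub>F h in at 0. norm (f (x + h) - f x - L h) / norm h \<le> C * norm h"
    proof (rule eventually_at_filter[THEN iffD2], rule always_eventually, intro allI impI)
      fix h :: 'a assume "h \<noteq> 0"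
      then show "norm (f (x + h) - f x - L h) / norm h \<le> C * norm h"
        using b[of h] by (simp add: divide_le_eq power2_eq_square mult.assoc)
    qed
  qed (simp add: always_eventually)
qed

lemma inv_fourier_has_derivative:
  fixes \<phi> :: "real^'n \<Rightarrow> complex"
  assumes \<phi>: "\<phi> \<in> schwartz"
  shows "(inv_fourier \<phi> has_derivative (\<lambda>h. LBINT \<xi>. (\<phi> \<xi> * plane_wave x \<xi>) * (2 * pi * \<i> * of_real (h \<bullet> \<xi>)))) (at x)"
proof -
  note m[measurable] = schwartzD(5)[OF \<phi>]
  let ?L = "\<lambda>h \<xi>. (\<phi> \<xi> * plane_wave x \<xi>) * (2 * pi * \<i> * of_real (h \<bullet> \<xi>))"
  have nL: "norm (?L h \<xi>) \<le> (2 * pi * norm h) * (norm \<xi> ^ 1 * norm (\<phi> \<xi>))" for h \<xi>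
  proof -
    have "norm (?L h \<xi>) = 2 * pi * norm (\<phi> \<xi>) * \<bar>h \<bullet> \<xi>\<bar>" by (simp add: norm_mult)
    also have "\<dots> \<le> 2 * pi * norm (\<phi> \<xi>) * (norm h * norm \<xi>)"
      by (intro mult_left_mono Cauchy_Schwarz_ineq2) auto
    finally show ?thesis by (simp add: mult_ac)
  qed
  have iL: "integrable lborel (?L h)" for h
  proof (rule Bochner_Integration.integrable_bound)
    show "integrable lborel (\<lambda>\<xi>. (2 * pi * norm h) * (norm \<xi> ^ 1 * norm (\<phi> \<xi>)))"
      by (rule integrable_mult_right[OF norm_power_schwartz_integrable[OF \<phi>]])
    show "AE \<xi> in lborel. norm (?L h \<xi>) \<le> norm ((2 * pi * norm h) * (norm \<xi> ^ 1 * norm (\<phi> \<xi>)))"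
      by (intro AE_I2 order_trans[OF nL]) simp
  qed measurable
  have i1: "integrable lborel (\<lambda>\<xi>. \<phi> \<xi> * plane_wave y \<xi>)" for y
    by (rule integrable_mult_plane_wave[OF schwartz_integrable[OF \<phi>]])
  show ?thesis
  proof (rule has_derivative_quadraticI)
    show "bounded_linear (\<lambda>h. LBINT \<xi>. ?L h \<xi>)"
    proof (rule bounded_linear_intro[where K="2 * pi * (LBINT \<xi>. norm \<xi> ^ 1 * norm (\<phi> \<xi>))"])
      fix h k :: "real^'n" and r :: real
      have "(LBINT \<xi>. ?L (h + k) \<xi>) = (LBINT \<xi>. ?L h \<xi> + ?L k \<xi>)"
        by (intro Bochner_Integration.integral_cong) (simp_all add: inner_add_left algebra_simps)
      then show "(LBINT \<xi>. ?L (h + k) \<xi>) = (LBINT \<xi>. ?L h \<xi>) + (LBINT \<xi>. ?L k \<xi>)"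
        using iL[of h] iL[of k] by simp
      have "(LBINT \<xi>. ?L (r *\<^sub>R h) \<xi>) = (LBINT \<xi>. r *\<^sub>R ?L h \<xi>)"
        by (intro Bochner_Integration.integral_cong) (simp_all add: scaleR_conv_of_real[where 'a=complex])
      then show "(LBINT \<xi>. ?L (r *\<^sub>R h) \<xi>) = r *\<^sub>R (LBINT \<xi>. ?L h \<xi>)" by simp
      have "norm (LBINT \<xi>. ?L h \<xi>) \<le> (LBINT \<xi>. norm (?L h \<xi>))" by (rule integral_norm_bound)
      also have "\<dots> \<le> (LBINT \<xi>. (2 * pi * norm h) * (norm \<xi> ^ 1 * norm (\<phi> \<xi>)))"
        by (intro integral_mono integrable_norm iL nL integrable_mult_right norm_power_schwartz_integrable[OF \<phi>])
      also have "\<dots> = norm h * (2 * pi * (LBINT \<xi>. norm \<xi> ^ 1 * norm (\<phi> \<xi>)))"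
        unfolding integral_mult_right_zero by (simp only: mult_ac)
      finally show "norm (LBINT \<xi>. ?L h \<xi>) \<le> norm h * (2 * pi * (LBINT \<xi>. norm \<xi> ^ 1 * norm (\<phi> \<xi>)))" .
    qed
    fix h :: "real^'n"
    let ?R = "\<lambda>\<xi>. \<phi> \<xi> * plane_wave (x + h) \<xi> - \<phi> \<xi> * plane_wave x \<xi> - ?L h \<xi>"
    have nR: "norm (?R \<xi>) \<le> (2 * pi\<^sup>2 * (norm h)\<^sup>2) * (norm \<xi> ^ 2 * norm (\<phi> \<xi>))" for \<xi>
    proof -
      let ?t = "2 * pi * (h \<bullet> \<xi>)"
      have "?R \<xi> = (\<phi> \<xi> * plane_wave x \<xi>) * (cis ?t - 1 - \<i> * of_real ?t)"
        unfolding plane_wave_add by (simp add: plane_wave_def algebra_simps)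
      then have "norm (?R \<xi>) = norm (\<phi> \<xi>) * norm (cis ?t - 1 - \<i> * of_real ?t)"
        by (simp add: norm_mult del: of_real_mult)
      also have "\<dots> \<le> norm (\<phi> \<xi>) * (?t\<^sup>2 / 2)" by (intro mult_left_mono norm_cis_remainder_le) auto
      also have "\<dots> = norm (\<phi> \<xi>) * (2 * pi\<^sup>2 * (h \<bullet> \<xi>)\<^sup>2)" by (simp add: power_mult_distrib)
      also have "\<dots> \<le> norm (\<phi> \<xi>) * (2 * pi\<^sup>2 * (norm h * norm \<xi>)\<^sup>2)"
      proof -
        have "(h \<bullet> \<xi>)\<^sup>2 \<le> (norm h * norm \<xi>)\<^sup>2"
          using power_mono[OF Cauchy_Schwarz_ineq2[of h \<xi>], of 2] by simp
        then show ?thesis by (intro mult_left_mono) auto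
      qed
      finally show ?thesis by (simp add: power_mult_distrib mult_ac)
    qed
    have iR: "integrable lborel ?R"
      by (rule Bochner_Integration.integrable_diff[OF Bochner_Integration.integrable_diff[OF i1[of "x + h"] i1[of x]] iL[of h]])
    have "inv_fourier \<phi> (x + h) - inv_fourier \<phi> x - (LBINT \<xi>. ?L h \<xi>) = (LBINT \<xi>. ?R \<xi>)"
      using i1 iL[of h] by (simp add: inv_fourier_eq[OF m])
    then have "norm (inv_fourier \<phi> (x + h) - inv_fourier \<phi> x - (LBINT \<xi>. ?L h \<xi>)) \<le> (LBINT \<xi>. norm (?R \<xi>))"
      by (simp only: integral_norm_bound)
    also have "\<dots> \<le> (LBINT \<xi>. (2 * pi\<^sup>2 * (norm h)\<^sup>2) * (norm \<xi> ^ 2 * norm (\<phi> \<xi>)))"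
    proof (rule integral_mono)
      show "integrable lborel (\<lambda>\<xi>. norm (?R \<xi>))"
        by (rule integrable_norm[OF iR])
      show "integrable lborel (\<lambda>\<xi>. (2 * pi\<^sup>2 * (norm h)\<^sup>2) * (norm \<xi> ^ 2 * norm (\<phi> \<xi>)))"
        by (rule integrable_mult_right[OF norm_power_schwartz_integrable[OF \<phi>]])
    qed (rule nR)
    also have "\<dots> = (2 * pi\<^sup>2 * (LBINT \<xi>. norm \<xi> ^ 2 * norm (\<phi> \<xi>))) * (norm h)\<^sup>2"
      unfolding integral_mult_right_zero by (simp only: mult_ac)
    finally show "norm (inv_fourier \<phi> (x + h) - inv_fourier \<phi> x - (LBINT \<xi>. ?L h \<xi>))
       \<le> (2 * pi\<^sup>2 * (LBINT \<xi>. norm \<xi> ^ 2 * norm (\<phi> \<xi>))) * (norm h)\<^sup>2" .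
  qed
qed

lemma pd_inv_fourier:
  assumes \<phi>: "\<phi> \<in> schwartz"
  shows "pd i (inv_fourier \<phi>) = inv_fourier (\<lambda>\<xi>. (2 * pi * \<i> * of_real (\<xi> $ i)) * \<phi> \<xi>)"
proof
  fix x
  note m[measurable] = schwartzD(5)[OF \<phi>]
  show "pd i (inv_fourier \<phi>) x = inv_fourier (\<lambda>\<xi>. (2 * pi * \<i> * of_real (\<xi> $ i)) * \<phi> \<xi>) x"
    by (subst pd_eqI[OF inv_fourier_has_derivative[OF \<phi>]], subst inv_fourier_eq)
       (simp_all add: inner_axis' mult_ac)
qed

text \<open>
  Integration by parts against the plane wave, which is itself slowly increasing.
\<close>

lemma component_inv_fourier:
  assumes \<phi>: "\<phi> \<in> schwartz"
  shows "complex_of_real (x $ i) * inv_fourier \<phi> x = inv_fourier (\<lambda>\<xi>. (\<i> / (2 * pi)) * pd i \<phi> \<xi>) x"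
proof -
  note p = schwartzD(3)[OF \<phi>, of i]
  note m[measurable] = schwartzD(5)[OF \<phi>] schwartzD(5)[OF p]
  have s: "(\<lambda>\<xi>. plane_wave x \<xi> * \<phi> \<xi>) \<in> schwartz" by (rule slow_schwartz[OF plane_wave_slow \<phi>])
  have "pd i (\<lambda>\<xi>. plane_wave x \<xi> * \<phi> \<xi>) \<xi> = (2 * pi * \<i> * of_real (x $ i)) * (\<phi> \<xi> * plane_wave x \<xi>) + pd i \<phi> \<xi> * plane_wave x \<xi>" for \<xi>
    by (subst pd_mult) (simp_all add: slowD(2)[OF plane_wave_slow] schwartzD(2)[OF \<phi>] pd_plane_wave mult_ac)
  then have "0 = (LBINT \<xi>. (2 * pi * \<i> * of_real (x $ i)) * (\<phi> \<xi> * plane_wave x \<xi>) + pd i \<phi> \<xi> * plane_wave x \<xi>)"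
    using integral_pd_zero[OF s, of i] by simp
  also have "\<dots> = (2 * pi * \<i> * of_real (x $ i)) * (LBINT \<xi>. \<phi> \<xi> * plane_wave x \<xi>) + (LBINT \<xi>. pd i \<phi> \<xi> * plane_wave x \<xi>)"
    using integrable_mult_plane_wave[OF schwartz_integrable[OF \<phi>], of x] integrable_mult_plane_wave[OF schwartz_integrable[OF p], of x]
    by simp
  also have "\<dots> = (2 * pi * \<i> * of_real (x $ i)) * inv_fourier \<phi> x + inv_fourier (pd i \<phi>) x"
    using m by (simp add: inv_fourier_eq)
  finally have eq: "inv_fourier (pd i \<phi>) x = - (2 * pi * \<i> * of_real (x $ i)) * inv_fourier \<phi> x"
    by (simp add: eq_neg_iff_add_eq_0 add.commute)
  have "inv_fourier (\<lambda>\<xi>. (\<i> / (2 * pi)) * pd i \<phi> \<xi>) x = (\<i> / (2 * pi)) * inv_fourier (pd i \<phi>) x"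
    using m by (simp add: inv_fourier_eq mult.assoc)
  also have "\<dots> = complex_of_real (x $ i) * inv_fourier \<phi> x"
    unfolding eq by (simp add: field_simps)
  finally show ?thesis ..
qed

text \<open>
  The image of the Schwartz space is closed under derivatives, since these correspond to
  multiplication by the frequency variable; the decay of a single member follows since
  multiplication by coordinates corresponds to derivatives, after which the sup-norm is bounded by
  the \<open>L^1\<close> norm.
\<close>

lemma inv_fourier_schwartz:
  fixes \<phi> :: "real^'n \<Rightarrow> complex"
  assumes "\<phi> \<in> schwartz"
  shows "inv_fourier \<phi> \<in> schwartz"
proof -
  have "inv_fourier ` schwartz \<subseteq> (schwartz :: (real^'n \<Rightarrow> complex) set)"
  proof (rule schwartz_subsetI)
    show "pd_closed (inv_fourier ` (schwartz :: (real^'n \<Rightarrow> complex) set))"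
      unfolding pd_closed_def
    proof (intro ballI conjI allI)
      fix f :: "real^'n \<Rightarrow> complex" and x i assume "f \<in> inv_fourier ` schwartz"
      then obtain \<phi> where \<phi>: "\<phi> \<in> schwartz" "f = inv_fourier \<phi>" by blast
      show "f differentiable at x" using inv_fourier_has_derivative[OF \<phi>(1)] \<phi>(2) unfolding differentiable_def by blast
      show "pd i f \<in> inv_fourier ` schwartz"
        unfolding \<phi>(2) pd_inv_fourier[OF \<phi>(1)]
        by (intro imageI slow_schwartz[OF slow_mult[OF slow_const slow_component] \<phi>(1)])
    qed
    fix f :: "real^'n \<Rightarrow> complex" assume "f \<in> inv_fourier ` schwartz"
    then obtain \<phi> where \<phi>: "\<phi> \<in> schwartz" "f = inv_fourier \<phi>" by blast
    show "rapid f"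
    proof (rule rapidI)
      fix i k
      have "\<exists>\<phi>'\<in>schwartz. \<forall>x. complex_of_real (x $ i) ^ k * f x = inv_fourier \<phi>' x"
      proof (induction k)
        case 0 then show ?case using \<phi> by auto
      next
        case (Suc k)
        then obtain \<phi>' where \<phi>': "\<phi>' \<in> schwartz" "\<And>x. complex_of_real (x $ i) ^ k * f x = inv_fourier \<phi>' x" by blast
        show ?case
        proof (intro bexI allI)
          show "(\<lambda>\<xi>. (\<i> / (2 * pi)) * pd i \<phi>' \<xi>) \<in> schwartz"
            by (rule schwartz_cmult[OF schwartzD(3)[OF \<phi>'(1)]])
          show "complex_of_real (x $ i) ^ Suc k * f x = inv_fourier (\<lambda>\<xi>. (\<i> / (2 * pi)) * pd i \<phi>' \<xi>) x" for x
            unfolding component_inv_fourier[OF \<phi>'(1), of x i, symmetric] \<phi>'(2)[of x, symmetric]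
            by simp
        qed
      qed
      then obtain \<phi>' where \<phi>': "\<phi>' \<in> schwartz" "\<And>x. complex_of_real (x $ i) ^ k * f x = inv_fourier \<phi>' x" by blast
      have "\<bar>x $ i\<bar> ^ k * norm (f x) \<le> (LBINT \<xi>. norm (\<phi>' \<xi>))" for x
        using norm_inv_fourier_le[OF schwartz_integrable[OF \<phi>'(1)], of x] \<phi>'(2)[of x, symmetric]
        by (simp add: norm_mult norm_power)
      then show "\<exists>C. \<forall>x. \<bar>x $ i\<bar> ^ k * norm (f x) \<le> C" by blast
    qed
  qed
  then show ?thesis using assms by blast
qed

lemma power_le_fact_exp:
  fixes u :: real
  assumes "0 \<le> u"
  shows "u ^ k \<le> fact k * exp u"
proof -
  have s: "(\<lambda>n. u ^ n /\<^sub>R fact n) sums exp u" by (rule exp_converges)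
  have "(\<Sum>n\<in>{k}. u ^ n /\<^sub>R fact n) \<le> (\<Sum>n. u ^ n /\<^sub>R fact n)"
    using assms by (intro sum_le_suminf sums_summable[OF s]) auto
  then have "u ^ k / fact k \<le> exp u" using sums_unique[OF s] by (simp add: field_simps)
  then show ?thesis by (simp add: field_simps)
qed

lemma rapid_if_gaussian_bound:
  assumes b: "\<And>x. norm (f x) \<le> C * exp (- (norm x)\<^sup>2)"
  shows "rapid f"
  unfolding rapid_def
proof
  fix k
  have C0: "0 \<le> C" using order_trans[OF norm_ge_zero b[of 0]] by simp
  have "(1 + norm x) ^ k * norm (f x) \<le> fact k * C * exp 2" for x
  proof -
    have "(1 + norm x) ^ k * norm (f x) \<le> (fact k * exp (1 + norm x)) * (C * exp (- (norm x)\<^sup>2))"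
      by (intro mult_mono power_le_fact_exp b) auto
    also have "\<dots> = fact k * C * exp (1 + norm x - (norm x)\<^sup>2)"
      by (simp add: exp_add exp_diff exp_minus field_simps)
    also have "\<dots> \<le> fact k * C * exp 2"
    proof -
      have "0 \<le> (norm x - 1/2)\<^sup>2" by simp
      then have "1 + norm x - (norm x)\<^sup>2 \<le> 2" by (simp add: power2_eq_square algebra_simps)
      then show ?thesis using C0 by (intro mult_left_mono) auto
    qed
    finally show ?thesis .
  qed
  then show "\<exists>C. \<forall>x. (1 + norm x) ^ k * norm (f x) \<le> C" by blast
qed

lemma dilation_has_derivative:
  fixes f :: "real^'n \<Rightarrow> complex"
  assumes "f differentiable (at (c *\<^sub>R x))"
  shows "((\<lambda>x. a * f (c *\<^sub>R x)) has_derivative (\<lambda>h. a * frechet_derivative f (at (c *\<^sub>R x)) (c *\<^sub>R h))) (at x)"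
proof -
  have "((\<lambda>x. c *\<^sub>R x) has_derivative (\<lambda>h. c *\<^sub>R h)) (at x)" by (auto intro!: derivative_eq_intros)
  from has_derivative_compose[OF this has_derivative_frechet[OF assms]]
  show ?thesis by (rule has_derivative_mult_right)
qed

text \<open>
  The scalar \<open>a\<close> absorbs the factor \<open>c\<close> that each derivative produces.
\<close>

lemma pd_closed_dilation:
  fixes X :: "(real^'n \<Rightarrow> complex) set"
  assumes X: "pd_closed X"
  shows "pd_closed {\<lambda>x. a * f (c *\<^sub>R x) | a f. f \<in> X}" (is "pd_closed ?Y")
  unfolding pd_closed_def
proof (intro ballI conjI allI)
  fix g :: "real^'n \<Rightarrow> complex" and x i assume "g \<in> ?Y"
  then obtain a f where g: "g = (\<lambda>x. a * f (c *\<^sub>R x))" and f: "f \<in> X" by blast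
  note D = dilation_has_derivative[OF pd_closedD(1)[OF X f], of a c]
  show "g differentiable at x" using D[of x] unfolding g differentiable_def by blast
  have "pd i g x = (a * of_real c) * pd i f (c *\<^sub>R x)" for x i
  proof -
    have "pd i g x = a * frechet_derivative f (at (c *\<^sub>R x)) (c *\<^sub>R axis i 1)"
      unfolding g by (rule pd_eqI[OF D])
    also have "frechet_derivative f (at (c *\<^sub>R x)) (c *\<^sub>R axis i 1) = c *\<^sub>R pd i f (c *\<^sub>R x)"
      unfolding pd_def by (rule linear_scale[OF has_derivative_linear[OF has_derivative_frechet[OF pd_closedD(1)[OF X f]]]])
    finally show ?thesis by (simp add: scaleR_conv_of_real)
  qed
  then have "pd i g = (\<lambda>x. (a * of_real c) * pd i f (c *\<^sub>R x))" by blast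
  then show "pd i g \<in> ?Y" using pd_closedD(2)[OF X f] by blast
qed

lemma schwartz_dilation:
  fixes f :: "real^'n \<Rightarrow> complex"
  assumes f: "f \<in> schwartz" and c: "c \<noteq> 0"
  shows "(\<lambda>x. f (c *\<^sub>R x)) \<in> schwartz"
proof -
  have "{\<lambda>x. a * f (c *\<^sub>R x) | a f. f \<in> (schwartz :: (real^'n \<Rightarrow> complex) set)} \<subseteq> schwartz"
  proof (rule schwartz_subsetI[OF pd_closed_dilation[OF pd_closed_schwartz]])
    fix g :: "real^'n \<Rightarrow> complex" assume "g \<in> {\<lambda>x. a * f (c *\<^sub>R x) | a f. f \<in> schwartz}"
    then obtain a f where g: "g = (\<lambda>x. a * f (c *\<^sub>R x))" and f: "f \<in> schwartz" by blast
    have r: "rapid (\<lambda>x. f (c *\<^sub>R x))"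
      unfolding rapid_def
    proof
      fix k
      obtain C where C: "\<And>x. (1 + norm x) ^ k * norm (f x) \<le> C"
        using schwartzD(1)[OF f] unfolding rapid_def by blast
      have "(1 + norm x) ^ k * norm (f (c *\<^sub>R x)) \<le> (1 + 1 / \<bar>c\<bar>) ^ k * C" for x
      proof -
        have "1 + norm x \<le> (1 + 1 / \<bar>c\<bar>) * (1 + norm (c *\<^sub>R x))"
          using c by (simp add: field_simps)
        then have "(1 + norm x) ^ k \<le> ((1 + 1 / \<bar>c\<bar>) * (1 + norm (c *\<^sub>R x))) ^ k"
          by (intro power_mono) auto
        then have "(1 + norm x) ^ k * norm (f (c *\<^sub>R x)) \<le> ((1 + 1 / \<bar>c\<bar>) ^ k * (1 + norm (c *\<^sub>R x)) ^ k) * norm (f (c *\<^sub>R x))"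
          unfolding power_mult_distrib by (rule mult_right_mono) simp
        also have "\<dots> \<le> (1 + 1 / \<bar>c\<bar>) ^ k * C"
          unfolding mult.assoc by (rule mult_left_mono[OF C]) (simp add: add_nonneg_nonneg)
        finally show ?thesis .
      qed
      then show "\<exists>C. \<forall>x. (1 + norm x) ^ k * norm (f (c *\<^sub>R x)) \<le> C" by blast
    qed
    show "rapid g" unfolding g by (rule rapid_mult[OF slowD(1)[OF slow_const] r])
  qed
  moreover have "(\<lambda>x. 1 * f (c *\<^sub>R x)) \<in> {\<lambda>x. a * f (c *\<^sub>R x) | a f. f \<in> schwartz}" using f by blast
  ultimately show ?thesis by auto
qed

lemma fourier_schwartz:
  assumes "\<phi> \<in> schwartz"
  shows "fourier \<phi> \<in> schwartz"
proof -
  have "fourier \<phi> = (\<lambda>\<xi>. inv_fourier \<phi> ((-1) *\<^sub>R \<xi>))"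
    using schwartzD(5)[OF assms] by (intro ext) (simp add: fourier_eq_inv_fourier)
  then show ?thesis using schwartz_dilation[OF inv_fourier_schwartz[OF assms], of "-1"] by simp
qed

lemma schwartz_inversion:
  assumes "\<phi> \<in> schwartz"
  shows "inv_fourier (fourier \<phi>) x = \<phi> x"
proof -
  obtain B where "\<And>x. norm (\<phi> x) \<le> B" using rapid_bounded[OF schwartzD(1)[OF assms]] by blast
  then show ?thesis
    by (intro fourier_inversion schwartz_integrable fourier_schwartz schwartzD(4) assms)
qed

text \<open>
  Pairing the constant \<open>1\<close> with an inverse transform gives a point evaluation at the origin: a
  constant function has its spectrum there.
\<close>

lemma integral_inv_fourier:
  fixes \<theta> :: "real^'n \<Rightarrow> complex"
  assumes \<theta>: "\<theta> \<in> schwartz"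
  shows "(LBINT x. inv_fourier \<theta> x) = \<theta> 0"
proof -
  note [measurable] = schwartzD(5)[OF \<theta>] schwartzD(5)[OF fourier_schwartz[OF \<theta>]]
  have "\<theta> 0 = (LBINT \<xi>. fourier \<theta> \<xi>)"
    using schwartz_inversion[OF \<theta>, of 0] by (simp add: inv_fourier_eq)
  also have "\<dots> = (LBINT \<xi>. inv_fourier \<theta> (- \<xi>))" by (simp add: fourier_eq_inv_fourier)
  also have "\<dots> = (LBINT \<xi>. inv_fourier \<theta> \<xi>)"
    using lborel_integral_affine[of "inv_fourier \<theta>" "-1" 0] by simp
  finally show ?thesis ..
qed

definition gauss :: "real^'n \<Rightarrow> complex" where
  "gauss x = of_real (exp (- (norm x)\<^sup>2))"

lemma gauss_has_derivative: "(gauss has_derivative (\<lambda>h. of_real (- 2 * (x \<bullet> h)) * gauss x)) (at x)"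
proof -
  have "((\<lambda>x. - (norm x)\<^sup>2) has_derivative (\<lambda>h. - (2 * (x \<bullet> h)))) (at x)"
    by (intro has_derivative_minus has_derivative_norm_sq)
  from has_derivative_of_real[OF has_derivative_compose[OF this DERIV_exp[unfolded has_field_derivative_def]], where 'a=complex]
  show ?thesis by (simp add: gauss_def[abs_def] mult_ac)
qed

lemma gauss_schwartz: "(gauss :: real^'n \<Rightarrow> complex) \<in> schwartz"
proof -
  have "{gauss :: real^'n \<Rightarrow> complex} \<subseteq> schwartz"
  proof (rule schwartz_moduleI)
    fix f :: "real^'n \<Rightarrow> complex" and i assume f: "f \<in> {gauss}"
    show "f differentiable (at x)" for x
      using f gauss_has_derivative[of x] unfolding differentiable_def by blast
    have "pd i gauss = (\<lambda>x::real^'n. (of_real (-2) * of_real (x $ i)) * gauss x)"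
      by (intro ext pd_eqI[OF gauss_has_derivative, THEN trans]) (simp add: inner_axis)
    moreover have "(\<lambda>x::real^'n. (of_real (-2) * of_real (x $ i)) * gauss x) \<in> prods slow {gauss}"
      by (intro prods.mult slow_mult slow_const slow_component singletonI)
    ultimately show "pd i f \<in> prods slow {gauss}" using f by (simp only: singleton_iff)
    show "rapid f" by (rule rapid_if_gaussian_bound[of _ 1]) (use f in \<open>simp add: gauss_def\<close>)
  qed
  then show ?thesis by simp
qed

lemma integral_gauss_ne_0: "(LBINT x. (gauss :: real^'n \<Rightarrow> complex) x) \<noteq> 0"
  using gaussian_fourier(2)[of 1 "0::real^'n"] by (simp add: gauss_def)

section \<open>Uniqueness of densities\<close>

text \<open>
  The closed sets are stable under intersection and generate the Borel sets, so the positive and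
  the negative part of \<open>f\<close> are densities of the same measure.
\<close>

lemma AE_zero_if_closed_integrals_zero:
  fixes f :: "'a::euclidean_space \<Rightarrow> real"
  assumes f: "integrable lborel f"
    and z: "\<And>C. closed C \<Longrightarrow> (LBINT x. indicator C x * f x) = 0"
  shows "AE x in lborel. f x = 0"
proof -
  note [measurable] = borel_measurable_integrable[OF f]
  let ?M = "density lborel (\<lambda>x. ennreal (f x))" and ?N = "density lborel (\<lambda>x. ennreal (- f x))"
  have fin: "(\<integral>\<^sup>+x. ennreal (indicator C x * f x) \<partial>lborel) < \<infinity> \<and> (\<integral>\<^sup>+x. ennreal (- (indicator C x * f x)) \<partial>lborel) < \<infinity>"
    if C: "closed C" for C
  proof -
    have [measurable]: "C \<in> sets borel" using C by simp
    have "integrable lborel (\<lambda>x. indicator C x * f x)"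
      by (rule Bochner_Integration.integrable_bound[OF f]) (auto simp: indicator_def)
    then show ?thesis unfolding real_integrable_def by (auto simp: less_top)
  qed
  have em: "emeasure ?M C = (\<integral>\<^sup>+x. ennreal (indicator C x * f x) \<partial>lborel)"
    "emeasure ?N C = (\<integral>\<^sup>+x. ennreal (- (indicator C x * f x)) \<partial>lborel)" if C: "closed C" for C
  proof -
    have [measurable]: "C \<in> sets borel" using C by simp
    show "emeasure ?M C = (\<integral>\<^sup>+x. ennreal (indicator C x * f x) \<partial>lborel)"
      "emeasure ?N C = (\<integral>\<^sup>+x. ennreal (- (indicator C x * f x)) \<partial>lborel)"
      by (auto simp: emeasure_density indicator_def intro!: nn_integral_cong)
  qed
  have "?M = ?N"
  proof (rule measure_eqI_generator_eq[where E="Collect closed" and \<Omega>=UNIV and A="\<lambda>_. UNIV"])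
    show "Int_stable (Collect closed :: 'a set set)" by (auto simp: Int_stable_def)
    show "sets ?M = sigma_sets UNIV (Collect closed)" "sets ?N = sigma_sets UNIV (Collect closed)"
      by (simp_all add: borel_eq_closed)
    fix C :: "'a set" assume "C \<in> Collect closed"
    then have C: "closed C" by simp
    have "integrable lborel (\<lambda>x. indicator C x * f x)"
      using fin[OF C] C by (simp add: real_integrable_def less_top)
    from real_lebesgue_integral_def[OF this] z[OF C]
    have "enn2real (emeasure ?M C) = enn2real (emeasure ?N C)" by (simp add: em[OF C])
    then show "emeasure ?M C = emeasure ?N C"
      using fin[OF C] unfolding em[OF C, symmetric] by (metis ennreal_enn2real infinity_ennreal_def)
  next
    show "emeasure ?M UNIV \<noteq> \<infinity>" using fin[of UNIV] em[of UNIV] by auto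
  qed auto
  then have "AE x in lborel. ennreal (f x) = ennreal (- f x)"
    by (intro sigma_finite_measure.density_unique[OF sigma_finite_lborel]) auto
  then show ?thesis
  proof eventually_elim
    case (elim x)
    then show ?case by (cases "0 \<le> f x") (auto simp: ennreal_neg ennreal_eq_0_iff)
  qed
qed

text \<open>
  If the transform of \<open>k\<close> vanishes then so do all heat regularisations of \<open>k\<close>. Moving the heat
  kernel to a bounded continuous test function and letting the time tend to zero shows that \<open>k\<close> is
  orthogonal to every such function, and indicators of closed sets are bounded limits of these.
\<close>

lemma fourier_injective:
  fixes k :: "real^'n \<Rightarrow> complex"
  assumes k: "integrable lborel k" and z: "\<And>\<xi>. fourier k \<xi> = 0"
  shows "AE x in lborel. k x = 0"
proof -
  note [measurable] = borel_measurable_integrable[OF k]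
  have test: "(LBINT y. k y * b y) = 0"
    if cb: "continuous_on UNIV b" and B: "\<And>x. norm (b x) \<le> B" for b :: "real^'n \<Rightarrow> complex" and B
  proof -
    have [measurable]: "b \<in> borel_measurable borel" by (rule borel_measurable_continuous_onI[OF cb])
    define t where "t = (\<lambda>j::nat. (1 / real (Suc j))\<^sup>2)"
    have t: "0 < t j" for j by (simp add: t_def)
    have hi: "integrable lborel (\<lambda>x. heat (t j) (y - x))" for j and y :: "real^'n"
      using lborel_integrable_affine[OF heat_integrable[OF t[of j]], of "-1" y] by simp
    have hi1: "(LBINT x. heat (t j) (y - x)) = 1" for j and y :: "real^'n"
      using lborel_integral_affine[of "heat (t j)" "-1" y] heat_integral[OF t[of j], where 'a="real^'n"] by simp
    have hb: "integrable lborel (\<lambda>x. of_real (heat (t j) (y - x)) * b x)" for j y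
      by (rule Bochner_Integration.integrable_bound[where f="\<lambda>x. B * heat (t j) (y - x)"])
         (use hi B order_trans[OF norm_ge_zero B] in \<open>auto simp: norm_mult abs_mult mult.commute[of B] intro!: mult_left_mono\<close>)
    have hbn: "norm (LBINT x. of_real (heat (t j) (y - x)) * b x) \<le> B" for j y
    proof -
      have "norm (LBINT x. of_real (heat (t j) (y - x)) * b x) \<le> (LBINT x. norm (of_real (heat (t j) (y - x)) * b x))"
        by (rule integral_norm_bound)
      also have "\<dots> \<le> (LBINT x. B * heat (t j) (y - x))"
        by (rule integral_mono[OF integrable_norm[OF hb]])
           (use hi B in \<open>auto simp: norm_mult mult.commute[of B] intro!: mult_left_mono\<close>)
      finally have "norm (LBINT x. of_real (heat (t j) (y - x)) * b x) \<le> (LBINT x. B * heat (t j) (y - x))" .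
      then show ?thesis by (simp add: hi1)
    qed
    have zero: "(LBINT y. k y * (LBINT x. of_real (heat (t j) (y - x)) * b x)) = 0" for j
    proof -
      have int: "integrable (lborel \<Otimes>\<^sub>M lborel) (\<lambda>(y,x). k y * (of_real (heat (t j) (y - x)) * b x))"
      proof (rule lborel_pair.Fubini_integrable)
        show "integrable lborel (\<lambda>y. LBINT x. norm (case (y,x) of (y,x) \<Rightarrow> k y * (of_real (heat (t j) (y - x)) * b x)))"
        proof (rule Bochner_Integration.integrable_bound[where f="\<lambda>y. norm (k y) * B"])
          show "AE y in lborel. norm (LBINT x. norm (case (y,x) of (y,x) \<Rightarrow> k y * (of_real (heat (t j) (y - x)) * b x))) \<le> norm (norm (k y) * B)"
          proof (rule AE_I2)
            fix y
            have "(LBINT x. norm (case (y,x) of (y,x) \<Rightarrow> k y * (of_real (heat (t j) (y - x)) * b x)))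
              \<le> (LBINT x. norm (k y) * B * heat (t j) (y - x))"
            proof (rule integral_mono)
              show "integrable lborel (\<lambda>x. norm (case (y,x) of (y,x) \<Rightarrow> k y * (of_real (heat (t j) (y - x)) * b x)))"
                using hb by simp
              show "integrable lborel (\<lambda>x. norm (k y) * B * heat (t j) (y - x))" using hi by simp
              fix x
              have "norm (k y) * (heat (t j) (y - x) * norm (b x)) \<le> norm (k y) * (heat (t j) (y - x) * B)"
                by (intro mult_left_mono B) auto
              then show "norm (case (y,x) of (y,x) \<Rightarrow> k y * (of_real (heat (t j) (y - x)) * b x)) \<le> norm (k y) * B * heat (t j) (y - x)"
                by (simp add: norm_mult mult_ac)
            qed
            also have "\<dots> = norm (k y) * B" by (simp add: hi1)
            finally show "norm (LBINT x. norm (case (y,x) of (y,x) \<Rightarrow> k y * (of_real (heat (t j) (y - x)) * b x))) \<le> norm (norm (k y) * B)"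
              using order_trans[OF norm_ge_zero B] by simp
          qed
        qed (use k in auto)
        show "AE y in lborel. integrable lborel (\<lambda>x. case (y,x) of (y,x) \<Rightarrow> k y * (of_real (heat (t j) (y - x)) * b x))"
          using hb by simp
      qed measurable
      have "(LBINT y. k y * (LBINT x. of_real (heat (t j) (y - x)) * b x)) = (LBINT y. LBINT x. k y * (of_real (heat (t j) (y - x)) * b x))"
        by simp
      also have "\<dots> = (LBINT x. LBINT y. k y * (of_real (heat (t j) (y - x)) * b x))"
        using lborel_pair.Fubini_integral[OF int] by simp
      also have "\<dots> = (LBINT x. b x * (LBINT y. of_real (heat (t j) (x - y)) * k y))"
      proof (intro Bochner_Integration.integral_cong refl)
        fix x
        have e: "k y * (of_real (heat (t j) (y - x)) * b x) = b x * (of_real (heat (t j) (x - y)) * k y)" for y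
          using heat_minus[of "t j" "x - y"] by (simp add: mult_ac)
        then show "(LBINT y. k y * (of_real (heat (t j) (y - x)) * b x)) = b x * (LBINT y. of_real (heat (t j) (x - y)) * k y)"
          unfolding e by simp
      qed
      also have "\<dots> = 0" using heat_convolution_eq[OF k t[of j]] by (simp add: z)
      finally show ?thesis .
    qed
    have "(\<lambda>j. LBINT y. k y * (LBINT x. of_real (heat (t j) (y - x)) * b x)) \<longlonglongrightarrow> (LBINT y. k y * b y)"
    proof (rule integral_dominated_convergence)
      show "integrable lborel (\<lambda>y. norm (k y) * B)" using k by simp
      show "AE y in lborel. (\<lambda>j. k y * (LBINT x. of_real (heat (t j) (y - x)) * b x)) \<longlonglongrightarrow> k y * b y"
        unfolding t_def by (intro AE_I2 tendsto_mult_left heat_approximates_identity[OF cb B])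
      show "AE y in lborel. norm (k y * (LBINT x. of_real (heat (t j) (y - x)) * b x)) \<le> norm (k y) * B" for j
        using hbn by (auto simp: norm_mult intro!: mult_left_mono)
    qed measurable
    then show ?thesis by (simp add: zero LIMSEQ_const_iff)
  qed
  have closed0: "(LBINT x. indicator C x *\<^sub>R k x) = 0" if C: "closed C" for C
  proof (cases "C = {}")
    case False
    have [measurable]: "C \<in> sets borel" using C by simp
    define b where "b = (\<lambda>m x. complex_of_real (max 0 (1 - real m * infdist x C)))"
    have bc: "continuous_on UNIV (b m)" for m unfolding b_def by (intro continuous_intros)
    have b1: "norm (b m x) \<le> 1" for m x unfolding b_def by (simp add: infdist_nonneg)
    have [measurable]: "b m \<in> borel_measurable borel" for m by (rule borel_measurable_continuous_onI[OF bc])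
    have "(\<lambda>m. LBINT x. k x * b m x) \<longlonglongrightarrow> (LBINT x. k x * indicator C x)"
    proof (rule integral_dominated_convergence)
      show "integrable lborel (\<lambda>y. norm (k y))" using k by simp
      show "AE x in lborel. norm (k x * b m x) \<le> norm (k x)" for m
        using b1 by (auto simp: norm_mult intro!: mult_left_le)
      show "AE x in lborel. (\<lambda>m. k x * b m x) \<longlonglongrightarrow> k x * indicator C x"
      proof (intro AE_I2 tendsto_mult_left)
        fix x
        show "(\<lambda>m. b m x) \<longlonglongrightarrow> indicator C x"
        proof (cases "x \<in> C")
          case True then show ?thesis by (simp add: b_def)
        next
          case xC: False
          have pos: "0 < infdist x C" by (rule infdist_pos_not_in_closed[OF C False xC])
          obtain M where M: "1 < real M * infdist x C" using reals_Archimedean3[OF pos] by blast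
          have "b m x = 0" if "M \<le> m" for m
          proof -
            have "real M * infdist x C \<le> real m * infdist x C" using that pos by (intro mult_right_mono) auto
            then show ?thesis using M by (simp add: b_def)
          qed
          then show ?thesis using xC by (intro tendsto_eventually) (auto simp: eventually_sequentially)
        qed
      qed
    qed measurable
    then have "(LBINT x. k x * indicator C x) = 0"
      using test[OF bc b1] by (simp add: LIMSEQ_const_iff)
    moreover have "indicator C x *\<^sub>R k x = k x * indicator C x" for x by (simp add: indicator_def)
    ultimately show ?thesis by (simp only:)
  qed simp
  have ind: "integrable lborel (\<lambda>x. indicator C x *\<^sub>R k x)" if C: "closed C" for C
  proof -
    have [measurable]: "C \<in> sets borel" using C by simp
    show ?thesis by (rule integrable_mult_indicator[OF _ k]) simp
  qed
  have "AE x in lborel. Re (k x) = 0"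
  proof (rule AE_zero_if_closed_integrals_zero)
    fix C :: "(real^'n) set" assume "closed C"
    then show "(LBINT x. indicator C x * Re (k x)) = 0"
      using integral_Re[OF ind] closed0 by simp
  qed (use k in auto)
  moreover have "AE x in lborel. Im (k x) = 0"
  proof (rule AE_zero_if_closed_integrals_zero)
    fix C :: "(real^'n) set" assume "closed C"
    then show "(LBINT x. indicator C x * Im (k x)) = 0"
      using integral_Im[OF ind] closed0 by simp
  qed (use k in auto)
  ultimately show ?thesis by eventually_elim (simp add: complex_eq_iff)
qed

text \<open>
  Multiplication by a Gaussian makes \<open>h\<close> integrable, and the plane waves times a Gaussian are
  Schwartz functions, so the Fourier transform of the product vanishes.
\<close>

lemma AE_zero_if_orthogonal_to_schwartz:
  fixes h :: "real^'n \<Rightarrow> complex"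
  assumes [measurable]: "h \<in> borel_measurable borel"
    and int: "\<And>\<phi>. \<phi> \<in> schwartz \<Longrightarrow> integrable lborel (\<lambda>x. h x * \<phi> x)"
    and z: "\<And>\<phi>. \<phi> \<in> schwartz \<Longrightarrow> (LBINT x. h x * \<phi> x) = 0"
  shows "AE x in lborel. h x = 0"
proof -
  note [measurable] = schwartzD(5)[OF gauss_schwartz]
  have "AE x in lborel. h x * gauss x = 0"
  proof (rule fourier_injective[OF int[OF gauss_schwartz]])
    fix \<xi> :: "real^'n"
    have "(\<lambda>x. plane_wave (-\<xi>) x * gauss x) \<in> schwartz" by (rule slow_schwartz[OF plane_wave_slow gauss_schwartz])
    from z[OF this] show "fourier (\<lambda>x. h x * gauss x) \<xi> = 0"
      by (subst fourier_eq) (simp_all add: mult_ac)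
  qed
  then show ?thesis by eventually_elim (simp add: gauss_def)
qed

section \<open>Functions flat at the origin\<close>

text \<open>
  The functions \<open>e^(-1/|x|\<^sup>2) |x|^(-2k)\<close>. They form one family because each derivative of a member
  is a combination of later members with polynomial coefficients; every member is bounded since
  \<open>u^k e^(-u) \<le> k!\<close>.
\<close>

definition flat_exp :: "nat \<Rightarrow> real^'n \<Rightarrow> complex" where
  "flat_exp k x = (if x = 0 then 0 else of_real (exp (- 1 / (norm x)\<^sup>2) / ((norm x)\<^sup>2) ^ k))"

lemma flat_zero [simp]: "flat_exp k 0 = 0"
  by (simp add: flat_exp_def)

lemma norm_flat_le: "norm (flat_exp k x) \<le> fact k"
proof (cases "x = 0")
  case False
  define u where "u = 1 / (norm x)\<^sup>2"
  have "u ^ k \<le> fact k * exp u" by (rule power_le_fact_exp) (simp add: u_def)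
  then have "u ^ k * exp (-u) \<le> fact k" by (simp add: exp_minus field_simps)
  moreover have "norm (flat_exp k x) = u ^ k * exp (-u)"
    using False by (simp add: flat_exp_def u_def norm_divide norm_power power_divide)
  ultimately show ?thesis by simp
qed simp

lemma flat_Suc: "flat_exp k x = of_real ((norm x)\<^sup>2) * flat_exp (Suc k) x"
  by (simp add: flat_exp_def)

lemma flat_has_derivative:
  fixes x :: "real^'n"
  shows
  "(flat_exp k has_derivative (\<lambda>h. of_real (2 * (x \<bullet> h)) * (flat_exp (k + 2) x - of_nat k * flat_exp (k + 1) x))) (at x)"
proof (cases "x = 0")
  case True
  have "(flat_exp k has_derivative (\<lambda>h. 0)) (at (0::real^'n))"
  proof (rule has_derivative_quadraticI)
    fix h :: "real^'n"
    show "norm (flat_exp k (0 + h) - flat_exp k 0 - 0) \<le> fact (Suc k) * (norm h)\<^sup>2"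
    proof -
      have "norm (flat_exp k h) = (norm h)\<^sup>2 * norm (flat_exp (Suc k) h)"
        by (subst flat_Suc) (simp add: norm_mult norm_power)
      also have "\<dots> \<le> (norm h)\<^sup>2 * fact (Suc k)" by (intro mult_left_mono norm_flat_le) auto
      finally show ?thesis by (simp add: mult.commute)
    qed
  qed simp
  then show ?thesis using True by simp
next
  case False
  define r where "r = (norm x)\<^sup>2"
  have r: "0 < r" using False by (simp add: r_def)
  have D: "((\<lambda>r. exp (- 1 / r) / r ^ k) has_real_derivative exp (- 1 / r) / r ^ (k + 2) - k * (exp (- 1 / r) / r ^ (k + 1))) (at r)"
  proof -
    have De: "((\<lambda>r. exp (- 1 / r)) has_real_derivative exp (- 1 / r) / r\<^sup>2) (at r)"
      using r by (auto intro!: derivative_eq_intros simp: power2_eq_square)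
    have Dk: "((\<lambda>r. 1 / r ^ k) has_real_derivative - real k / r ^ (k + 1)) (at r)"
    proof (cases k)
      case (Suc m)
      have "((\<lambda>r. r ^ Suc m) has_real_derivative real (Suc m) * r ^ m) (at r)"
        using DERIV_pow[of "Suc m" r] by simp
      from DERIV_inverse'[OF this] r
      have "((\<lambda>r. inverse (r ^ Suc m)) has_real_derivative - (inverse (r ^ Suc m) * (real (Suc m) * r ^ m) * inverse (r ^ Suc m))) (at r)"
        by simp
      moreover have "- (inverse (r ^ Suc m) * (real (Suc m) * r ^ m) * inverse (r ^ Suc m)) = - real k / r ^ (k + 1)"
        using r Suc by (simp add: divide_simps)
      ultimately show ?thesis by (simp only: Suc inverse_eq_divide)
    qed simp
    show ?thesis
      using DERIV_cong[OF DERIV_mult[OF De Dk]] r by (simp add: power_add power2_eq_square mult_ac)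
  qed
  from has_derivative_compose[OF has_derivative_norm_sq D[unfolded r_def has_field_derivative_def]]
  have "((\<lambda>x. exp (- 1 / (norm x)\<^sup>2) / ((norm x)\<^sup>2) ^ k) has_derivative
     (\<lambda>h. (exp (- 1 / r) / r ^ (k + 2) - k * (exp (- 1 / r) / r ^ (k + 1))) * (2 * (x \<bullet> h)))) (at x)"
    by (simp add: r_def)
  then have "((\<lambda>x. complex_of_real (exp (- 1 / (norm x)\<^sup>2) / ((norm x)\<^sup>2) ^ k)) has_derivative
     (\<lambda>h. of_real ((exp (- 1 / r) / r ^ (k + 2) - k * (exp (- 1 / r) / r ^ (k + 1))) * (2 * (x \<bullet> h))))) (at x)"
    by (rule has_derivative_of_real)
  then have "(flat_exp k has_derivative
     (\<lambda>h. of_real ((exp (- 1 / r) / r ^ (k + 2) - k * (exp (- 1 / r) / r ^ (k + 1))) * (2 * (x \<bullet> h))))) (at x)"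
    by (rule has_derivative_transform_within_open[where s="- {0}"]) (use False in \<open>auto simp: flat_exp_def\<close>)
  then show ?thesis
    by (rule has_derivative_eq_rhs) (use False in \<open>simp add: flat_exp_def r_def fun_eq_iff mult.commute\<close>)
qed

lemma flat_differentiable: "flat_exp k differentiable (at x)"
  using flat_has_derivative unfolding differentiable_def by blast

lemma pd_flat: "pd i (flat_exp k) = (\<lambda>x. (of_real 2 * of_real (x $ i)) * (flat_exp (k + 2) x + of_real (- real k) * flat_exp (k + 1) x))"
  by (intro ext pd_eqI[OF flat_has_derivative, THEN trans]) (simp add: inner_axis)

lemma prods_slow_mult:
  assumes "f \<in> prods slow F" "a \<in> slow"
  shows "(\<lambda>x. a x * f x) \<in> prods slow F"
  using assms
proof (induction rule: prods.induct)
  case (mult b c)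
  then show ?case using prods.mult[OF slow_mult[of a b] mult(2)] by (simp add: mult.assoc)
next
  case (add f g)
  then show ?case using prods.add[OF add.IH] by (simp add: distrib_left)
qed

lemma prods_slow_base: "f \<in> F \<Longrightarrow> f \<in> prods slow F"
  using prods.mult[OF slow_const[of 1], of f F] by simp

lemma flat_slow: "(flat_exp k :: real^'n \<Rightarrow> complex) \<in> slow"
proof -
  have "range (flat_exp :: nat \<Rightarrow> real^'n \<Rightarrow> complex) \<subseteq> slow"
  proof (rule slow_moduleI(2))
    fix f :: "real^'n \<Rightarrow> complex" assume "f \<in> range flat_exp"
    then obtain k where f: "f = flat_exp k" by blast
    show "f differentiable (at x)" for x unfolding f by (rule flat_differentiable)
    show "pd i f \<in> prods slow (range flat_exp)" for i
      unfolding f pd_flat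
      by (intro prods_slow_mult[where a="\<lambda>x. of_real 2 * of_real (x $ i)"] prods.add prods_slow_mult[where a="\<lambda>x. of_real (- real k)"]
            prods_slow_base slow_mult slow_const slow_component rangeI)
    have "\<forall>x. norm (flat_exp k x) \<le> fact k * (1 + norm x) ^ 0" using norm_flat_le by auto
    then show "poly_bounded f" unfolding f poly_bounded_def by blast
  qed
  then show ?thesis by blast
qed

text \<open>
  A substitute for a compactly supported bump function, \<open>exp (-|x|\<^sup>2 e^(-1/|x|\<^sup>2))\<close>: it equals \<open>1\<close>
  to infinite order at the origin and decays like a Gaussian, and its derivatives are explicit.
\<close>

definition cutoff :: "real^'n \<Rightarrow> complex" where
  "cutoff x = exp (- (of_real ((norm x)\<^sup>2) * flat_exp 0 x))"

lemma cutoff_exponent_slow: "(\<lambda>x::real^'n. of_real ((norm x)\<^sup>2) * flat_exp 0 x) \<in> slow"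
  by (rule slow_mult[OF slow_norm_sq flat_slow])

lemma cutoff_has_derivative:
  defines "\<beta> \<equiv> \<lambda>x::real^'n. of_real ((norm x)\<^sup>2) * flat_exp 0 x"
  shows "(cutoff has_derivative (\<lambda>h. - frechet_derivative \<beta> (at x) h * cutoff x)) (at x)"
proof -
  have "((\<lambda>x. - \<beta> x) has_derivative (\<lambda>h. - frechet_derivative \<beta> (at x) h)) (at x)"
    unfolding \<beta>_def by (intro has_derivative_minus has_derivative_frechet slowD(2)[OF cutoff_exponent_slow])
  from has_derivative_compose[OF this DERIV_exp[unfolded has_field_derivative_def]]
  show ?thesis by (simp add: cutoff_def[abs_def] \<beta>_def mult.commute)
qed

lemma cutoff_differentiable: "cutoff differentiable (at x)"
  using cutoff_has_derivative unfolding differentiable_def by blast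

lemma pd_cutoff_exponent:
  "pd i (\<lambda>x::real^'n. of_real ((norm x)\<^sup>2) * flat_exp 0 x) = (\<lambda>x. (of_real 2 * of_real (x $ i)) * (flat_exp 0 x + flat_exp 1 x))"
proof
  fix x :: "real^'n"
  have n: "((\<lambda>x::real^'n. complex_of_real ((norm x)\<^sup>2)) has_derivative (\<lambda>h. of_real (2 * (x \<bullet> h)))) (at x)"
    by (rule has_derivative_of_real[OF has_derivative_norm_sq])
  have "pd i (\<lambda>x::real^'n. of_real ((norm x)\<^sup>2) * flat_exp 0 x) x = pd i (\<lambda>x. of_real ((norm x)\<^sup>2)) x * flat_exp 0 x + of_real ((norm x)\<^sup>2) * pd i (flat_exp 0) x"
    by (intro pd_mult slowD(2)[OF slow_norm_sq] flat_differentiable)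
  also have "pd i (\<lambda>x. of_real ((norm x)\<^sup>2)) x = of_real 2 * of_real (x $ i)"
    using pd_eqI[OF n, of i] by (simp add: inner_axis)
  also have "of_real ((norm x)\<^sup>2) * pd i (flat_exp 0) x = (of_real 2 * of_real (x $ i)) * flat_exp 1 x"
    unfolding pd_flat using flat_Suc[of 1 x] by (simp add: numeral_2_eq_2)
  finally show "pd i (\<lambda>x::real^'n. of_real ((norm x)\<^sup>2) * flat_exp 0 x) x = (of_real 2 * of_real (x $ i)) * (flat_exp 0 x + flat_exp 1 x)"
    by (simp add: distrib_left)
qed

lemma pd_cutoff: "pd i cutoff = (\<lambda>x. (of_real (-2) * of_real (x $ i)) * (flat_exp 0 x * cutoff x + flat_exp 1 x * cutoff x))"
proof
  fix x
  have "pd i cutoff x = - pd i (\<lambda>x. of_real ((norm x)\<^sup>2) * flat_exp 0 x) x * cutoff x"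
    unfolding pd_eqI[OF cutoff_has_derivative] by (simp add: pd_def)
  then show "pd i cutoff x = (of_real (-2) * of_real (x $ i)) * (flat_exp 0 x * cutoff x + flat_exp 1 x * cutoff x)"
    unfolding pd_cutoff_exponent by (simp add: algebra_simps)
qed

lemma norm_cutoff_le: "norm (cutoff x) \<le> exp 1 * exp (- (norm x)\<^sup>2)"
proof (cases "x = 0")
  case False
  define r where "r = (norm x)\<^sup>2"
  have r: "0 < r" using False by (simp add: r_def)
  have "1 + (- 1 / r) \<le> exp (- 1 / r)" by (rule exp_ge_add_one_self)
  then have "r * (1 + (- 1 / r)) \<le> r * exp (- 1 / r)" using r by (intro mult_left_mono) auto
  moreover have "r * (1 + (- 1 / r)) = r - 1" using r by (simp add: field_simps)
  ultimately have "- (r * exp (- 1 / r)) \<le> 1 + - r" by simp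
  moreover have "norm (cutoff x) = exp (- (r * exp (- 1 / r)))"
    using False by (simp add: cutoff_def flat_exp_def r_def norm_exp_eq_Re)
  ultimately show ?thesis unfolding exp_add[symmetric] r_def by simp
qed (simp add: cutoff_def)

lemma norm_cutoff_le_1: "norm (cutoff x) \<le> 1"
  by (simp add: cutoff_def flat_exp_def norm_exp_eq_Re)

lemma cutoff_slow: "(cutoff :: real^'n \<Rightarrow> complex) \<in> slow"
  and cutoff_schwartz: "(cutoff :: real^'n \<Rightarrow> complex) \<in> schwartz"
proof -
  have d: "f differentiable (at x)" if "f \<in> {cutoff :: real^'n \<Rightarrow> complex}" for f x
    using that cutoff_differentiable by blast
  have p: "pd i f \<in> prods slow {cutoff :: real^'n \<Rightarrow> complex}" if "f \<in> {cutoff :: real^'n \<Rightarrow> complex}" for f i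
  proof -
    have "f = cutoff" using that by simp
    then show ?thesis
      by (simp only: pd_cutoff)
         (intro prods_slow_mult[where a="\<lambda>x. of_real (-2) * of_real (x $ i)"] prods.add prods.mult flat_slow slow_mult slow_const slow_component singletonI)
  qed
  have b: "poly_bounded f" if "f \<in> {cutoff :: real^'n \<Rightarrow> complex}" for f
  proof -
    have "\<forall>x::real^'n. norm (cutoff x) \<le> 1 * (1 + norm x) ^ 0" using norm_cutoff_le_1 by auto
    then show ?thesis using that unfolding poly_bounded_def by blast
  qed
  have r: "rapid f" if "f \<in> {cutoff :: real^'n \<Rightarrow> complex}" for f
    using that rapid_if_gaussian_bound[OF norm_cutoff_le] by auto
  show "(cutoff :: real^'n \<Rightarrow> complex) \<in> slow" using slow_moduleI(2)[OF d p b] by blast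
  show "(cutoff :: real^'n \<Rightarrow> complex) \<in> schwartz" using schwartz_moduleI[OF d p r] by blast
qed

definition slow_flat :: "(real^'n \<Rightarrow> complex) set" where
  "slow_flat = {f \<in> slow. \<forall>is. partials is f 0 = 0}"

lemma pd_closed_slow_flat: "pd_closed slow_flat"
  unfolding pd_closed_def slow_flat_def
  by (auto simp: slowD partials_snoc[symmetric])

lemma pd_closed_schwartz_zero: "pd_closed schwartz_zero"
  unfolding pd_closed_def schwartz_zero_def
  by (auto simp: schwartzD partials_snoc[symmetric])

text \<open>
  If a class closed under derivatives vanishes at the origin, its members vanish there to infinite
  order.
\<close>

lemma vanishing_partials:
  assumes X: "pd_closed X" and z: "\<forall>f\<in>X. f 0 = 0" and f: "f \<in> X"
  shows "partials is f 0 = 0"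
  using z pd_closed_partials[OF X f] by blast

lemma prods_vanish:
  assumes "f \<in> prods A B" "(\<forall>a\<in>A. a 0 = 0) \<or> (\<forall>b\<in>B. b 0 = 0)"
  shows "f 0 = 0"
  using assms by (induction rule: prods.induct) auto

text \<open>
  From the first derivative on, all derivatives lie in the module generated by the products of
  \<open>cutoff\<close> with the functions \<open>flat_exp k\<close>, and these vanish at the origin.
\<close>

lemma one_minus_cutoff_slow_flat: "(\<lambda>x::real^'n. 1 - cutoff x) \<in> slow_flat"
proof -
  define B where "B = range (\<lambda>k x::real^'n. flat_exp k x * cutoff x)"
  have B: "pd_closed (prods slow B)"
  proof (rule slow_module)
    fix f :: "real^'n \<Rightarrow> complex" assume "f \<in> B"
    then obtain k where f: "f = (\<lambda>x. flat_exp k x * cutoff x)" by (auto simp: B_def)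
    show "f differentiable (at x)" for x
      unfolding f by (intro differentiable_mult flat_differentiable cutoff_differentiable)
    fix i
    have "pd i f = (\<lambda>x. pd i (flat_exp k) x * cutoff x + flat_exp k x * pd i cutoff x)"
      unfolding f by (intro ext pd_mult flat_differentiable cutoff_differentiable)
    also have "\<dots> = (\<lambda>x. (of_real 2 * of_real (x $ i)) * (flat_exp (k + 2) x * cutoff x) + (of_real (- 2 * real k) * of_real (x $ i)) * (flat_exp (k + 1) x * cutoff x)
       + (of_real (-2) * of_real (x $ i) * flat_exp 0 x + of_real (-2) * of_real (x $ i) * flat_exp 1 x) * (flat_exp k x * cutoff x))"
      unfolding pd_flat pd_cutoff by (simp add: algebra_simps)
    also have "\<dots> \<in> prods slow B"
      unfolding B_def by (intro prods.add prods.mult slow_add slow_mult slow_const slow_component flat_slow rangeI)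
    finally show "pd i f \<in> prods slow B" .
  qed
  have z: "\<forall>g\<in>prods slow B. g 0 = 0"
    by (auto simp: B_def elim: prods_vanish)
  have pd1: "pd i (\<lambda>x::real^'n. 1 - cutoff x) \<in> prods slow B" for i
  proof -
    have "pd i (\<lambda>x::real^'n. 1 - cutoff x) = (\<lambda>x. (of_real 2 * of_real (x $ i)) * (flat_exp 0 x * cutoff x) + (of_real 2 * of_real (x $ i)) * (flat_exp 1 x * cutoff x))"
    proof
      fix x :: "real^'n"
      have "((\<lambda>x::real^'n. 1 - cutoff x) has_derivative (\<lambda>h. 0 - frechet_derivative cutoff (at x) h)) (at x)"
        by (intro has_derivative_diff has_derivative_const has_derivative_frechet cutoff_differentiable)
      from pd_eqI[OF this, of i] have "pd i (\<lambda>x::real^'n. 1 - cutoff x) x = - pd i cutoff x" by (simp add: pd_def)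
      then show "pd i (\<lambda>x::real^'n. 1 - cutoff x) x = (of_real 2 * of_real (x $ i)) * (flat_exp 0 x * cutoff x) + (of_real 2 * of_real (x $ i)) * (flat_exp 1 x * cutoff x)"
        unfolding pd_cutoff by (simp add: algebra_simps)
    qed
    also have "\<dots> \<in> prods slow B"
      unfolding B_def by (intro prods.add prods.mult slow_mult slow_const slow_component rangeI)
    finally show ?thesis .
  qed
  have "partials is (\<lambda>x::real^'n. 1 - cutoff x) 0 = 0" for "is"
  proof (cases "is" rule: rev_cases)
    case Nil then show ?thesis by (simp add: cutoff_def)
  next
    case (snoc js i)
    then show ?thesis using vanishing_partials[OF B z pd1] by (simp only: partials_snoc)
  qed
  moreover have "(\<lambda>x::real^'n. 1 - cutoff x) \<in> slow"
    using slow_add[OF slow_const[of 1] slow_mult[OF slow_const[of "-1"] cutoff_slow]] by simp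
  ultimately show ?thesis by (simp add: slow_flat_def)
qed

lemma slow_flat_dilation:
  fixes f :: "real^'n \<Rightarrow> complex"
  assumes f: "f \<in> slow_flat"
  shows "(\<lambda>x. f (c *\<^sub>R x)) \<in> slow_flat"
proof -
  let ?Y = "{\<lambda>x. a * f (c *\<^sub>R x) | a f. f \<in> (slow_flat :: (real^'n \<Rightarrow> complex) set)}"
  have Y: "pd_closed ?Y" by (rule pd_closed_dilation[OF pd_closed_slow_flat])
  have Y0: "\<forall>g\<in>?Y. g 0 = 0"
  proof
    fix g :: "real^'n \<Rightarrow> complex" assume "g \<in> ?Y"
    then obtain a f where g: "g = (\<lambda>x. a * f (c *\<^sub>R x))" and f: "f \<in> slow_flat" by blast
    have "partials [] f 0 = 0" using f unfolding slow_flat_def by blast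
    then show "g 0 = 0" using g by simp
  qed
  have "?Y \<subseteq> slow"
  proof (rule slow_subsetI[OF Y])
    fix g :: "real^'n \<Rightarrow> complex" assume "g \<in> ?Y"
    then obtain a f where g: "g = (\<lambda>x. a * f (c *\<^sub>R x))" and f: "f \<in> slow_flat" by blast
    obtain C k where C: "\<And>x. norm (f x) \<le> C * (1 + norm x) ^ k"
      using f unfolding slow_flat_def by (blast dest: slowD(1)[unfolded poly_bounded_def])
    have C0: "0 \<le> C" using order_trans[OF norm_ge_zero C[of 0]] by simp
    have "norm (g x) \<le> (norm a * C * (1 + \<bar>c\<bar>) ^ k) * (1 + norm x) ^ k" for x
    proof -
      have "1 + norm (c *\<^sub>R x) \<le> (1 + \<bar>c\<bar>) * (1 + norm x)" by (simp add: algebra_simps)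
      then have "(1 + norm (c *\<^sub>R x)) ^ k \<le> ((1 + \<bar>c\<bar>) * (1 + norm x)) ^ k" by (intro power_mono) auto
      then have "C * (1 + norm (c *\<^sub>R x)) ^ k \<le> C * ((1 + \<bar>c\<bar>) ^ k * (1 + norm x) ^ k)"
        unfolding power_mult_distrib using C0 by (rule mult_left_mono)
      then have "norm (f (c *\<^sub>R x)) \<le> C * ((1 + \<bar>c\<bar>) ^ k * (1 + norm x) ^ k)"
        using C[of "c *\<^sub>R x"] by (rule order_trans[rotated])
      then have "norm a * norm (f (c *\<^sub>R x)) \<le> norm a * (C * ((1 + \<bar>c\<bar>) ^ k * (1 + norm x) ^ k))"
        by (intro mult_left_mono) auto
      then show ?thesis unfolding g by (simp add: norm_mult mult_ac)
    qed
    then show "poly_bounded g" unfolding poly_bounded_def by blast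
  qed
  moreover have m: "(\<lambda>x. f (c *\<^sub>R x)) \<in> ?Y"
    using f by (intro CollectI exI[of _ 1] exI[of _ f]) auto
  ultimately show ?thesis
    using vanishing_partials[OF Y Y0 m] by (auto simp: slow_flat_def)
qed

lemma slow_flat_schwartz:
  fixes a f :: "real^'n \<Rightarrow> complex"
  assumes a: "a \<in> slow_flat" and f: "f \<in> schwartz"
  shows "(\<lambda>x. a x * f x) \<in> schwartz_zero"
proof -
  have X: "pd_closed (prods slow_flat schwartz)" by (rule pd_closed_prods[OF pd_closed_slow_flat pd_closed_schwartz])
  have z: "\<forall>g\<in>prods slow_flat (schwartz :: (real^'n \<Rightarrow> complex) set). g 0 = 0"
  proof (intro ballI, erule prods_vanish, rule disjI1, rule ballI)
    fix a :: "real^'n \<Rightarrow> complex" assume "a \<in> slow_flat"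
    then have "partials [] a 0 = 0" unfolding slow_flat_def by blast
    then show "a 0 = 0" by simp
  qed
  have "partials is (\<lambda>x. a x * f x) 0 = 0" for "is"
    by (rule vanishing_partials[OF X z]) (auto intro: prods.mult a f)
  then show ?thesis using slow_schwartz[OF _ f, of a] a by (auto simp: schwartz_zero_def slow_flat_def)
qed

lemma slow_schwartz_zero:
  fixes a f :: "real^'n \<Rightarrow> complex"
  assumes a: "a \<in> slow" and f: "f \<in> schwartz_zero"
  shows "(\<lambda>x. a x * f x) \<in> schwartz_zero"
proof -
  have X: "pd_closed (prods slow schwartz_zero)" by (rule pd_closed_prods[OF pd_closed_slow pd_closed_schwartz_zero])
  have z: "\<forall>g\<in>prods slow (schwartz_zero :: (real^'n \<Rightarrow> complex) set). g 0 = 0"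
  proof (intro ballI, erule prods_vanish, rule disjI2, rule ballI)
    fix a :: "real^'n \<Rightarrow> complex" assume "a \<in> schwartz_zero"
    then have "partials [] a 0 = 0" unfolding schwartz_zero_def by blast
    then show "a 0 = 0" by simp
  qed
  have "partials is (\<lambda>x. a x * f x) 0 = 0" for "is"
    by (rule vanishing_partials[OF X z]) (auto intro: prods.mult a f)
  then show ?thesis using slow_schwartz[OF a, of f] f by (auto simp: schwartz_zero_def)
qed

text \<open>
  The powers of the resolvent symbol span a module closed under derivatives.
\<close>

lemma slow_inverse_quadratic:
  assumes lam: "0 < lam"
  shows "(\<lambda>x::real^'n. complex_of_real (1 / (lam + 4 * pi\<^sup>2 * (norm x)\<^sup>2))) \<in> slow"
proof -
  define f where "f = (\<lambda>x::real^'n. complex_of_real (1 / (lam + 4 * pi\<^sup>2 * (norm x)\<^sup>2)))"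
  have pos: "0 < lam + 4 * pi\<^sup>2 * (norm x)\<^sup>2" for x :: "real^'n" using lam by (simp add: add_pos_nonneg)
  have D: "(f has_derivative (\<lambda>h. of_real (- (8 * pi\<^sup>2 * (x \<bullet> h))) * (f x * f x))) (at x)" for x
  proof -
    have "((\<lambda>x::real^'n. lam + 4 * pi\<^sup>2 * (norm x)\<^sup>2) has_derivative (\<lambda>h. 4 * pi\<^sup>2 * (2 * (x \<bullet> h)))) (at x)"
      by (rule has_derivative_eq_rhs[OF has_derivative_add[OF has_derivative_const has_derivative_mult_right[OF has_derivative_norm_sq]]]) simp
    from has_derivative_compose[OF this DERIV_inverse[unfolded has_field_derivative_def]] pos[of x]
    have "((\<lambda>x::real^'n. inverse (lam + 4 * pi\<^sup>2 * (norm x)\<^sup>2)) has_derivative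
      (\<lambda>h. - (inverse (lam + 4 * pi\<^sup>2 * (norm x)\<^sup>2) ^ Suc (Suc 0)) * (4 * pi\<^sup>2 * (2 * (x \<bullet> h))))) (at x)"
      by simp
    from has_derivative_of_real[OF this, where 'a=complex] show ?thesis
      by (simp add: f_def inverse_eq_divide mult_ac)
  qed
  have pdf: "pd i f = (\<lambda>x. (of_real (- (8 * pi\<^sup>2)) * of_real (x $ i)) * (f x * f x))" for i
    by (intro ext pd_eqI[OF D, THEN trans]) (simp add: inner_axis)
  have d: "f differentiable (at x)" for x using D unfolding differentiable_def by blast
  have "range (\<lambda>k x. f x ^ k) \<subseteq> slow"
  proof (rule slow_moduleI(2))
    fix g assume "g \<in> range (\<lambda>k x. f x ^ k)"
    then obtain k where g: "g = (\<lambda>x. f x ^ k)" by blast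
    have dk: "(\<lambda>x. f x ^ k) differentiable (at x)" for k x by (intro differentiable_power d)
    show "g differentiable (at x)" for x unfolding g by (rule dk)
    have "norm (f x) \<le> 1 / lam" for x
    proof -
      have "norm (f x) = 1 / (lam + 4 * pi\<^sup>2 * (norm x)\<^sup>2)"
        unfolding f_def norm_of_real using pos[of x] by (intro abs_of_nonneg) simp
      also have "\<dots> \<le> 1 / lam" using lam by (intro divide_left_mono) (auto intro!: mult_pos_pos pos)
      finally show ?thesis .
    qed
    then have "\<forall>x. norm (f x ^ k) \<le> (1 / lam) ^ k * (1 + norm x) ^ 0" by (simp add: norm_power power_mono)
    then show "poly_bounded g" unfolding g poly_bounded_def by blast
    fix i
    have "pd i (\<lambda>x. f x ^ k) = (\<lambda>x. (of_real (real k * (- (8 * pi\<^sup>2))) * of_real (x $ i)) * f x ^ (k + 1))"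
    proof (induction k)
      case 0 show ?case by (simp add: pd_const)
    next
      case (Suc k)
      have "pd i (\<lambda>x. f x ^ Suc k) = (\<lambda>x. pd i f x * f x ^ k + f x * pd i (\<lambda>x. f x ^ k) x)"
        unfolding power_Suc by (intro ext pd_mult d dk)
      then show ?case unfolding Suc pdf by (simp add: algebra_simps)
    qed
    also have "\<dots> \<in> prods slow (range (\<lambda>k x. f x ^ k))"
    proof (rule prods.mult)
      show "(\<lambda>x::real^'n. complex_of_real (real k * (- (8 * pi\<^sup>2))) * of_real (x $ i)) \<in> slow"
        by (rule slow_mult[OF slow_const slow_component])
      show "(\<lambda>x. f x ^ (k + 1)) \<in> range (\<lambda>k x. f x ^ k)" by (rule rangeI)
    qed
    finally show "pd i g \<in> prods slow (range (\<lambda>k x. f x ^ k))" unfolding g .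
  qed
  then have "(\<lambda>x. f x ^ 1) \<in> slow" by blast
  then show ?thesis by (simp add: f_def)
qed

section \<open>Functions with spectrum at the origin are constant\<close>

lemma Lp_schwartz_pairing_integrable:
  assumes "1 \<le> p" "v \<in> Lp_borel p" "\<phi> \<in> schwartz"
  shows "integrable lborel (\<lambda>x. v x * \<phi> x)"
proof -
  obtain B where "\<And>x. norm (\<phi> x) \<le> B" using rapid_bounded[OF schwartzD(1)[OF assms(3)]] by blast
  then show ?thesis by (rule Lp_pairing_integrable[OF assms(1,2) schwartz_integrable[OF assms(3)]])
qed

lemma translation_L1_le:
  fixes K :: "'a::euclidean_space \<Rightarrow> complex"
  assumes K: "integrable lborel K"
  shows "(LBINT z. norm (K (z + a) - K z)) \<le> 2 * (LBINT z. norm (K z))"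
proof -
  note [measurable] = borel_measurable_integrable[OF K]
  have "(LBINT z. norm (K (z + a) - K z)) \<le> (LBINT z. norm (K (z + a)) + norm (K z))"
    using lborel_integrable_shift[OF K, of a] K
    by (intro integral_mono norm_triangle_ineq4 integrable_norm Bochner_Integration.integrable_diff Bochner_Integration.integrable_add)
  also have "\<dots> = (LBINT z. norm (K (z + a))) + (LBINT z. norm (K z))"
    using lborel_integrable_shift[OF K, of a] K by (intro Bochner_Integration.integral_add integrable_norm)
  also have "(LBINT z. norm (K (z + a))) = (LBINT z. norm (K z))"
    using lborel_integral_shift[of "\<lambda>z. norm (K z)" a] by simp
  finally show ?thesis by simp
qed

lemma translation_continuous_L1:
  fixes K :: "real^'n \<Rightarrow> complex"
  assumes K: "K \<in> schwartz"
  shows "(\<lambda>m. LBINT z. norm (K (z + (1 / real (Suc m)) *\<^sub>R y) - K z)) \<longlonglongrightarrow> 0"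
proof -
  note [measurable] = schwartzD(5)[OF K]
  obtain C where C: "0 \<le> C" "\<And>x. norm (K x) \<le> C * decay x" using rapid_le_decay[OF schwartzD(1)[OF K]] by blast
  define D where "D = (1 + norm y) ^ (2 * CARD('n))"
  have "(\<lambda>m. LBINT z. norm (K (z + (1 / real (Suc m)) *\<^sub>R y) - K z)) \<longlonglongrightarrow> (integral\<^sup>L lborel (\<lambda>z::real^'n. 0))"
  proof (rule integral_dominated_convergence)
    show "integrable lborel (\<lambda>z::real^'n. (C * D + C) * decay z)" using decay_integrable[where 'n='n] by simp
    show "AE z in lborel. (\<lambda>m. norm (K (z + (1 / real (Suc m)) *\<^sub>R y) - K z)) \<longlonglongrightarrow> 0"
    proof (rule AE_I2)
      fix z
      have "(\<lambda>m. z + (1 / real (Suc m)) *\<^sub>R y) \<longlonglongrightarrow> z + 0 *\<^sub>R y"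
        by (intro tendsto_intros LIMSEQ_Suc[OF lim_1_over_n])
      then have "(\<lambda>m. K (z + (1 / real (Suc m)) *\<^sub>R y)) \<longlonglongrightarrow> K z"
        by (intro continuous_on_tendsto_compose[OF schwartzD(4)[OF K]]) auto
      then have "(\<lambda>m. norm (K (z + (1 / real (Suc m)) *\<^sub>R y) - K z)) \<longlonglongrightarrow> norm (K z - K z)"
        by (intro tendsto_intros)
      then show "(\<lambda>m. norm (K (z + (1 / real (Suc m)) *\<^sub>R y) - K z)) \<longlonglongrightarrow> 0" by simp
    qed
    fix m
    show "AE z in lborel. norm (norm (K (z + (1 / real (Suc m)) *\<^sub>R y) - K z)) \<le> (C * D + C) * decay z"
    proof (rule AE_I2)
      fix z
      let ?h = "(1 / real (Suc m)) *\<^sub>R y"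
      have "norm ?h \<le> norm y"
        by (simp add: divide_le_eq mult_le_cancel_left1)
      then have "(1 + norm ?h) ^ (2 * CARD('n)) \<le> D" unfolding D_def by (intro power_mono) auto
      then have "decay (z + ?h) \<le> D * decay z"
        by (intro order_trans[OF decay_shift] mult_right_mono) (auto simp: less_imp_le)
      then have "C * decay (z + ?h) \<le> C * (D * decay z)" using C(1) by (rule mult_left_mono)
      then show "norm (norm (K (z + ?h) - K z)) \<le> (C * D + C) * decay z"
        using norm_triangle_ineq4[of "K (z + ?h)" "K z"] C(2)[of "z + ?h"] C(2)[of z] by (simp add: algebra_simps)
    qed
  qed measurable
  then show ?thesis by simp
qed

text \<open>
  The low-frequency part of \<open>\<Phi>\<close> is its convolution with the kernel \<open>K\<close>, rescaled to width \<open>c\<close>. As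
  \<open>\<Phi>\<close> has mean zero, \<open>K z\<close> may be subtracted from every translate of \<open>K\<close>, which exhibits the
  convolution as an average of small differences. After rescaling, the translations are by \<open>y/c\<close>.
\<close>

lemma low_frequency_L1:
  fixes \<Phi> :: "real^'n \<Rightarrow> complex"
  assumes \<Phi>: "\<Phi> \<in> schwartz" and z: "(LBINT x. \<Phi> x) = 0"
  defines "K \<equiv> inv_fourier (cutoff :: real^'n \<Rightarrow> complex)"
  defines "E \<equiv> \<lambda>c. inv_fourier (\<lambda>\<xi>. cutoff (c *\<^sub>R \<xi>) * fourier \<Phi> \<xi>)"
  assumes c: "0 < c"
  shows "(LBINT x. norm (E c x)) \<le> (LBINT y. norm (\<Phi> y) * (LBINT z. norm (K (z + (1 / c) *\<^sub>R (- y)) - K z)))"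
proof -
  have K: "K \<in> schwartz" unfolding K_def by (rule inv_fourier_schwartz[OF cutoff_schwartz])
  note [measurable] = schwartzD(5)[OF K] schwartzD(5)[OF \<Phi>] schwartzD(5)[OF fourier_schwartz[OF \<Phi>]] schwartzD(5)[OF cutoff_schwartz]
  let ?n = "CARD('n)"
  have i\<Phi>: "integrable lborel \<Phi>" by (rule schwartz_integrable[OF \<Phi>])
  have iK: "integrable lborel K" by (rule schwartz_integrable[OF K])
  have ic: "integrable lborel (cutoff :: real^'n \<Rightarrow> complex)" by (rule schwartz_integrable[OF cutoff_schwartz])
  define H where "H = (\<lambda>z. LBINT y. \<Phi> y * (K (z + (1 / c) *\<^sub>R (- y)) - K z))"
  obtain B where B: "\<And>x. norm (K x) \<le> B" using rapid_bounded[OF schwartzD(1)[OF K]] by blast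
  have i\<Phi>K: "integrable lborel (\<lambda>y. \<Phi> y * K (z + (1 / c) *\<^sub>R (- y)))" for z
    by (rule Bochner_Integration.integrable_bound[where f="\<lambda>y. norm (\<Phi> y) * B"])
       (use i\<Phi> B order_trans[OF norm_ge_zero B] in \<open>auto simp: norm_mult intro!: mult_left_mono\<close>)
  have E: "E c x = (1 / c) ^ ?n *\<^sub>R H ((1 / c) *\<^sub>R x)" for x
  proof -
    have "E c x = (LBINT \<xi>. cutoff (c *\<^sub>R \<xi>) * fourier \<Phi> \<xi> * plane_wave x \<xi>)"
      unfolding E_def by (subst inv_fourier_eq) auto
    also have "\<dots> = (1 / c) ^ ?n *\<^sub>R (LBINT \<eta>. cutoff \<eta> * fourier \<Phi> ((1 / c) *\<^sub>R \<eta>) * plane_wave x ((1 / c) *\<^sub>R \<eta>))"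
      using c by (subst lborel_integral_affine[where c="1 / c" and t=0]) simp_all
    also have "(LBINT \<eta>. cutoff \<eta> * fourier \<Phi> ((1 / c) *\<^sub>R \<eta>) * plane_wave x ((1 / c) *\<^sub>R \<eta>))
       = (LBINT \<eta>. LBINT y. (\<Phi> y * cutoff \<eta>) * plane_wave ((1 / c) *\<^sub>R x + (1 / c) *\<^sub>R (- y)) \<eta>)"
    proof (intro Bochner_Integration.integral_cong refl)
      fix \<eta> :: "real^'n"
      have e: "(\<Phi> y * cutoff \<eta>) * plane_wave ((1 / c) *\<^sub>R x + (1 / c) *\<^sub>R (- y)) \<eta>
         = (cutoff \<eta> * plane_wave x ((1 / c) *\<^sub>R \<eta>)) * (\<Phi> y * plane_wave (- ((1 / c) *\<^sub>R \<eta>)) y)" for y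
        unfolding plane_wave_add by (simp add: plane_wave_def inner_commute mult_ac)
      show "cutoff \<eta> * fourier \<Phi> ((1 / c) *\<^sub>R \<eta>) * plane_wave x ((1 / c) *\<^sub>R \<eta>)
         = (LBINT y. (\<Phi> y * cutoff \<eta>) * plane_wave ((1 / c) *\<^sub>R x + (1 / c) *\<^sub>R (- y)) \<eta>)"
        unfolding e by (simp add: fourier_eq)
    qed
    also have "\<dots> = (LBINT y. LBINT \<eta>. (\<Phi> y * cutoff \<eta>) * plane_wave ((1 / c) *\<^sub>R x + (1 / c) *\<^sub>R (- y)) \<eta>)"
    proof (rule lborel_pair.Fubini_integral)
      show "integrable (lborel \<Otimes>\<^sub>M lborel) (\<lambda>(y, \<eta>). \<Phi> y * cutoff \<eta> * plane_wave ((1 / c) *\<^sub>R x + (1 / c) *\<^sub>R (- y)) \<eta>)"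
      proof (rule lborel_pair.Fubini_integrable)
        show "AE y in lborel. integrable lborel (\<lambda>\<eta>. case (y, \<eta>) of (y, \<eta>) \<Rightarrow> \<Phi> y * cutoff \<eta> * plane_wave ((1 / c) *\<^sub>R x + (1 / c) *\<^sub>R (- y)) \<eta>)"
          unfolding prod.case mult.assoc
          by (intro AE_I2 integrable_mult_right integrable_mult_plane_wave ic)
      qed (use i\<Phi> ic in \<open>simp_all add: norm_mult\<close>)
    qed
    also have "\<dots> = (LBINT y. \<Phi> y * K ((1 / c) *\<^sub>R x + (1 / c) *\<^sub>R (- y)))"
      unfolding K_def by (subst inv_fourier_eq) (simp_all add: mult.assoc)
    also have "\<dots> = H ((1 / c) *\<^sub>R x)"
      unfolding H_def using i\<Phi>K i\<Phi> by (simp add: right_diff_distrib z)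
    finally show ?thesis .
  qed
  note wb = translation_L1_le[OF iK]
  have int2: "integrable (lborel \<Otimes>\<^sub>M lborel) (\<lambda>(y,z). \<Phi> y * (K (z + (1 / c) *\<^sub>R (- y)) - K z))"
  proof (rule lborel_pair.Fubini_integrable)
    show "integrable lborel (\<lambda>y. LBINT z. norm (case (y,z) of (y,z) \<Rightarrow> \<Phi> y * (K (z + (1 / c) *\<^sub>R (- y)) - K z)))"
    proof (rule Bochner_Integration.integrable_bound[where f="\<lambda>y. norm (\<Phi> y) * (2 * (LBINT z. norm (K z)))"])
      show "AE y in lborel. norm (LBINT z. norm (case (y,z) of (y,z) \<Rightarrow> \<Phi> y * (K (z + (1 / c) *\<^sub>R (- y)) - K z)))
          \<le> norm (norm (\<Phi> y) * (2 * (LBINT z. norm (K z))))"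
      proof (rule AE_I2)
        fix y
        have "(LBINT z. norm (case (y,z) of (y,z) \<Rightarrow> \<Phi> y * (K (z + (1 / c) *\<^sub>R (- y)) - K z)))
          = norm (\<Phi> y) * (LBINT z. norm (K (z + (1 / c) *\<^sub>R (- y)) - K z))"
          by (simp add: norm_mult)
        also have "\<dots> \<le> norm (\<Phi> y) * (2 * (LBINT z. norm (K z)))"
          by (rule mult_left_mono[OF wb norm_ge_zero])
        finally show "norm (LBINT z. norm (case (y,z) of (y,z) \<Rightarrow> \<Phi> y * (K (z + (1 / c) *\<^sub>R (- y)) - K z)))
          \<le> norm (norm (\<Phi> y) * (2 * (LBINT z. norm (K z))))"
          by (subst (1) real_norm_def, subst abs_of_nonneg) (auto intro: order_trans[OF _ abs_ge_self])
      qed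
    qed (use i\<Phi> in auto)
    show "AE y in lborel. integrable lborel (\<lambda>z. case (y,z) of (y,z) \<Rightarrow> \<Phi> y * (K (z + (1 / c) *\<^sub>R (- y)) - K z))"
    proof (rule AE_I2)
      fix y
      have "integrable lborel (\<lambda>z. K (z + (1 / c) *\<^sub>R (- y)) - K z)"
        using lborel_integrable_shift[OF iK] iK by (intro Bochner_Integration.integrable_diff)
      then show "integrable lborel (\<lambda>z. case (y,z) of (y,z) \<Rightarrow> \<Phi> y * (K (z + (1 / c) *\<^sub>R (- y)) - K z))"
        by simp
    qed
  qed measurable
  have int3: "integrable (lborel \<Otimes>\<^sub>M lborel) (\<lambda>(y,z). norm (\<Phi> y * (K (z + (1 / c) *\<^sub>R (- y)) - K z)))"
    using integrable_norm[OF int2] by (simp add: case_prod_unfold)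
  have iH: "integrable lborel H" unfolding H_def by (rule lborel_pair.integrable_snd[OF int2])
  have [measurable]: "H \<in> borel_measurable borel" using borel_measurable_integrable[OF iH] by simp
  have "(LBINT x. norm (E c x)) = (1 / c) ^ ?n * (LBINT x. norm (H ((1 / c) *\<^sub>R x)))"
    using c by (simp add: E)
  also have "\<dots> = (LBINT z. norm (H z))"
    using c lborel_integral_affine[of "\<lambda>z. norm (H z)" "1 / c" 0] by simp
  also have "\<dots> \<le> (LBINT z. LBINT y. norm (\<Phi> y * (K (z + (1 / c) *\<^sub>R (- y)) - K z)))"
    unfolding H_def
    by (intro integral_mono integral_norm_bound lborel_pair.integrable_snd[OF int3] integrable_norm iH[unfolded H_def])
  also have "\<dots> = (LBINT y. LBINT z. norm (\<Phi> y * (K (z + (1 / c) *\<^sub>R (- y)) - K z)))"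
    by (rule lborel_pair.Fubini_integral[OF int3])
  also have "\<dots> = (LBINT y. norm (\<Phi> y) * (LBINT z. norm (K (z + (1 / c) *\<^sub>R (- y)) - K z)))"
    by (simp add: norm_mult)
  finally show ?thesis .
qed

text \<open>
  Low frequencies of a mean-zero function disappear both in \<open>L^1\<close> and, as the second limit shows
  on the Fourier side, uniformly. The \<open>L^1\<close> part is the substantial one: it fails if the mean is
  not zero.
\<close>

lemma low_frequency_tendsto_zero:
  fixes \<Phi> :: "real^'n \<Rightarrow> complex"
  assumes \<Phi>: "\<Phi> \<in> schwartz" and z: "(LBINT x. \<Phi> x) = 0"
  defines "E \<equiv> \<lambda>m. inv_fourier (\<lambda>\<xi>. cutoff (real (Suc m) *\<^sub>R \<xi>) * fourier \<Phi> \<xi>)"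
  shows "(\<lambda>m. LBINT x. norm (E m x)) \<longlonglongrightarrow> 0"
    and "(\<lambda>m. LBINT \<xi>. norm (cutoff (real (Suc m) *\<^sub>R \<xi>) * fourier \<Phi> \<xi>)) \<longlonglongrightarrow> 0"
proof -
  define K where "K = inv_fourier (cutoff :: real^'n \<Rightarrow> complex)"
  have K: "K \<in> schwartz" unfolding K_def by (rule inv_fourier_schwartz[OF cutoff_schwartz])
  note F = fourier_schwartz[OF \<Phi>]
  note [measurable] = schwartzD(5)[OF K] schwartzD(5)[OF \<Phi>] schwartzD(5)[OF F] schwartzD(5)[OF cutoff_schwartz]
  have iK: "integrable lborel K" by (rule schwartz_integrable[OF K])
  define \<omega> where "\<omega> = (\<lambda>m y. LBINT z. norm (K (z + (1 / real (Suc m)) *\<^sub>R (- y)) - K z))"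
  have [measurable]: "\<omega> m \<in> borel_measurable borel" for m unfolding \<omega>_def by measurable
  have \<omega>0: "0 \<le> \<omega> m y" for m y by (simp add: \<omega>_def)
  have \<omega>b: "\<omega> m y \<le> 2 * (LBINT z. norm (K z))" for m y
    unfolding \<omega>_def by (rule translation_L1_le[OF iK])
  have "(\<lambda>m. LBINT y. norm (\<Phi> y) * \<omega> m y) \<longlonglongrightarrow> (integral\<^sup>L lborel (\<lambda>y::real^'n. 0))"
  proof (rule integral_dominated_convergence)
    show "integrable lborel (\<lambda>y. norm (\<Phi> y) * (2 * (LBINT z. norm (K z))))"
      using schwartz_integrable[OF \<Phi>] by simp
    show "AE y in lborel. (\<lambda>m. norm (\<Phi> y) * \<omega> m y) \<longlonglongrightarrow> 0"
      unfolding \<omega>_def by (intro AE_I2 tendsto_mult_right_zero translation_continuous_L1[OF K])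
    show "AE y in lborel. norm (norm (\<Phi> y) * \<omega> m y) \<le> norm (\<Phi> y) * (2 * (LBINT z. norm (K z)))" for m
      using \<omega>0 \<omega>b by (auto simp: abs_mult intro!: AE_I2 mult_left_mono)
  qed measurable
  then have lim: "(\<lambda>m. LBINT y. norm (\<Phi> y) * \<omega> m y) \<longlonglongrightarrow> 0" by simp
  show "(\<lambda>m. LBINT x. norm (E m x)) \<longlonglongrightarrow> 0"
  proof (rule tendsto_sandwich[OF _ _ tendsto_const lim])
    show "\<forall>\<^sub>F m in sequentially. (LBINT x. norm (E m x)) \<le> (LBINT y. norm (\<Phi> y) * \<omega> m y)"
      unfolding E_def \<omega>_def K_def by (intro always_eventually allI low_frequency_L1[OF \<Phi> z]) simp
  qed (simp add: always_eventually)
  have "(\<lambda>m. LBINT \<xi>. norm (cutoff (real (Suc m) *\<^sub>R \<xi>) * fourier \<Phi> \<xi>)) \<longlonglongrightarrow> (integral\<^sup>L lborel (\<lambda>\<xi>::real^'n. 0))"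
  proof (rule integral_dominated_convergence)
    show "integrable lborel (\<lambda>\<xi>. norm (fourier \<Phi> \<xi>))" using schwartz_integrable[OF F] by simp
    show "AE \<xi> in lborel. norm (norm (cutoff (real (Suc m) *\<^sub>R \<xi>) * fourier \<Phi> \<xi>)) \<le> norm (fourier \<Phi> \<xi>)" for m
      using norm_cutoff_le_1 by (auto simp: norm_mult intro!: AE_I2 mult_left_le_one_le)
    show "AE \<xi> in lborel. (\<lambda>m. norm (cutoff (real (Suc m) *\<^sub>R \<xi>) * fourier \<Phi> \<xi>)) \<longlonglongrightarrow> 0"
      using AE_lborel_singleton[of "0 :: real^'n"]
    proof eventually_elim
      case (elim \<xi>)
      define a where "a = (norm \<xi>)\<^sup>2"
      have a: "0 < a" using elim by (simp add: a_def)
      \<comment> \<open>The elementary \<open>t \<le> e^t\<close> turns the Gaussian decay of the cutoff into \<open>O(1/m)\<close>.\<close>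
      have cb: "norm (cutoff (real (Suc m) *\<^sub>R \<xi>)) \<le> exp 1 * (1 / (a * real (Suc m)))" for m
      proof -
        have "norm (cutoff (real (Suc m) *\<^sub>R \<xi>)) \<le> exp 1 * exp (- ((real (Suc m))\<^sup>2 * a))"
          using norm_cutoff_le[of "real (Suc m) *\<^sub>R \<xi>"] by (simp add: a_def power_mult_distrib)
        also have "exp (- ((real (Suc m))\<^sup>2 * a)) \<le> 1 / (a * real (Suc m))"
        proof -
          have "a * real (Suc m) \<le> a * (real (Suc m))\<^sup>2"
            using a by (intro mult_left_mono) (auto simp: power2_eq_square)
          also have "\<dots> \<le> exp (a * (real (Suc m))\<^sup>2)"
            using exp_ge_add_one_self[of "a * (real (Suc m))\<^sup>2"] by linarith
          finally have f: "a * real (Suc m) \<le> exp (a * (real (Suc m))\<^sup>2)" .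
          have "0 < a * real (Suc m)" using a by simp
          from le_imp_inverse_le[OF f this] show ?thesis
            by (simp only: exp_minus mult.commute[of "(real (Suc m))\<^sup>2" a] inverse_eq_divide)
        qed
        finally show ?thesis by simp
      qed
      have "norm (norm (cutoff (real (Suc m) *\<^sub>R \<xi>) * fourier \<Phi> \<xi>)) \<le> (exp 1 / a * norm (fourier \<Phi> \<xi>)) * (1 / real (Suc m))" for m
        using mult_right_mono[OF cb[of m] norm_ge_zero[of "fourier \<Phi> \<xi>"]] by (simp add: norm_mult mult_ac)
      moreover have "(\<lambda>m. (exp 1 / a * norm (fourier \<Phi> \<xi>)) * (1 / real (Suc m))) \<longlonglongrightarrow> 0"
        by (intro tendsto_mult_right_zero LIMSEQ_Suc[OF lim_1_over_n])
      ultimately show ?case by (rule Lim_null_comparison[OF always_eventually[OF allI]])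
    qed
  qed measurable
  then show "(\<lambda>m. LBINT \<xi>. norm (cutoff (real (Suc m) *\<^sub>R \<xi>) * fourier \<Phi> \<xi>)) \<longlonglongrightarrow> 0" by simp
qed

text \<open>
  Since \<open>v\<close> lies in \<open>L^1 + L^\<infinity>\<close>, it suffices to split a mean-zero Schwartz function into a part
  whose transform is flat at the origin, to which \<open>v\<close> is orthogonal, and a low-frequency part that
  is small in \<open>L^1\<close> and uniformly. Hence \<open>v\<close> is orthogonal to all mean-zero functions. A
  nonconstant polynomial would also be orthogonal to the functions in question, but it does not
  belong to any \<open>L^p\<close>.
\<close>

lemma constant_if_orthogonal_to_schwartz_zero:
  fixes v :: "real^'n \<Rightarrow> complex"
  assumes p: "1 \<le> p" and v: "v \<in> Lp_borel p"
    and orth: "\<And>\<psi>. \<psi> \<in> schwartz_zero \<Longrightarrow> \<langle>v, \<psi>\<rangle> = 0"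
  shows "\<exists>c. AE x in lborel. v x = c"
proof -
  note vm[measurable] = Lp_borel_measurable[OF v]
  obtain C where C: "0 \<le> C"
    "\<And>\<Phi> B. integrable lborel \<Phi> \<Longrightarrow> (\<And>x. norm (\<Phi> x) \<le> B) \<Longrightarrow> integrable lborel (\<lambda>x. v x * \<Phi> x) \<and>
     norm (LBINT x. v x * \<Phi> x) \<le> C * (B + (LBINT x. norm (\<Phi> x)))"
    using Lp_pairing[OF p v] by blast
  note v_schwartz = Lp_schwartz_pairing_integrable[OF p v]
  have mean0: "(LBINT x. v x * \<Phi> x) = 0" if \<Phi>: "\<Phi> \<in> schwartz" and z: "(LBINT x. \<Phi> x) = 0" for \<Phi>
  proof -
    note F = fourier_schwartz[OF \<Phi>]
    define L where "L = (\<lambda>m \<xi>. cutoff (real (Suc m) *\<^sub>R \<xi>) * fourier \<Phi> \<xi>)"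
    have L: "L m \<in> schwartz" for m
    proof -
      have "(\<lambda>\<xi>::real^'n. 1 - cutoff (real (Suc m) *\<^sub>R \<xi>)) \<in> slow_flat"
        by (rule slow_flat_dilation[OF one_minus_cutoff_slow_flat])
      then have "(\<lambda>\<xi>::real^'n. 1 - cutoff (real (Suc m) *\<^sub>R \<xi>)) \<in> slow" by (simp add: slow_flat_def)
      then have "(\<lambda>\<xi>. (1 - cutoff (real (Suc m) *\<^sub>R \<xi>)) * fourier \<Phi> \<xi>) \<in> schwartz" by (rule slow_schwartz[OF _ F])
      from schwartz_diff[OF F this] show ?thesis by (simp add: L_def algebra_simps)
    qed
    have Z: "(\<lambda>\<xi>. (1 - cutoff (real (Suc m) *\<^sub>R \<xi>)) * fourier \<Phi> \<xi>) \<in> schwartz_zero" for m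
      by (rule slow_flat_schwartz[OF slow_flat_dilation[OF one_minus_cutoff_slow_flat] F])
    note [measurable] = schwartzD(5)[OF F] schwartzD(5)[OF L]
    have split: "\<Phi> x = inv_fourier (\<lambda>\<xi>. (1 - cutoff (real (Suc m) *\<^sub>R \<xi>)) * fourier \<Phi> \<xi>) x + inv_fourier (L m) x" for m x
    proof -
      have ZS: "(\<lambda>\<xi>. (1 - cutoff (real (Suc m) *\<^sub>R \<xi>)) * fourier \<Phi> \<xi>) \<in> schwartz" using Z[of m] by (simp add: schwartz_zero_def)
      have "inv_fourier (\<lambda>\<xi>. (1 - cutoff (real (Suc m) *\<^sub>R \<xi>)) * fourier \<Phi> \<xi>) x + inv_fourier (L m) x
        = (LBINT \<xi>. (1 - cutoff (real (Suc m) *\<^sub>R \<xi>)) * fourier \<Phi> \<xi> * plane_wave x \<xi> + L m \<xi> * plane_wave x \<xi>)"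
        unfolding inv_fourier_eq[OF schwartzD(5)[OF ZS]] inv_fourier_eq[OF schwartzD(5)[OF L]]
        by (rule Bochner_Integration.integral_add[symmetric])
           (rule integrable_mult_plane_wave[OF schwartz_integrable[OF ZS]] integrable_mult_plane_wave[OF schwartz_integrable[OF L]])+
      also have "\<dots> = inv_fourier (fourier \<Phi>) x"
        by (subst inv_fourier_eq) (auto simp: L_def algebra_simps)
      finally show ?thesis by (simp add: schwartz_inversion[OF \<Phi>])
    qed
    have eq: "(LBINT x. v x * \<Phi> x) = \<langle>v, L m\<rangle>" for m
    proof -
      have ZS: "(\<lambda>\<xi>. (1 - cutoff (real (Suc m) *\<^sub>R \<xi>)) * fourier \<Phi> \<xi>) \<in> schwartz" using Z[of m] by (simp add: schwartz_zero_def)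
      show ?thesis
        using v_schwartz[OF inv_fourier_schwartz[OF ZS]] v_schwartz[OF inv_fourier_schwartz[OF L[of m]]] orth[OF Z[of m]]
        by (subst split[of _ m]) (simp add: distrib_left)
    qed
    have "norm (LBINT x. v x * \<Phi> x) \<le> C * ((LBINT \<xi>. norm (L m \<xi>)) + (LBINT x. norm (inv_fourier (L m) x)))" for m
      unfolding eq[of m]
      using C(2)[OF schwartz_integrable[OF inv_fourier_schwartz[OF L[of m]]] norm_inv_fourier_le[OF schwartz_integrable[OF L[of m]]]] by blast
    moreover have "(\<lambda>m. C * ((LBINT \<xi>. norm (L m \<xi>)) + (LBINT x. norm (inv_fourier (L m) x)))) \<longlonglongrightarrow> C * (0 + 0)"
      unfolding L_def by (intro tendsto_mult_left tendsto_add low_frequency_tendsto_zero[OF \<Phi> z])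
    ultimately have "norm (LBINT x. v x * \<Phi> x) \<le> C * (0 + 0)"
      by (intro LIMSEQ_le_const) auto
    then show ?thesis by simp
  qed
  define I where "I = (LBINT x. (gauss :: real^'n \<Rightarrow> complex) x)"
  have I: "I \<noteq> 0" unfolding I_def by (rule integral_gauss_ne_0)
  define c where "c = (LBINT x. v x * gauss x) / I"
  have "AE x in lborel. v x - c = 0"
  proof (rule AE_zero_if_orthogonal_to_schwartz)
    fix \<phi> :: "real^'n \<Rightarrow> complex" assume \<phi>: "\<phi> \<in> schwartz"
    have i: "integrable lborel \<phi>" by (rule schwartz_integrable[OF \<phi>])
    show "integrable lborel (\<lambda>x. (v x - c) * \<phi> x)" using v_schwartz[OF \<phi>] i by (simp add: left_diff_distrib)
    \<comment> \<open>Subtracting this multiple of a Gaussian from \<open>\<phi>\<close> makes the mean zero.\<close>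
    define b where "b = (LBINT x. \<phi> x) / I"
    have S: "(\<lambda>x. \<phi> x - b * gauss x) \<in> schwartz" by (rule schwartz_diff[OF \<phi> schwartz_cmult[OF gauss_schwartz]])
    have "(LBINT x. \<phi> x - b * gauss x) = 0"
      using i schwartz_integrable[OF gauss_schwartz, where 'a='n] I by (simp add: I_def[symmetric] b_def)
    from mean0[OF S this] have "(LBINT x. v x * \<phi> x - b * (v x * gauss x)) = 0"
      by (simp add: algebra_simps)
    then have "(LBINT x. v x * \<phi> x) = b * (LBINT x. v x * gauss x)"
      using v_schwartz[OF \<phi>] v_schwartz[OF gauss_schwartz] by simp
    also have "\<dots> = c * (LBINT x. \<phi> x)" by (simp add: b_def c_def)
    finally show "(LBINT x. (v x - c) * \<phi> x) = 0"
      using v_schwartz[OF \<phi>] i by (simp add: left_diff_distrib)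
  qed measurable
  then show ?thesis by (intro exI[of _ c]) auto
qed

section \<open>Lp functions as tempered distributions\<close>

lemma seminorm_upper:
  assumes "\<phi> \<in> schwartz"
  shows "norm (mono_pow \<gamma> x *\<^sub>R partials is \<phi> x) \<le> schwartz_seminorm \<gamma> is \<phi>"
  unfolding schwartz_seminorm_def
proof (rule cSUP_upper)
  have "bounded (range (\<lambda>x. mono_pow \<gamma> x *\<^sub>R partials is \<phi> x))" using assms by (simp add: schwartz_def)
  then show "bdd_above (range (\<lambda>x. norm (mono_pow \<gamma> x *\<^sub>R partials is \<phi> x)))"
    by (auto simp: bounded_iff bdd_above_def)
qed simp

text \<open>
  The sup-norm and the \<open>L^1\<close> norm of \<open>\<phi>\<close> are controlled by the weights \<open>1\<close> and \<open>x_i^(2n)\<close>.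
\<close>

lemma distr_of_seminorm_bound:
  fixes v :: "real^'n \<Rightarrow> complex"
  assumes p: "1 \<le> p" and v: "v \<in> Lp_borel p"
  shows "\<exists>\<Gamma> C. finite \<Gamma> \<and> 0 \<le> C \<and> (\<forall>\<phi>\<in>schwartz. norm (LBINT x. v x * \<phi> x) \<le> C * (\<Sum>\<gamma>\<in>\<Gamma>. schwartz_seminorm \<gamma> [] \<phi>))"
proof -
  obtain C where C: "0 \<le> C"
    "\<And>\<Phi> B. integrable lborel \<Phi> \<Longrightarrow> (\<And>x. norm (\<Phi> x) \<le> B) \<Longrightarrow> integrable lborel (\<lambda>x. v x * \<Phi> x) \<and>
     norm (LBINT x. v x * \<Phi> x) \<le> C * (B + (LBINT x. norm (\<Phi> x)))"
    using Lp_pairing[OF p v] by blast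
  let ?k = "2 * CARD('n)"
  define g where "g = (\<lambda>i::'n. (\<lambda>_. 0)(i := ?k) :: 'n \<Rightarrow> nat)"
  define \<Gamma> where "\<Gamma> = insert (\<lambda>_. 0) (range g)"
  have fin: "finite \<Gamma>" by (simp add: \<Gamma>_def)
  define A where "A = (1 + real CARD('n)) ^ ?k * (1 + real CARD('n))"
  define W where "W = (integral\<^sup>L lborel (\<lambda>x::real^'n. decay x))"
  have W0: "0 \<le> W" unfolding W_def by (intro integral_nonneg_AE) (auto simp: less_imp_le)
  have A0: "0 \<le> A" by (simp add: A_def)
  show ?thesis
  proof (intro exI[of _ \<Gamma>] exI[of _ "C * (1 + A * W)"] conjI ballI)
    fix \<phi> :: "real^'n \<Rightarrow> complex" assume \<phi>: "\<phi> \<in> schwartz"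
    define S where "S = (\<Sum>\<gamma>\<in>\<Gamma>. schwartz_seminorm \<gamma> [] \<phi>)"
    have sn0: "0 \<le> schwartz_seminorm \<gamma> [] \<phi>" for \<gamma>
      using order_trans[OF norm_ge_zero seminorm_upper[OF \<phi>, of \<gamma> 0 "[]"]] .
    have le: "schwartz_seminorm \<gamma> [] \<phi> \<le> S" if "\<gamma> \<in> \<Gamma>" for \<gamma>
      unfolding S_def using that fin sn0 by (intro member_le_sum) auto
    have b0: "norm (\<phi> x) \<le> S" for x
      using seminorm_upper[OF \<phi>, of "\<lambda>_. 0" x "[]"] le[of "\<lambda>_. 0"] by (simp add: mono_pow_def \<Gamma>_def)
    have bi: "\<bar>x $ i\<bar> ^ ?k * norm (\<phi> x) \<le> S" for x i
      using seminorm_upper[OF \<phi>, of "g i" x "[]"] le[of "g i"] by (simp add: g_def mono_pow_single power_abs \<Gamma>_def)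
    have S0: "0 \<le> S" using order_trans[OF norm_ge_zero b0] .
    have bw: "norm (\<phi> x) \<le> (A * S) * decay x" for x
    proof -
      have pos: "0 < (1 + norm x) ^ ?k" by (intro zero_less_power add_pos_nonneg) auto
      have "(1 + norm x) ^ ?k * norm (\<phi> x) \<le> (1 + real CARD('n)) ^ ?k * (1 + (\<Sum>i\<in>UNIV. \<bar>x $ i\<bar> ^ ?k)) * norm (\<phi> x)"
        by (intro mult_right_mono one_plus_norm_power_le) auto
      also have "\<dots> = (1 + real CARD('n)) ^ ?k * (norm (\<phi> x) + (\<Sum>i\<in>UNIV. \<bar>x $ i\<bar> ^ ?k * norm (\<phi> x)))"
        by (simp add: distrib_right sum_distrib_right mult.assoc)
      also have "\<dots> \<le> (1 + real CARD('n)) ^ ?k * (S + (\<Sum>i\<in>(UNIV::'n set). S))"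
        by (intro mult_left_mono add_mono sum_mono b0 bi) auto
      also have "\<dots> = A * S" by (simp add: A_def algebra_simps)
      finally show ?thesis using pos by (simp add: decay_def field_simps)
    qed
    have "(LBINT x. norm (\<phi> x)) \<le> (LBINT x. (A * S) * decay (x::real^'n))"
      using schwartz_integrable[OF \<phi>] decay_integrable[where 'n='n] by (intro integral_mono[OF _ _ bw]) auto
    also have "\<dots> = A * W * S" by (simp add: W_def)
    finally have "S + (LBINT x. norm (\<phi> x)) \<le> (1 + A * W) * S" by (simp add: distrib_right)
    then have "C * (S + (LBINT x. norm (\<phi> x))) \<le> C * ((1 + A * W) * S)" using C(1) by (rule mult_left_mono)
    then show "norm (LBINT x. v x * \<phi> x) \<le> C * (1 + A * W) * S"
      using C(2)[OF schwartz_integrable[OF \<phi>] b0] by (simp add: mult.assoc)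
  qed (use fin C(1) A0 W0 in auto)
qed

lemma distr_of_in_dual:
  fixes u :: "real^'n \<Rightarrow> complex"
  assumes p: "1 \<le> p" and u: "u \<in> Lp p"
  shows "distr_of u \<in> dual schwartz"
proof -
  obtain v where v: "v \<in> Lp_borel p" "AE x in lborel. u x = v x" using Lp_representative[OF u] by blast
  have ub: "u \<in> borel_measurable lebesgue" using u by (simp add: Lp_def)
  have T: "distr_of u \<phi> = (LBINT x. v x * \<phi> x)" if "\<phi> \<in> schwartz" for \<phi>
    by (rule distr_of_borel[OF ub Lp_borel_measurable[OF v(1)] v(2) schwartzD(5)[OF that]])
  note v_schwartz = Lp_schwartz_pairing_integrable[OF p v(1)]
  have lin: "distr_of u (\<lambda>x. a * \<phi> x + b * \<psi> x) = a * distr_of u \<phi> + b * distr_of u \<psi>"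
    if "\<phi> \<in> schwartz" "\<psi> \<in> schwartz" for \<phi> \<psi> a b
  proof -
    have "(\<lambda>x. a * \<phi> x + b * \<psi> x) \<in> schwartz" using that by (intro schwartz_add schwartz_cmult)
    then have "distr_of u (\<lambda>x. a * \<phi> x + b * \<psi> x) = (LBINT x. v x * (a * \<phi> x + b * \<psi> x))" by (rule T)
    also have "\<dots> = (LBINT x. a * (v x * \<phi> x) + b * (v x * \<psi> x))" by (simp add: algebra_simps)
    finally show ?thesis using v_schwartz[OF that(1)] v_schwartz[OF that(2)] by (simp add: T[OF that(1)] T[OF that(2)])
  qed
  obtain \<Gamma> C where G: "finite \<Gamma>" "0 \<le> C"
    "\<And>\<phi>. \<phi> \<in> schwartz \<Longrightarrow> norm (LBINT x. v x * \<phi> x) \<le> C * (\<Sum>\<gamma>\<in>\<Gamma>. schwartz_seminorm \<gamma> [] \<phi>)"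
    using distr_of_seminorm_bound[OF p v(1)] by blast
  let ?V = "\<lambda>\<gamma> is (f :: real^'n \<Rightarrow> complex) e. {g \<in> schwartz. schwartz_seminorm \<gamma> is (\<lambda>x. g x - f x) < e}"
  have open_V: "openin schwartz_topology (?V \<gamma> is f e)" if "f \<in> schwartz" "0 < e" for \<gamma> "is" f e
    unfolding schwartz_topology_def by (rule topology_generated_by_Basis) (use that in blast)
  have sn_zero: "schwartz_seminorm \<gamma> [] (\<lambda>x::real^'n. 0) = 0" for \<gamma>
    by (simp add: schwartz_seminorm_def)
  have top: "topspace schwartz_topology = (schwartz :: (real^'n \<Rightarrow> complex) set)"
  proof
    show "topspace schwartz_topology \<subseteq> (schwartz :: (real^'n \<Rightarrow> complex) set)"
      unfolding schwartz_topology_def topology_generated_by_topspace by blast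
    show "(schwartz :: (real^'n \<Rightarrow> complex) set) \<subseteq> topspace schwartz_topology"
    proof
      fix f :: "real^'n \<Rightarrow> complex" assume f: "f \<in> schwartz"
      then have "f \<in> ?V (\<lambda>_. 0) [] f 1" by (simp add: sn_zero)
      moreover have "openin schwartz_topology (?V (\<lambda>_. 0) [] f 1)" by (rule open_V[OF f]) simp
      ultimately show "f \<in> topspace schwartz_topology" using openin_subset by blast
    qed
  qed
  have "continuous_map (subtopology schwartz_topology schwartz) euclidean (distr_of u)"
    unfolding continuous_map
  proof (intro conjI allI impI)
    fix U :: "complex set" assume U: "openin euclidean U"
    let ?P = "{\<phi> \<in> topspace (subtopology schwartz_topology schwartz). distr_of u \<phi> \<in> U}"
    have P: "?P = {\<phi> \<in> schwartz. distr_of u \<phi> \<in> U}" by (simp add: top)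
    have "openin schwartz_topology ?P"
      unfolding P
    proof (subst openin_subopen, intro ballI)
      fix f assume "f \<in> {\<phi> \<in> schwartz. distr_of u \<phi> \<in> U}"
      then have f: "f \<in> schwartz" "distr_of u f \<in> U" by auto
      obtain e where e: "0 < e" "ball (distr_of u f) e \<subseteq> U" using U f(2) by (auto simp: open_contains_ball)
      define d where "d = e / ((C + 1) * (real (card \<Gamma>) + 1))"
      have d: "0 < d" using e G(2) by (simp add: d_def add_nonneg_pos)
      define N where "N = \<Inter>((\<lambda>\<gamma>. ?V \<gamma> [] f d) ` (insert (\<lambda>_. 0) \<Gamma>))"
      have "openin schwartz_topology N"
        unfolding N_def by (rule openin_Inter) (use G(1) open_V[OF f(1) d] in auto)
      moreover have "f \<in> N" unfolding N_def using f(1) d by (auto simp: sn_zero)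
      moreover have "N \<subseteq> {\<phi> \<in> schwartz. distr_of u \<phi> \<in> U}"
      proof
        fix g assume g: "g \<in> N"
        then have gS: "g \<in> schwartz" by (auto simp: N_def)
        have gd: "schwartz_seminorm \<gamma> [] (\<lambda>x. g x - f x) \<le> d" if "\<gamma> \<in> \<Gamma>" for \<gamma>
          using g that by (auto simp: N_def less_imp_le)
        have D: "(\<lambda>x. g x - f x) \<in> schwartz" by (rule schwartz_diff[OF gS f(1)])
        have "distr_of u g - distr_of u f = (LBINT x. v x * (g x - f x))"
          using v_schwartz[OF gS] v_schwartz[OF f(1)] by (simp add: T[OF gS] T[OF f(1)] right_diff_distrib)
        then have "norm (distr_of u g - distr_of u f) \<le> C * (\<Sum>\<gamma>\<in>\<Gamma>. schwartz_seminorm \<gamma> [] (\<lambda>x. g x - f x))"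
          using G(3)[OF D] by simp
        also have "\<dots> \<le> C * (\<Sum>\<gamma>\<in>\<Gamma>. d)" using G(2) gd by (intro mult_left_mono sum_mono) auto
        also have "\<dots> = C * (real (card \<Gamma>) * d)" by simp
        also have "\<dots> < (C + 1) * ((real (card \<Gamma>) + 1) * d)"
          using G(2) d by (intro mult_strict_mono' mult_strict_right_mono) auto
        also have "\<dots> = e" unfolding d_def using G(2) by (simp add: add_nonneg_pos)
        finally have "distr_of u g \<in> ball (distr_of u f) e" by (simp add: dist_norm norm_minus_commute)
        then show "g \<in> {\<phi> \<in> schwartz. distr_of u \<phi> \<in> U}" using e gS by blast
      qed
      ultimately show "\<exists>N. openin schwartz_topology N \<and> f \<in> N \<and> N \<subseteq> {\<phi> \<in> schwartz. distr_of u \<phi> \<in> U}" by blast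
    qed
    then show "openin (subtopology schwartz_topology schwartz) ?P"
      by (subst openin_subtopology) (rule exI[of _ ?P], auto simp: top)
  qed simp
  then show ?thesis using lin by (simp add: dual_def)
qed

section \<open>Multipliers of Lebesgue spaces\<close>

text \<open>
  Symbols such as \<open>A\<close> and \<open>B\<close> are not smooth at the origin and do not preserve the Schwartz space.
  They do preserve this larger class, on which every \<open>L^p\<close> function still pairs with the inverse
  Fourier transform.
\<close>

definition tests :: "(real^'n \<Rightarrow> complex) set" where
  "tests = {\<psi>. integrable lborel \<psi> \<and> integrable lborel (inv_fourier \<psi>)}"

lemma testsD:
  assumes "\<psi> \<in> tests"
  shows "integrable lborel \<psi>" "integrable lborel (inv_fourier \<psi>)" "\<psi> \<in> borel_measurable borel"
  using assms borel_measurable_integrable[of lborel \<psi>] by (auto simp: tests_def)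

lemma schwartz_tests: "\<psi> \<in> schwartz \<Longrightarrow> \<psi> \<in> tests"
  by (simp add: tests_def schwartz_integrable inv_fourier_schwartz)

lemma inv_fourier_add:
  assumes "integrable lborel \<psi>" "integrable lborel \<phi>"
  shows "inv_fourier (\<lambda>\<xi>. \<psi> \<xi> + \<phi> \<xi>) x = inv_fourier \<psi> x + inv_fourier \<phi> x"
proof -
  note [measurable] = borel_measurable_integrable[OF assms(1)] borel_measurable_integrable[OF assms(2)]
  show ?thesis
    using integrable_mult_plane_wave[OF assms(1), of x] integrable_mult_plane_wave[OF assms(2), of x]
    by (simp add: inv_fourier_eq distrib_right)
qed

lemma inv_fourier_cmult:
  assumes "\<psi> \<in> borel_measurable borel"
  shows "inv_fourier (\<lambda>\<xi>. c * \<psi> \<xi>) x = c * inv_fourier \<psi> x"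
  using assms by (simp add: inv_fourier_eq mult.assoc)

lemma tests_add: "\<psi> \<in> tests \<Longrightarrow> \<phi> \<in> tests \<Longrightarrow> (\<lambda>\<xi>. \<psi> \<xi> + \<phi> \<xi>) \<in> tests"
proof -
  assume a: "\<psi> \<in> tests" "\<phi> \<in> tests"
  have "inv_fourier (\<lambda>\<xi>. \<psi> \<xi> + \<phi> \<xi>) = (\<lambda>x. inv_fourier \<psi> x + inv_fourier \<phi> x)"
    by (intro ext inv_fourier_add testsD a)
  then show ?thesis using a by (simp add: tests_def)
qed

lemma tests_cmult: "\<psi> \<in> tests \<Longrightarrow> (\<lambda>\<xi>. c * \<psi> \<xi>) \<in> tests"
proof -
  assume a: "\<psi> \<in> tests"
  have "inv_fourier (\<lambda>\<xi>. c * \<psi> \<xi>) = (\<lambda>x. c * inv_fourier \<psi> x)"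
    by (intro ext inv_fourier_cmult testsD a)
  then show ?thesis using a by (simp add: tests_def)
qed

lemma pairing_tests_integrable:
  assumes "1 \<le> p" "v \<in> Lp_borel p" "\<psi> \<in> tests"
  shows "integrable lborel (\<lambda>x. v x * inv_fourier \<psi> x)"
  by (rule Lp_pairing_integrable[OF assms(1,2) testsD(2)[OF assms(3)] norm_inv_fourier_le[OF testsD(1)[OF assms(3)]]])

text \<open>
  \<open>T\<close> is bounded by \<open>C\<close> on \<open>L^p\<close> and acts on the Fourier side as multiplication by \<open>h\<close>. Describing
  the operator by its adjoint action on test functions makes sums and compositions immediate,
  without computing convolutions of kernels. The last clause, that constants are mapped to
  constants, is a residue of translation invariance; for \<open>p = \<infinity>\<close> it is needed at frequency zero.
\<close>

definition realizes :: "ereal \<Rightarrow> (real^'n \<Rightarrow> real) \<Rightarrow> real \<Rightarrow> ((real^'n \<Rightarrow> complex) \<Rightarrow> real^'n \<Rightarrow> complex) \<Rightarrow> bool" where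
  "realizes p h C T \<longleftrightarrow> 0 \<le> C \<and>
     (\<forall>v\<in>Lp_borel p. T v \<in> Lp_borel p \<and> Lp_norm p (T v) \<le> C * Lp_norm p v \<and>
        (\<forall>\<psi>\<in>tests. \<langle>T v, \<psi>\<rangle> = \<langle>v, h \<odot> \<psi>\<rangle>) \<and>
        ((\<exists>c. AE x in lborel. v x = c) \<longrightarrow> (\<exists>c. AE x in lborel. T v x = c)))"

lemma realizesD:
  assumes "realizes p h C T"
  shows "0 \<le> C" "v \<in> Lp_borel p \<Longrightarrow> T v \<in> Lp_borel p" "v \<in> Lp_borel p \<Longrightarrow> Lp_norm p (T v) \<le> C * Lp_norm p v"
    "v \<in> Lp_borel p \<Longrightarrow> \<psi> \<in> tests \<Longrightarrow>
       \<langle>T v, \<psi>\<rangle> = \<langle>v, h \<odot> \<psi>\<rangle>"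
    "v \<in> Lp_borel p \<Longrightarrow> AE x in lborel. v x = c \<Longrightarrow> \<exists>c. AE x in lborel. T v x = c"
  using assms unfolding realizes_def by blast+

definition Lp_multiplier :: "ereal \<Rightarrow> (real^'n \<Rightarrow> real) \<Rightarrow> bool" where
  "Lp_multiplier p h \<longleftrightarrow>
     (\<forall>\<psi>\<in>tests. (h \<odot> \<psi>) \<in> tests) \<and> (\<exists>C T. realizes p h C T)"

lemma Lp_multiplier_tests: "Lp_multiplier p h \<Longrightarrow> \<psi> \<in> tests \<Longrightarrow> (h \<odot> \<psi>) \<in> tests"
  by (simp add: Lp_multiplier_def)

lemma Lp_multiplierE:
  assumes "Lp_multiplier p h"
  obtains C T where "realizes p h C T"
  using assms unfolding Lp_multiplier_def by blast

lemma Lp_multiplierI: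
  fixes h :: "real^'n \<Rightarrow> real" and T :: "(real^'n \<Rightarrow> complex) \<Rightarrow> real^'n \<Rightarrow> complex"
  assumes "\<And>\<psi>. \<psi> \<in> tests \<Longrightarrow> (h \<odot> \<psi>) \<in> tests"
    and "0 \<le> C" and "\<And>v. v \<in> Lp_borel p \<Longrightarrow> T v \<in> Lp_borel p" and "\<And>v. v \<in> Lp_borel p \<Longrightarrow> Lp_norm p (T v) \<le> C * Lp_norm p v"
    and "\<And>v \<psi>. v \<in> Lp_borel p \<Longrightarrow> \<psi> \<in> tests \<Longrightarrow>
       \<langle>T v, \<psi>\<rangle> = \<langle>v, h \<odot> \<psi>\<rangle>"
    and "\<And>v c. v \<in> Lp_borel p \<Longrightarrow> AE x in lborel. v x = c \<Longrightarrow> \<exists>c. AE x in lborel. T v x = c"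
  shows "Lp_multiplier p h"
proof -
  have "realizes p h C T"
    unfolding realizes_def using assms(2-6) by (intro conjI ballI impI) (simp_all, blast)
  then show ?thesis unfolding Lp_multiplier_def using assms(1) by blast
qed

lemma Lp_multiplier_const:
  assumes p: "1 \<le> p"
  shows "Lp_multiplier p (\<lambda>_::real^'n. c)"
proof (rule Lp_multiplierI[where C="\<bar>c\<bar>" and T="\<lambda>v x. of_real c * v x"])
  fix v :: "real^'n \<Rightarrow> complex" assume v: "v \<in> Lp_borel p"
  show "(\<lambda>x. of_real c * v x) \<in> Lp_borel p" by (rule Lp_norm_scale[OF p v])
  show "Lp_norm p (\<lambda>x. of_real c * v x) \<le> \<bar>c\<bar> * Lp_norm p v" using Lp_norm_scale(2)[OF p v, of "of_real c"] by simp
  fix \<psi> :: "real^'n \<Rightarrow> complex" assume \<psi>: "\<psi> \<in> tests"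
  show "(LBINT x. of_real c * v x * inv_fourier \<psi> x) = \<langle>v, \<lambda>\<xi>. of_real c * \<psi> \<xi>\<rangle>"
    by (simp add: inv_fourier_cmult[OF testsD(3)[OF \<psi>]] mult_ac)
next
  fix v :: "real^'n \<Rightarrow> complex" and d assume "AE x in lborel. v x = d"
  then have "AE x in lborel. of_real c * v x = of_real c * d" by eventually_elim simp
  then show "\<exists>d. AE x in lborel. of_real c * v x = d" by blast
qed (auto simp: tests_cmult)

lemma Lp_multiplier_add:
  fixes h k :: "real^'n \<Rightarrow> real"
  assumes p: "1 \<le> p" and h: "Lp_multiplier p h" and k: "Lp_multiplier p k"
  shows "Lp_multiplier p (\<lambda>\<xi>. h \<xi> + k \<xi>)"
proof -
  obtain C S where Sr: "realizes p h C S" by (rule Lp_multiplierE[OF h])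
  note S = realizesD[OF Sr]
  obtain D T where Tr: "realizes p k D T" by (rule Lp_multiplierE[OF k])
  note T = realizesD[OF Tr]
  show ?thesis
  proof (rule Lp_multiplierI[where C="2 * (C + D)" and T="\<lambda>v x. S v x + T v x"])
    fix v :: "real^'n \<Rightarrow> complex" assume v: "v \<in> Lp_borel p"
    note sum = Lp_norm_add[OF p S(2)[OF v] T(2)[OF v]]
    show "(\<lambda>x. S v x + T v x) \<in> Lp_borel p" by (rule sum)
    show "Lp_norm p (\<lambda>x. S v x + T v x) \<le> 2 * (C + D) * Lp_norm p v"
      using sum(2) S(3)[OF v] T(3)[OF v] by (simp add: algebra_simps)
    {
      fix \<psi> :: "real^'n \<Rightarrow> complex" assume \<psi>: "\<psi> \<in> tests"
      note th = Lp_multiplier_tests[OF h \<psi>] and tk = Lp_multiplier_tests[OF k \<psi>]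
      have e: "inv_fourier (\<lambda>\<xi>. of_real (h \<xi> + k \<xi>) * \<psi> \<xi>) x
          = inv_fourier (h \<odot> \<psi>) x + inv_fourier (k \<odot> \<psi>) x" for x
        using inv_fourier_add[OF testsD(1)[OF th] testsD(1)[OF tk]] by (simp add: distrib_right)
      show "(LBINT x. (S v x + T v x) * inv_fourier \<psi> x)
          = \<langle>v, \<lambda>\<xi>. of_real (h \<xi> + k \<xi>) * \<psi> \<xi>\<rangle>"
        unfolding e distrib_left distrib_right
        using pairing_tests_integrable[OF p S(2)[OF v] \<psi>] pairing_tests_integrable[OF p T(2)[OF v] \<psi>]
          pairing_tests_integrable[OF p v th] pairing_tests_integrable[OF p v tk] S(4)[OF v \<psi>] T(4)[OF v \<psi>]
        by simp
    }
    fix c assume "AE x in lborel. v x = c"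
    from S(5)[OF v this] T(5)[OF v this] obtain a b where "AE x in lborel. S v x = a" "AE x in lborel. T v x = b" by blast
    then have "AE x in lborel. S v x + T v x = a + b" by eventually_elim simp
    then show "\<exists>c. AE x in lborel. S v x + T v x = c" by blast
  next
    fix \<psi> :: "real^'n \<Rightarrow> complex" assume \<psi>: "\<psi> \<in> tests"
    show "(\<lambda>\<xi>. of_real (h \<xi> + k \<xi>) * \<psi> \<xi>) \<in> tests"
      using tests_add[OF Lp_multiplier_tests[OF h \<psi>] Lp_multiplier_tests[OF k \<psi>]] by (simp add: distrib_right)
  qed (use S(1) T(1) in simp)
qed

lemma Lp_multiplier_mult:
  fixes h k :: "real^'n \<Rightarrow> real"
  assumes h: "Lp_multiplier p h" and k: "Lp_multiplier p k"
  shows "Lp_multiplier p (\<lambda>\<xi>. h \<xi> * k \<xi>)"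
proof -
  obtain C S where Sr: "realizes p h C S" by (rule Lp_multiplierE[OF h])
  note S = realizesD[OF Sr]
  obtain D T where Tr: "realizes p k D T" by (rule Lp_multiplierE[OF k])
  note T = realizesD[OF Tr]
  show ?thesis
  proof (rule Lp_multiplierI[where C="D * C" and T="\<lambda>v. T (S v)"])
    fix v :: "real^'n \<Rightarrow> complex" assume v: "v \<in> Lp_borel p"
    show "T (S v) \<in> Lp_borel p" by (intro T(2) S(2) v)
    show "Lp_norm p (T (S v)) \<le> D * C * Lp_norm p v"
      using T(3)[OF S(2)[OF v]] mult_left_mono[OF S(3)[OF v] T(1)] by (simp add: mult.assoc)
    {
      fix \<psi> :: "real^'n \<Rightarrow> complex" assume \<psi>: "\<psi> \<in> tests"
      show "\<langle>T (S v), \<psi>\<rangle>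
          = \<langle>v, \<lambda>\<xi>. of_real (h \<xi> * k \<xi>) * \<psi> \<xi>\<rangle>"
        using T(4)[OF S(2)[OF v] \<psi>] S(4)[OF v Lp_multiplier_tests[OF k \<psi>]] by (simp add: mult.assoc)
    }
    fix c assume "AE x in lborel. v x = c"
    from S(5)[OF v this] obtain d where "AE x in lborel. S v x = d" by blast
    then show "\<exists>c. AE x in lborel. T (S v) x = c" by (rule T(5)[OF S(2)[OF v]])
  next
    fix \<psi> :: "real^'n \<Rightarrow> complex" assume \<psi>: "\<psi> \<in> tests"
    show "(\<lambda>\<xi>. of_real (h \<xi> * k \<xi>) * \<psi> \<xi>) \<in> tests"
      using Lp_multiplier_tests[OF h Lp_multiplier_tests[OF k \<psi>]] by (simp add: mult.assoc)
  qed (use S(1) T(1) in simp)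
qed

lemma Lp_multiplier_cmult: "1 \<le> p \<Longrightarrow> Lp_multiplier p h \<Longrightarrow> Lp_multiplier p (\<lambda>\<xi>. c * h \<xi>)"
  by (intro Lp_multiplier_mult Lp_multiplier_const)

lemma Lp_multiplier_diff:
  assumes "1 \<le> p" "Lp_multiplier p h" "Lp_multiplier p k"
  shows "Lp_multiplier p (\<lambda>\<xi>. h \<xi> - k \<xi>)"
  using Lp_multiplier_add[OF assms(1,2) Lp_multiplier_cmult[OF assms(1,3), of "-1"]] by simp

lemma Lp_multiplier_power: "1 \<le> p \<Longrightarrow> Lp_multiplier p h \<Longrightarrow> Lp_multiplier p (\<lambda>\<xi>. h \<xi> ^ k)"
  by (induction k) (auto intro: Lp_multiplier_mult Lp_multiplier_const)

lemma Lp_multiplier_sum: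
  assumes "1 \<le> p" "finite I" "\<And>i. i \<in> I \<Longrightarrow> Lp_multiplier p (h i)"
  shows "Lp_multiplier p (\<lambda>\<xi>. \<Sum>i\<in>I. h i \<xi>)"
  using assms(2,3)
  by (induction I rule: finite_induct) (auto intro: Lp_multiplier_add Lp_multiplier_const assms(1))

text \<open>
  Convolution with a positive integrable kernel, whose transform is \<open>h\<close>.
\<close>

lemma Lp_multiplier_kernel:
  fixes K :: "real^'n \<Rightarrow> real"
  assumes p: "1 \<le> p" and K: "integrable lborel K" and K0: "\<And>y. 0 \<le> K y"
    and ft: "\<And>\<xi>. (LBINT x. of_real (K x) * plane_wave \<xi> x) = of_real (h \<xi>)"
  shows "Lp_multiplier p h"
proof -
  note [measurable] = borel_measurable_integrable[OF K]
  have "h = (\<lambda>\<xi>. Re (LBINT x. of_real (K x) * plane_wave \<xi> x))" by (simp add: ft)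
  then have hm[measurable]: "h \<in> borel_measurable borel" by simp
  define k where "k = (LBINT y. K y)"
  have k0: "0 \<le> k" using K0 by (simp add: k_def)
  have hb: "\<bar>h \<xi>\<bar> \<le> k" for \<xi>
  proof -
    have "norm (complex_of_real (h \<xi>)) \<le> (LBINT x. norm (of_real (K x) * plane_wave \<xi> x))"
      unfolding ft[symmetric] by (rule integral_norm_bound)
    then show ?thesis using K0 by (simp add: norm_mult k_def)
  qed
  have conv: "inv_fourier (h \<odot> \<psi>) z = (LBINT y. of_real (K y) * inv_fourier \<psi> (z + y))"
    if \<psi>: "\<psi> \<in> tests" for \<psi> z
  proof -
    note [measurable] = testsD(3)[OF \<psi>]
    have int: "integrable (lborel \<Otimes>\<^sub>M lborel) (\<lambda>(y,\<xi>). of_real (K y) * (\<psi> \<xi> * plane_wave (z + y) \<xi>))"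
    proof (rule lborel_pair.Fubini_integrable)
      show "AE y in lborel. integrable lborel (\<lambda>\<xi>. case (y,\<xi>) of (y,\<xi>) \<Rightarrow> of_real (K y) * (\<psi> \<xi> * plane_wave (z + y) \<xi>))"
        unfolding prod.case by (intro AE_I2 integrable_mult_right integrable_mult_plane_wave testsD(1)[OF \<psi>])
    qed (use K testsD(1)[OF \<psi>] in \<open>simp_all add: norm_mult\<close>)
    have "(LBINT y. of_real (K y) * inv_fourier \<psi> (z + y)) = (LBINT y. LBINT \<xi>. of_real (K y) * (\<psi> \<xi> * plane_wave (z + y) \<xi>))"
      by (simp add: inv_fourier_eq)
    also have "\<dots> = (LBINT \<xi>. LBINT y. of_real (K y) * (\<psi> \<xi> * plane_wave (z + y) \<xi>))"
      using lborel_pair.Fubini_integral[OF int] by simp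
    also have "\<dots> = (LBINT \<xi>. (of_real (h \<xi>) * \<psi> \<xi>) * plane_wave z \<xi>)"
    proof (intro Bochner_Integration.integral_cong refl)
      fix \<xi>
      have e: "of_real (K y) * (\<psi> \<xi> * plane_wave (z + y) \<xi>) = (\<psi> \<xi> * plane_wave z \<xi>) * (of_real (K y) * plane_wave \<xi> y)" for y
        by (simp add: plane_wave_add plane_wave_commute[of y \<xi>])
      show "(LBINT y. of_real (K y) * (\<psi> \<xi> * plane_wave (z + y) \<xi>)) = (of_real (h \<xi>) * \<psi> \<xi>) * plane_wave z \<xi>"
        unfolding e by (simp add: ft)
    qed
    also have "\<dots> = inv_fourier (h \<odot> \<psi>) z" by (subst inv_fourier_eq) auto
    finally show ?thesis ..
  qed
  show ?thesis
  proof (rule Lp_multiplierI[where C=k and T="\<lambda>v x. LBINT y. of_real (K y) * v (x - y)"])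
    fix \<psi> :: "real^'n \<Rightarrow> complex" assume \<psi>: "\<psi> \<in> tests"
    note [measurable] = testsD(3)[OF \<psi>]
    have "integrable lborel (h \<odot> \<psi>)"
      by (rule Bochner_Integration.integrable_bound[where f="\<lambda>\<xi>. k * norm (\<psi> \<xi>)"])
         (use testsD(1)[OF \<psi>] hb k0 in \<open>auto simp: norm_mult intro!: AE_I2 mult_right_mono\<close>)
    moreover have "integrable lborel (inv_fourier (h \<odot> \<psi>))"
      using lborel_pair.integrable_snd[OF reflected_product_integrable[OF K K0 testsD(2)[OF \<psi>]]] unfolding conv[OF \<psi>, symmetric] .
    ultimately show "(h \<odot> \<psi>) \<in> tests" by (simp add: tests_def)
    fix v :: "real^'n \<Rightarrow> complex" assume v: "v \<in> Lp_borel p"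
    show "(LBINT x. (LBINT y. of_real (K y) * v (x - y)) * inv_fourier \<psi> x)
       = \<langle>v, h \<odot> \<psi>\<rangle>"
      unfolding conv[OF \<psi>]
      by (rule Lp_convolution_adjoint[OF p K K0 v testsD(2)[OF \<psi>] norm_inv_fourier_le[OF testsD(1)[OF \<psi>]]])
  next
    fix v :: "real^'n \<Rightarrow> complex" assume v: "v \<in> Lp_borel p"
    note [measurable] = Lp_borel_measurable[OF v]
    show "(\<lambda>x. LBINT y. of_real (K y) * v (x - y)) \<in> Lp_borel p"
      "Lp_norm p (\<lambda>x. LBINT y. of_real (K y) * v (x - y)) \<le> k * Lp_norm p v"
      using Lp_convolution[OF p K K0 v] by (auto simp: k_def)
    fix c assume c: "AE x in lborel. v x = c"
    have "(LBINT y. of_real (K y) * v (x - y)) = (LBINT y. of_real (K y) * c)" for x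
    proof (rule integral_cong_AE)
      have "AE y in lborel. v (x + (-1) *\<^sub>R y) = c" by (rule lborel_AE_affine[OF _ _ c]) auto
      then show "AE y in lborel. of_real (K y) * v (x - y) = of_real (K y) * c" by eventually_elim simp
    qed auto
    then show "\<exists>c. AE x in lborel. (LBINT y. of_real (K y) * v (x - y)) = c" by auto
  qed (rule k0)
qed

section \<open>Laplace transforms in the squared frequency\<close>

text \<open>
  \<open>h\<close> is the Laplace transform of the density \<open>\<kappa>\<close> on the positive half-line. The requirement at
  \<open>r = 0\<close> says that the total mass is finite.
\<close>

definition laplace :: "(real \<Rightarrow> ennreal) \<Rightarrow> (real \<Rightarrow> real) \<Rightarrow> bool" where
  "laplace \<kappa> h \<longleftrightarrow> \<kappa> \<in> borel_measurable borel \<and>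
     (\<forall>r\<ge>0. 0 \<le> h r \<and> (\<integral>\<^sup>+\<tau>. \<kappa> \<tau> * ennreal (exp (- (r * \<tau>))) * indicator {0<..} \<tau> \<partial>lborel) = ennreal (h r))"

text \<open>
  The kernel is the superposition of heat kernels at times \<open>\<tau>\<close> with weight \<open>\<kappa> \<tau>\<close>. It is positive
  and its integral is the total mass \<open>h 0\<close>.
\<close>

lemma Lp_multiplier_laplace:
  assumes p: "1 \<le> p" and L: "laplace \<kappa> h"
  shows "Lp_multiplier p (\<lambda>\<xi>::real^'n. h (4 * pi\<^sup>2 * (norm \<xi>)\<^sup>2))"
proof -
  have [measurable]: "\<kappa> \<in> borel_measurable borel" using L by (simp add: laplace_def)
  define N where "N = density lborel (\<lambda>\<tau>. \<kappa> \<tau> * indicator {0<..} \<tau>)"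
  have sN[measurable_cong]: "sets N = sets borel" by (simp add: N_def)
  have nnN: "(\<integral>\<^sup>+\<tau>. ennreal (exp (- (r * \<tau>))) \<partial>N) = ennreal (h r)" if "0 \<le> r" for r
  proof -
    have "(\<integral>\<^sup>+\<tau>. ennreal (exp (- (r * \<tau>))) \<partial>N) = (\<integral>\<^sup>+\<tau>. (\<kappa> \<tau> * indicator {0<..} \<tau>) * ennreal (exp (- (r * \<tau>))) \<partial>lborel)"
      unfolding N_def by (rule nn_integral_density) measurable
    also have "\<dots> = (\<integral>\<^sup>+\<tau>. \<kappa> \<tau> * ennreal (exp (- (r * \<tau>))) * indicator {0<..} \<tau> \<partial>lborel)"
      by (intro nn_integral_cong) (simp only: mult.assoc mult.commute[of "indicator {0<..} _"])
    also have "\<dots> = ennreal (h r)" using L that by (simp only: laplace_def)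
    finally show ?thesis .
  qed
  have "emeasure N (space N) = ennreal (h 0)"
    using nnN[of 0] by simp
  then interpret N: finite_measure N by (intro finite_measureI) auto
  interpret P: pair_sigma_finite N "lborel :: (real^'n) measure" by standard
  have pos: "AE \<tau> in N. 0 < \<tau>"
    unfolding N_def by (subst AE_density) (auto simp: indicator_def)
  have Nexp: "(\<integral>\<tau>. exp (- (r * \<tau>)) \<partial>N) = h r" if "0 \<le> r" for r
  proof -
    have "(\<integral>\<tau>. exp (- (r * \<tau>)) \<partial>N) = enn2real (\<integral>\<^sup>+\<tau>. ennreal (exp (- (r * \<tau>))) \<partial>N)"
      by (rule integral_eq_nn_integral) auto
    then show ?thesis using L that unfolding nnN[OF that] laplace_def by simp
  qed
  have int0: "integrable (N \<Otimes>\<^sub>M lborel) (\<lambda>(\<tau>,x::real^'n). heat \<tau> x)"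
  proof (rule P.Fubini_integrable)
    show "integrable N (\<lambda>\<tau>. LBINT x. norm (case (\<tau>,x::real^'n) of (\<tau>,x) \<Rightarrow> heat \<tau> x))"
    proof (subst integrable_cong_AE[where g="\<lambda>_. 1::real"])
      show "AE \<tau> in N. (LBINT x. norm (case (\<tau>,x::real^'n) of (\<tau>,x) \<Rightarrow> heat \<tau> x)) = 1"
        using pos by eventually_elim (simp add: heat_integral)
    qed auto
    show "AE \<tau> in N. integrable lborel (\<lambda>x::real^'n. case (\<tau>,x) of (\<tau>,x) \<Rightarrow> heat \<tau> x)"
      using pos by eventually_elim (simp add: heat_integrable)
  qed measurable
  define K where "K = (\<lambda>x::real^'n. \<integral>\<tau>. heat \<tau> x \<partial>N)"
  have K: "integrable lborel K" unfolding K_def by (rule P.integrable_snd[OF int0])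
  have K0: "0 \<le> K x" for x unfolding K_def by (intro integral_nonneg_AE) simp
  show ?thesis
  proof (rule Lp_multiplier_kernel[OF p K K0])
    fix \<xi> :: "real^'n"
    have int: "integrable (N \<Otimes>\<^sub>M lborel) (\<lambda>(\<tau>,x). of_real (heat \<tau> x) * plane_wave \<xi> x)"
      by (rule Bochner_Integration.integrable_bound[OF int0]) (auto simp: norm_mult)
    have "(LBINT x. of_real (K x) * plane_wave \<xi> x) = (LBINT x. \<integral>\<tau>. of_real (heat \<tau> x) * plane_wave \<xi> x \<partial>N)"
      unfolding K_def by (simp add: integral_complex_of_real[symmetric] del: integral_complex_of_real)
    also have "\<dots> = (\<integral>\<tau>. \<integral>x. of_real (heat \<tau> x) * plane_wave \<xi> x \<partial>lborel \<partial>N)"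
      by (rule P.Fubini_integral[OF int])
    also have "\<dots> = (\<integral>\<tau>. complex_of_real (exp (- ((4 * pi\<^sup>2 * (norm \<xi>)\<^sup>2) * \<tau>))) \<partial>N)"
    proof (rule integral_cong_AE)
      show "AE \<tau> in N. (LBINT x. of_real (heat \<tau> x) * plane_wave \<xi> x) = complex_of_real (exp (- ((4 * pi\<^sup>2 * (norm \<xi>)\<^sup>2) * \<tau>)))"
        using pos
      proof eventually_elim
        case (elim \<tau>)
        show ?case unfolding heat_fourier(2)[OF elim] by (simp add: mult_ac)
      qed
    qed measurable
    also have "\<dots> = of_real (h (4 * pi\<^sup>2 * (norm \<xi>)\<^sup>2))"
      by (simp only: integral_complex_of_real) (simp add: Nexp)
    finally show "(LBINT x. of_real (K x) * plane_wave \<xi> x) = of_real (h (4 * pi\<^sup>2 * (norm \<xi>)\<^sup>2))" .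
  qed
qed

lemma nn_integral_gamma:
  assumes a: "0 < a" and \<rho>: "0 < \<rho>"
  shows "(\<integral>\<^sup>+\<tau>. ennreal (\<tau> powr (a - 1) * exp (- (\<rho> * \<tau>))) * indicator {0<..} \<tau> \<partial>lborel) = ennreal (Gamma a * \<rho> powr (- a))"
proof -
  let ?I = "\<integral>\<^sup>+\<tau>. ennreal (\<tau> powr (a - 1) * exp (- (\<rho> * \<tau>))) * indicator {0<..} \<tau> \<partial>lborel"
  have "ennreal (Gamma a) = (\<integral>\<^sup>+t. ennreal (indicator {0..} t * t powr (a - 1) / exp t) \<partial>lborel)"
    by (rule Gamma_conv_nn_integral_real[OF a])
  also have "\<dots> = ennreal \<bar>\<rho>\<bar> * (\<integral>\<^sup>+\<tau>. ennreal (indicator {0..} (0 + \<rho> * \<tau>) * (0 + \<rho> * \<tau>) powr (a - 1) / exp (0 + \<rho> * \<tau>)) \<partial>lborel)"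
    using \<rho> by (intro nn_integral_real_affine) auto
  also have "(\<integral>\<^sup>+\<tau>. ennreal (indicator {0..} (0 + \<rho> * \<tau>) * (0 + \<rho> * \<tau>) powr (a - 1) / exp (0 + \<rho> * \<tau>)) \<partial>lborel)
      = (\<integral>\<^sup>+\<tau>. ennreal (\<rho> powr (a - 1)) * (ennreal (\<tau> powr (a - 1) * exp (- (\<rho> * \<tau>))) * indicator {0<..} \<tau>) \<partial>lborel)"
  proof (rule nn_integral_cong)
    fix \<tau> :: real
    consider "\<tau> < 0" | "\<tau> = 0" | "0 < \<tau>" by linarith
    then show "ennreal (indicator {0..} (0 + \<rho> * \<tau>) * (0 + \<rho> * \<tau>) powr (a - 1) / exp (0 + \<rho> * \<tau>))
       = ennreal (\<rho> powr (a - 1)) * (ennreal (\<tau> powr (a - 1) * exp (- (\<rho> * \<tau>))) * indicator {0<..} \<tau>)"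
    proof cases
      case 1
      then have "\<rho> * \<tau> < 0" using \<rho> by (simp add: mult_pos_neg)
      then show ?thesis using 1 by (simp add: indicator_def)
    next
      case 2 then show ?thesis by simp
    next
      case 3
      then have "0 < \<rho> * \<tau>" using \<rho> by simp
      then have "indicator {0..} (0 + \<rho> * \<tau>) * (0 + \<rho> * \<tau>) powr (a - 1) / exp (0 + \<rho> * \<tau>)
         = \<rho> powr (a - 1) * (\<tau> powr (a - 1) * exp (- (\<rho> * \<tau>)))"
        using 3 \<rho> by (simp add: powr_mult exp_minus divide_inverse mult.assoc)
      then show ?thesis using 3 by (simp add: ennreal_mult')
    qed
  qed
  also have "\<dots> = ennreal (\<rho> powr (a - 1)) * ?I" by (rule nn_integral_cmult) measurable
  finally have "ennreal (Gamma a) = ennreal (\<rho> * \<rho> powr (a - 1)) * ?I"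
    using \<rho> by (simp add: ennreal_mult' mult.assoc)
  also have "\<rho> * \<rho> powr (a - 1) = \<rho> powr a" using \<rho> by (simp add: powr_diff)
  finally have G: "ennreal (Gamma a) = ennreal (\<rho> powr a) * ?I" .
  have "ennreal (\<rho> powr (- a)) * ennreal (Gamma a) = ennreal (\<rho> powr (- a)) * (ennreal (\<rho> powr a) * ?I)"
    unfolding G ..
  also have "\<dots> = ennreal (\<rho> powr (- a) * \<rho> powr a) * ?I"
    by (simp add: ennreal_mult' mult.assoc)
  also have "\<rho> powr (- a) * \<rho> powr a = 1" using \<rho> by (simp add: powr_add[symmetric])
  finally have "?I = ennreal (\<rho> powr (- a)) * ennreal (Gamma a)" by simp
  also have "\<dots> = ennreal (Gamma a * \<rho> powr (- a))"
    by (subst mult.commute) (simp add: ennreal_mult')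
  finally show ?thesis .
qed

lemma nn_integral_exp:
  assumes c: "0 < c"
  shows "(\<integral>\<^sup>+t. ennreal (exp (- (c * t))) * indicator {0<..} t \<partial>lborel) = ennreal (1 / c)"
proof -
  have "(\<integral>\<^sup>+t. ennreal (exp (- (c * t))) * indicator {0<..} t \<partial>lborel)
     = (\<integral>\<^sup>+t. ennreal (t powr (1 - 1) * exp (- (c * t))) * indicator {0<..} t \<partial>lborel)"
    by (intro nn_integral_cong) (auto simp: indicator_def)
  also have "\<dots> = ennreal (1 / c)"
    using nn_integral_gamma[of 1 c] c by (simp add: powr_minus inverse_eq_divide)
  finally show ?thesis .
qed

lemma rGamma_real_nonneg: "0 < a \<Longrightarrow> 0 \<le> rGamma (a::real)"
  using Gamma_real_pos[of a] by (simp add: rGamma_inverse_Gamma)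

text \<open>
  The gamma density, whose Laplace transform is \<open>(lam + r) powr (- a)\<close>. Writing it with the entire
  function \<open>rGamma\<close> instead of dividing by \<open>Gamma\<close> makes it measurable jointly in \<open>a\<close> and \<open>\<tau>\<close>.
\<close>

definition power_density :: "real \<Rightarrow> real \<Rightarrow> real \<Rightarrow> ennreal" where
  "power_density lam a \<tau> = ennreal (\<tau> powr (a - 1) * exp (- (lam * \<tau>)) * rGamma a)"

lemma power_density_measurable [measurable]: "(\<lambda>(a, \<tau>). power_density lam a \<tau>) \<in> borel_measurable (borel \<Otimes>\<^sub>M borel)"
proof -
  have [measurable]: "(rGamma :: real \<Rightarrow> real) \<in> borel_measurable borel"
    by (intro borel_measurable_continuous_onI continuous_on_rGamma)
  show ?thesis unfolding power_density_def by measurable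
qed

lemma nn_integral_power_density:
  assumes a: "0 < a" and lam: "0 < lam" and r: "0 \<le> r"
  shows "(\<integral>\<^sup>+\<tau>. power_density lam a \<tau> * ennreal (exp (- (r * \<tau>))) * indicator {0<..} \<tau> \<partial>lborel) = ennreal ((lam + r) powr (- a))"
proof -
  have G: "0 < Gamma a" using a by (rule Gamma_real_pos)
  have "(\<integral>\<^sup>+\<tau>. power_density lam a \<tau> * ennreal (exp (- (r * \<tau>))) * indicator {0<..} \<tau> \<partial>lborel)
     = (\<integral>\<^sup>+\<tau>. ennreal (rGamma a) * (ennreal (\<tau> powr (a - 1) * exp (- ((lam + r) * \<tau>))) * indicator {0<..} \<tau>) \<partial>lborel)"
  proof (rule nn_integral_cong)
    fix \<tau> :: real
    have "exp (- ((lam + r) * \<tau>)) = exp (- (lam * \<tau>)) * exp (- (r * \<tau>))"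
      by (simp add: exp_add[symmetric] algebra_simps)
    then have e: "\<tau> powr (a - 1) * exp (- (lam * \<tau>)) * rGamma a * exp (- (r * \<tau>)) = rGamma a * (\<tau> powr (a - 1) * exp (- ((lam + r) * \<tau>)))"
      by (simp only: mult_ac)
    have "power_density lam a \<tau> * ennreal (exp (- (r * \<tau>)))
       = ennreal (\<tau> powr (a - 1) * exp (- (lam * \<tau>)) * rGamma a * exp (- (r * \<tau>)))"
      unfolding power_density_def by (rule ennreal_mult''[symmetric]) simp
    also have "\<dots> = ennreal (rGamma a) * ennreal (\<tau> powr (a - 1) * exp (- ((lam + r) * \<tau>)))"
      unfolding e by (rule ennreal_mult'[OF rGamma_real_nonneg[OF a]])
    finally show "power_density lam a \<tau> * ennreal (exp (- (r * \<tau>))) * indicator {0<..} \<tau>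
       = ennreal (rGamma a) * (ennreal (\<tau> powr (a - 1) * exp (- ((lam + r) * \<tau>))) * indicator {0<..} \<tau>)"
      by (simp only: mult.assoc)
  qed
  also have "\<dots> = ennreal (rGamma a) * ennreal (Gamma a * (lam + r) powr (- a))"
    using a lam r by (subst nn_integral_cmult) (auto simp: nn_integral_gamma)
  also have "\<dots> = ennreal (rGamma a * (Gamma a * (lam + r) powr (- a)))"
    using rGamma_real_nonneg[OF a] by (simp add: ennreal_mult')
  also have "rGamma a * (Gamma a * (lam + r) powr (- a)) = (lam + r) powr (- a)"
    using G by (simp add: rGamma_inverse_Gamma)
  finally show ?thesis .
qed

lemma laplace_resolvent_power:
  assumes "0 < a" "0 < lam"
  shows "laplace (power_density lam a) (\<lambda>r. (lam + r) powr (- a))"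
  unfolding laplace_def
proof (intro conjI allI impI)
  show "power_density lam a \<in> borel_measurable borel"
    using measurable_compose_Pair1[OF _ power_density_measurable, of a lam] by simp
qed (use assms nn_integral_power_density in auto)

text \<open>
  \<open>1 / ln \<rho>\<close> is the integral of \<open>\<rho>^(-t)\<close> over \<open>t > 0\<close>. It converges because \<open>\<rho> \<ge> lam > 1\<close>.
\<close>

lemma laplace_inverse_ln:
  assumes lam: "1 < lam"
  shows "laplace (\<lambda>\<tau>. \<integral>\<^sup>+t. power_density lam t \<tau> * indicator {0<..} t \<partial>lborel) (\<lambda>r. 1 / ln (lam + r))"
  unfolding laplace_def
proof (intro conjI allI impI)
  show "(\<lambda>\<tau>. \<integral>\<^sup>+t. power_density lam t \<tau> * indicator {0<..} t \<partial>lborel) \<in> borel_measurable borel" by measurable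
  fix r :: real assume r: "0 \<le> r"
  have lnp: "0 < ln (lam + r)" using lam r by simp
  then show "0 \<le> 1 / ln (lam + r)" by simp
  have "(\<integral>\<^sup>+\<tau>. (\<integral>\<^sup>+t. power_density lam t \<tau> * indicator {0<..} t \<partial>lborel) * ennreal (exp (- (r * \<tau>))) * indicator {0<..} \<tau> \<partial>lborel)
     = (\<integral>\<^sup>+\<tau>. \<integral>\<^sup>+t. (power_density lam t \<tau> * ennreal (exp (- (r * \<tau>))) * indicator {0<..} \<tau>) * indicator {0<..} t \<partial>lborel \<partial>lborel)"
    by (subst nn_integral_multc[symmetric], measurable)+ (simp add: mult_ac)
  also have "\<dots> = (\<integral>\<^sup>+t. \<integral>\<^sup>+\<tau>. (power_density lam t \<tau> * ennreal (exp (- (r * \<tau>))) * indicator {0<..} \<tau>) * indicator {0<..} t \<partial>lborel \<partial>lborel)"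
    by (rule lborel_pair.Fubini') measurable
  also have "\<dots> = (\<integral>\<^sup>+t. ennreal (exp (- (ln (lam + r) * t))) * indicator {0<..} t \<partial>lborel)"
  proof (rule nn_integral_cong)
    fix t :: real
    show "(\<integral>\<^sup>+\<tau>. (power_density lam t \<tau> * ennreal (exp (- (r * \<tau>))) * indicator {0<..} \<tau>) * indicator {0<..} t \<partial>lborel)
       = ennreal (exp (- (ln (lam + r) * t))) * indicator {0<..} t"
    proof (cases "0 < t")
      case True
      then show ?thesis
        using nn_integral_power_density[OF True _ r, of lam] lam r by (simp add: powr_def mult.commute)
    qed simp
  qed
  also have "\<dots> = ennreal (1 / ln (lam + r))" by (rule nn_integral_exp[OF lnp])
  finally show "(\<integral>\<^sup>+\<tau>. (\<integral>\<^sup>+t. power_density lam t \<tau> * indicator {0<..} t \<partial>lborel) * ennreal (exp (- (r * \<tau>))) * indicator {0<..} \<tau> \<partial>lborel)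
     = ennreal (1 / ln (lam + r))" .
qed

lemma nn_integral_ln_quotient:
  assumes \<rho>: "1 < \<rho>"
  shows "(\<integral>\<^sup>+t. ennreal (1 / ((1 + t) * (\<rho> + t))) * indicator {0<..} t \<partial>lborel) = ennreal (ln \<rho> / (\<rho> - 1))"
proof -
  let ?F = "\<lambda>t. ln ((1 + t) / (\<rho> + t)) / (\<rho> - 1)"
  have "(\<integral>\<^sup>+t. ennreal (1 / ((1 + t) * (\<rho> + t))) * indicator {0<..} t \<partial>lborel)
     = (\<integral>\<^sup>+t. ennreal (1 / ((1 + t) * (\<rho> + t))) * indicator {0..} t \<partial>lborel)"
  proof (rule nn_integral_cong_AE)
    show "AE t in lborel. ennreal (1 / ((1 + t) * (\<rho> + t))) * indicator {0<..} t = ennreal (1 / ((1 + t) * (\<rho> + t))) * indicator {0..} t"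
      using AE_lborel_singleton[of "0::real"] by eventually_elim (auto simp: indicator_def)
  qed
  also have "\<dots> = ennreal (0 - ?F 0)"
  proof (rule nn_integral_FTC_atLeast)
    show "(\<lambda>t. 1 / ((1 + t) * (\<rho> + t))) \<in> borel_measurable borel" by measurable
    show "(?F has_real_derivative 1 / ((1 + t) * (\<rho> + t))) (at t)" if "0 \<le> t" for t
    proof -
      have pos: "0 < 1 + t" "0 < \<rho> + t" "0 < \<rho> - 1" using that \<rho> by auto
      have "((\<lambda>t. (ln (1 + t) - ln (\<rho> + t)) / (\<rho> - 1)) has_real_derivative (1 / (1 + t) - 1 / (\<rho> + t)) / (\<rho> - 1)) (at t)"
        using pos by (auto intro!: derivative_eq_intros)
      moreover have "(1 / (1 + t) - 1 / (\<rho> + t)) / (\<rho> - 1) = 1 / ((1 + t) * (\<rho> + t))"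
        using pos by (simp add: divide_simps)
      ultimately have D: "((\<lambda>t. (ln (1 + t) - ln (\<rho> + t)) / (\<rho> - 1)) has_real_derivative 1 / ((1 + t) * (\<rho> + t))) (at t)"
        by (simp only:)
      show ?thesis
      proof (rule has_field_derivative_transform_within_open[OF D, of "{-1<..}"])
        fix u :: real assume "u \<in> {-1<..}"
        then show "(ln (1 + u) - ln (\<rho> + u)) / (\<rho> - 1) = ?F u" using \<rho> by (simp add: ln_div)
      qed (use that in auto)
    qed
    show "(?F \<longlongrightarrow> 0) at_top" using \<rho> by real_asymp
    show "0 \<le> 1 / ((1 + t) * (\<rho> + t))" if "0 \<le> t" for t using that \<rho> by simp
  qed
  also have "0 - ?F 0 = ln \<rho> / (\<rho> - 1)" using \<rho> by (simp add: ln_div)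
  finally show ?thesis .
qed

text \<open>
  \<open>ln \<rho> / (\<rho> - 1)\<close> is the integral of \<open>1 / ((1+t)(\<rho>+t))\<close> over \<open>t > 0\<close>, and \<open>1/(\<rho>+t)\<close> is the
  Laplace transform of an exponential.
\<close>

lemma laplace_ln_quotient:
  assumes lam: "1 < lam"
  shows "laplace (\<lambda>\<tau>. \<integral>\<^sup>+t. ennreal (exp (- ((lam + t) * \<tau>)) / (1 + t)) * indicator {0<..} t \<partial>lborel)
     (\<lambda>r. ln (lam + r) / (lam + r - 1))"
  unfolding laplace_def
proof (intro conjI allI impI)
  show "(\<lambda>\<tau>. \<integral>\<^sup>+t. ennreal (exp (- ((lam + t) * \<tau>)) / (1 + t)) * indicator {0<..} t \<partial>lborel) \<in> borel_measurable borel" by measurable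
  fix r :: real assume r: "0 \<le> r"
  show "0 \<le> ln (lam + r) / (lam + r - 1)" using lam r by simp
  have "(\<integral>\<^sup>+\<tau>. (\<integral>\<^sup>+t. ennreal (exp (- ((lam + t) * \<tau>)) / (1 + t)) * indicator {0<..} t \<partial>lborel) * ennreal (exp (- (r * \<tau>))) * indicator {0<..} \<tau> \<partial>lborel)
     = (\<integral>\<^sup>+\<tau>. \<integral>\<^sup>+t. (ennreal (exp (- ((lam + t) * \<tau>)) / (1 + t)) * ennreal (exp (- (r * \<tau>))) * indicator {0<..} \<tau>) * indicator {0<..} t \<partial>lborel \<partial>lborel)"
    by (subst nn_integral_multc[symmetric], measurable)+ (simp add: mult_ac)
  also have "\<dots> = (\<integral>\<^sup>+t. \<integral>\<^sup>+\<tau>. (ennreal (exp (- ((lam + t) * \<tau>)) / (1 + t)) * ennreal (exp (- (r * \<tau>))) * indicator {0<..} \<tau>) * indicator {0<..} t \<partial>lborel \<partial>lborel)"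
    by (rule lborel_pair.Fubini') measurable
  also have "\<dots> = (\<integral>\<^sup>+t. ennreal (1 / ((1 + t) * (lam + r + t))) * indicator {0<..} t \<partial>lborel)"
  proof (rule nn_integral_cong)
    fix t :: real
    show "(\<integral>\<^sup>+\<tau>. (ennreal (exp (- ((lam + t) * \<tau>)) / (1 + t)) * ennreal (exp (- (r * \<tau>))) * indicator {0<..} \<tau>) * indicator {0<..} t \<partial>lborel)
       = ennreal (1 / ((1 + t) * (lam + r + t))) * indicator {0<..} t"
    proof (cases "0 < t")
      case True
      have e: "ennreal (exp (- ((lam + t) * \<tau>)) / (1 + t)) * ennreal (exp (- (r * \<tau>))) * indicator {0<..} \<tau>
         = ennreal (1 / (1 + t)) * (ennreal (exp (- ((lam + r + t) * \<tau>))) * indicator {0<..} \<tau>)" for \<tau> :: real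
      proof -
        have "exp (- ((lam + t) * \<tau>)) / (1 + t) * exp (- (r * \<tau>)) = 1 / (1 + t) * exp (- ((lam + r + t) * \<tau>))"
          by (simp add: exp_add[symmetric] algebra_simps)
        then show ?thesis using True by (simp add: ennreal_mult'[symmetric] mult.assoc[symmetric])
      qed
      have "(\<integral>\<^sup>+\<tau>. ennreal (exp (- ((lam + t) * \<tau>)) / (1 + t)) * ennreal (exp (- (r * \<tau>))) * indicator {0<..} \<tau> \<partial>lborel)
         = ennreal (1 / (1 + t)) * ennreal (1 / (lam + r + t))"
        unfolding e using True lam r by (subst nn_integral_cmult) (auto simp: nn_integral_exp)
      then show ?thesis using True lam r by (simp add: ennreal_mult'[symmetric])
    qed simp
  qed
  also have "\<dots> = ennreal (ln (lam + r) / (lam + r - 1))" using lam r by (intro nn_integral_ln_quotient) simp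
  finally show "(\<integral>\<^sup>+\<tau>. (\<integral>\<^sup>+t. ennreal (exp (- ((lam + t) * \<tau>)) / (1 + t)) * indicator {0<..} t \<partial>lborel) * ennreal (exp (- (r * \<tau>))) * indicator {0<..} \<tau> \<partial>lborel)
     = ennreal (ln (lam + r) / (lam + r - 1))" .
qed

lemma laplace_power_series:
  fixes c :: "nat \<Rightarrow> real"
  assumes lam: "0 < lam" and c: "\<And>k. 0 \<le> c k" and s: "summable c"
  shows "laplace (\<lambda>\<tau>. \<Sum>k. ennreal (c k * lam ^ Suc k) * power_density lam (real (Suc k)) \<tau>)
     (\<lambda>r. \<Sum>k. c k * (lam / (lam + r)) ^ Suc k)"
  unfolding laplace_def
proof (intro conjI allI impI)
  have [measurable]: "power_density lam a \<in> borel_measurable borel" for a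
    using measurable_compose_Pair1[OF _ power_density_measurable, of a lam] by simp
  show "(\<lambda>\<tau>. \<Sum>k. ennreal (c k * lam ^ Suc k) * power_density lam (real (Suc k)) \<tau>) \<in> borel_measurable borel" by measurable
  fix r :: real assume r: "0 \<le> r"
  have w: "0 \<le> lam / (lam + r)" "lam / (lam + r) \<le> 1" using lam r by auto
  have s2: "summable (\<lambda>k. c k * (lam / (lam + r)) ^ Suc k)"
  proof (rule summable_comparison_test'[OF s, of 0])
    fix k
    have "c k * (lam / (lam + r)) ^ Suc k \<le> c k * 1"
      using power_le_one[OF w, of "Suc k"] c by (intro mult_left_mono)
    moreover have "0 \<le> c k * (lam / (lam + r)) ^ Suc k" by (intro mult_nonneg_nonneg zero_le_power c w)
    ultimately show "norm (c k * (lam / (lam + r)) ^ Suc k) \<le> c k" by (simp only: real_norm_def abs_of_nonneg mult_1_right)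
  qed
  show "0 \<le> (\<Sum>k. c k * (lam / (lam + r)) ^ Suc k)" by (intro suminf_nonneg[OF s2] mult_nonneg_nonneg zero_le_power c w)
  have "(\<integral>\<^sup>+\<tau>. (\<Sum>k. ennreal (c k * lam ^ Suc k) * power_density lam (real (Suc k)) \<tau>) * ennreal (exp (- (r * \<tau>))) * indicator {0<..} \<tau> \<partial>lborel)
     = (\<integral>\<^sup>+\<tau>. (\<Sum>k. ennreal (c k * lam ^ Suc k) * (power_density lam (real (Suc k)) \<tau> * ennreal (exp (- (r * \<tau>))) * indicator {0<..} \<tau>)) \<partial>lborel)"
    by (simp only: ennreal_suminf_multc[symmetric] mult.assoc)
  also have "\<dots> = (\<Sum>k. \<integral>\<^sup>+\<tau>. ennreal (c k * lam ^ Suc k) * (power_density lam (real (Suc k)) \<tau> * ennreal (exp (- (r * \<tau>))) * indicator {0<..} \<tau>) \<partial>lborel)"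
    by (rule nn_integral_suminf) measurable
  also have "\<dots> = (\<Sum>k. ennreal (c k * (lam / (lam + r)) ^ Suc k))"
  proof (rule suminf_cong)
    fix k
    have "(\<integral>\<^sup>+\<tau>. ennreal (c k * lam ^ Suc k) * (power_density lam (real (Suc k)) \<tau> * ennreal (exp (- (r * \<tau>))) * indicator {0<..} \<tau>) \<partial>lborel)
       = ennreal (c k * lam ^ Suc k) * ennreal ((lam + r) powr (- real (Suc k)))"
      using lam r by (subst nn_integral_cmult) (auto simp: nn_integral_power_density simp del: of_nat_Suc)
    also have "\<dots> = ennreal (c k * lam ^ Suc k * (lam + r) powr (- real (Suc k)))"
      using c lam by (intro ennreal_mult'[symmetric]) auto
    also have "c k * lam ^ Suc k * (lam + r) powr (- real (Suc k)) = c k * (lam / (lam + r)) ^ Suc k"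
    proof -
      have "(lam + r) powr (- real (Suc k)) = inverse ((lam + r) ^ Suc k)"
        using lam r by (simp only: powr_minus) (simp add: powr_realpow del: power_Suc of_nat_Suc)
      then show ?thesis by (simp only: divide_inverse power_mult_distrib power_inverse mult.assoc)
    qed
    finally show "(\<integral>\<^sup>+\<tau>. ennreal (c k * lam ^ Suc k) * (power_density lam (real (Suc k)) \<tau> * ennreal (exp (- (r * \<tau>))) * indicator {0<..} \<tau>) \<partial>lborel)
       = ennreal (c k * (lam / (lam + r)) ^ Suc k)" .
  qed
  also have "\<dots> = ennreal (\<Sum>k. c k * (lam / (lam + r)) ^ Suc k)"
    by (intro suminf_ennreal2 s2 mult_nonneg_nonneg zero_le_power c w)
  finally show "(\<integral>\<^sup>+\<tau>. (\<Sum>k. ennreal (c k * lam ^ Suc k) * power_density lam (real (Suc k)) \<tau>) * ennreal (exp (- (r * \<tau>))) * indicator {0<..} \<tau> \<partial>lborel)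
     = ennreal (\<Sum>k. c k * (lam / (lam + r)) ^ Suc k)" .
qed

section \<open>Symbols built from the resolvent\<close>

definition rho :: "real \<Rightarrow> real^'n \<Rightarrow> real" where
  "rho lam \<xi> = lam + 4 * pi\<^sup>2 * (norm \<xi>)\<^sup>2"

lemma rho_ge: "lam \<le> rho lam \<xi>"
  by (simp add: rho_def)

lemma Lp_multiplier_rho_powr:
  assumes p: "1 \<le> p" and lam: "0 < lam" and a: "0 \<le> a"
  shows "Lp_multiplier p (\<lambda>\<xi>::real^'n. rho lam \<xi> powr (- a))"
proof (cases "a = 0")
  case True
  have "rho lam \<xi> \<noteq> 0" for \<xi> :: "real^'n" using rho_ge[of lam \<xi>] lam by linarith
  then show ?thesis using True Lp_multiplier_const[OF p, of 1] by simp
next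
  case False
  then show ?thesis
    using Lp_multiplier_laplace[OF p laplace_resolvent_power[of a lam]] a lam by (simp add: rho_def)
qed

lemma Lp_multiplier_inverse_rho:
  assumes p: "1 \<le> p" and lam: "0 < lam"
  shows "Lp_multiplier p (\<lambda>\<xi>::real^'n. 1 / rho lam \<xi>)"
proof -
  have "0 < rho lam \<xi>" for \<xi> :: "real^'n" using rho_ge[of lam \<xi>] lam by linarith
  then show ?thesis using Lp_multiplier_rho_powr[OF p lam, of 1, where 'n='n] by (simp add: powr_minus inverse_eq_divide less_imp_le)
qed

lemma Lp_multiplier_inverse_ln_rho:
  assumes p: "1 \<le> p" and lam: "1 < lam"
  shows "Lp_multiplier p (\<lambda>\<xi>::real^'n. 1 / ln (rho lam \<xi>))"
  using Lp_multiplier_laplace[OF p laplace_inverse_ln[OF lam]] by (simp add: rho_def)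

text \<open>
  The Laplace representation is available for \<open>ln \<rho> / (\<rho> - 1)\<close>; the factor \<open>1 - 1/\<rho>\<close> converts it.
\<close>

lemma Lp_multiplier_ln_over_rho:
  assumes p: "1 \<le> p" and lam: "1 < lam"
  shows "Lp_multiplier p (\<lambda>\<xi>::real^'n. ln (rho lam \<xi>) / rho lam \<xi>)"
proof -
  have "Lp_multiplier p (\<lambda>\<xi>::real^'n. (1 - 1 / rho lam \<xi>) * (ln (rho lam \<xi>) / (rho lam \<xi> - 1)))"
    using Lp_multiplier_laplace[OF p laplace_ln_quotient[OF lam], where 'n='n] lam
    by (intro Lp_multiplier_mult Lp_multiplier_diff p Lp_multiplier_const Lp_multiplier_inverse_rho) (auto simp: rho_def)
  moreover have "(1 - 1 / rho lam \<xi>) * (ln (rho lam \<xi>) / (rho lam \<xi> - 1)) = ln (rho lam \<xi>) / rho lam \<xi>" for \<xi> :: "real^'n"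
  proof -
    have "1 < rho lam \<xi>" using rho_ge[of lam \<xi>] lam by linarith
    then show ?thesis by (simp add: divide_simps)
  qed
  ultimately show ?thesis by simp
qed

text \<open>
  Positive and negative coefficients are treated separately, since the kernels are to be positive.
\<close>

lemma Lp_multiplier_power_series:
  fixes c :: "nat \<Rightarrow> real"
  assumes p: "1 \<le> p" and lam: "0 < lam" and s: "summable (\<lambda>k. \<bar>c k\<bar>)"
  shows "Lp_multiplier p (\<lambda>\<xi>::real^'n. \<Sum>k. c k * (lam / rho lam \<xi>) ^ k)"
proof -
  define P where "P = (\<lambda>k. max 0 (c (Suc k)))"
  define M where "M = (\<lambda>k. max 0 (- c (Suc k)))"
  have s1: "summable (\<lambda>k. \<bar>c (Suc k)\<bar>)" by (rule iffD2[OF summable_Suc_iff[of "\<lambda>k. \<bar>c k\<bar>"] s])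
  have sP: "summable P" and sM: "summable M"
    by (rule summable_comparison_test'[OF s1, of 0]; auto simp: P_def M_def)+
  have m: "Lp_multiplier p (\<lambda>\<xi>::real^'n. c 0 + ((\<Sum>k. P k * (lam / rho lam \<xi>) ^ Suc k) - (\<Sum>k. M k * (lam / rho lam \<xi>) ^ Suc k)))"
    using Lp_multiplier_laplace[OF p laplace_power_series[OF lam _ sP], where 'n='n] Lp_multiplier_laplace[OF p laplace_power_series[OF lam _ sM], where 'n='n]
    by (intro Lp_multiplier_add Lp_multiplier_diff p Lp_multiplier_const) (auto simp: rho_def P_def M_def)
  have "(\<Sum>k. c k * (lam / rho lam \<xi>) ^ k) = c 0 + ((\<Sum>k. P k * (lam / rho lam \<xi>) ^ Suc k) - (\<Sum>k. M k * (lam / rho lam \<xi>) ^ Suc k))" for \<xi> :: "real^'n"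
  proof -
    define w where "w = lam / rho lam \<xi>"
    have w: "0 \<le> w" "w \<le> 1" using rho_ge[of lam \<xi>] lam by (auto simp: w_def)
    have wk: "0 \<le> w ^ k" "w ^ k \<le> 1" for k using w by (auto simp: power_le_one)
    have sc: "summable (\<lambda>k. c k * w ^ k)"
      by (rule summable_comparison_test'[OF s, of 0]) (use wk in \<open>auto simp: abs_mult intro!: mult_left_le\<close>)
    have sP': "summable (\<lambda>k. P k * w ^ Suc k)"
      by (rule summable_comparison_test'[OF sP, of 0]) (use wk[of "Suc _"] in \<open>auto simp: P_def abs_mult simp del: power_Suc intro!: mult_left_le\<close>)
    have sM': "summable (\<lambda>k. M k * w ^ Suc k)"
      by (rule summable_comparison_test'[OF sM, of 0]) (use wk[of "Suc _"] in \<open>auto simp: M_def abs_mult simp del: power_Suc intro!: mult_left_le\<close>)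
    have "(\<Sum>k. c k * w ^ k) = c 0 + (\<Sum>k. c (Suc k) * w ^ Suc k)"
      using suminf_split_head[OF sc] by simp
    also have "(\<Sum>k. c (Suc k) * w ^ Suc k) = (\<Sum>k. P k * w ^ Suc k - M k * w ^ Suc k)"
      by (intro suminf_cong) (auto simp: P_def M_def max_def)
    also have "\<dots> = (\<Sum>k. P k * w ^ Suc k) - (\<Sum>k. M k * w ^ Suc k)"
      by (rule suminf_diff[OF sP' sM', symmetric])
    finally show ?thesis by (simp add: w_def)
  qed
  with m show ?thesis by simp
qed

section \<open>Two power series absolutely convergent on the closed unit interval\<close>

text \<open>
  The recurrence of the binomial coefficients \<open>b_k\<close> reads \<open>s |b_k| = k |b_k| - (k+1) |b_(k+1)|\<close>
  once \<open>k \<ge> s\<close>, so the series telescopes.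
\<close>

lemma summable_abs_gbinomial:
  fixes s :: real
  assumes s: "0 < s"
  shows "summable (\<lambda>k. \<bar>s gchoose k\<bar>)"
proof -
  define A where "A = (\<lambda>k. \<bar>s gchoose k\<bar>)"
  obtain K :: nat where K: "s \<le> real K" using real_arch_simple by blast
  have rec: "s * A k = real k * A k - real (Suc k) * A (Suc k)" if "K \<le> k" for k
  proof -
    have "real (Suc k) * (s gchoose Suc k) = - ((real k - s) * (s gchoose k))"
      using gbinomial_mult_1[of s k] by (simp add: algebra_simps)
    then have "real (Suc k) * A (Suc k) = (real k - s) * A k"
      using that K unfolding A_def by (metis abs_minus_cancel abs_mult abs_of_nat abs_of_nonneg diff_ge_0_iff_ge of_nat_le_iff order_trans)
    then show ?thesis by (simp add: algebra_simps)
  qed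
  have "summable (\<lambda>i. A (i + K))"
  proof (rule summableI_nonneg_bounded)
    fix n
    have "s * (\<Sum>i<n. A (i + K)) = (\<Sum>i<n. real (i + K) * A (i + K) - real (Suc (i + K)) * A (Suc (i + K)))"
      by (simp add: sum_distrib_left rec)
    also have "\<dots> = real K * A K - real (n + K) * A (n + K)"
      using sum_lessThan_telescope'[of "\<lambda>i. real (i + K) * A (i + K)" n] by simp
    also have "\<dots> \<le> real K * A K" by (simp add: A_def)
    finally show "(\<Sum>i<n. A (i + K)) \<le> real K * A K / s" using s by (simp add: field_simps)
  qed (simp add: A_def)
  then have "summable A" by (rule iffD1[OF summable_iff_shift])
  then show ?thesis by (simp only: A_def)
qed

lemma one_minus_powr_sums:
  fixes s w :: real
  assumes "0 \<le> w" "w < 1"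
  shows "(\<lambda>k. ((-1) ^ k * (s gchoose k)) * w ^ k) sums (1 - w) powr s"
  using gen_binomial_real[of "-w" s] assms by (simp add: power_minus[of w] mult_ac)

text \<open>
  The factor \<open>1 - w\<close> makes the coefficients absolutely summable: it replaces \<open>1/k\<close> by
  \<open>1/k - 1/(k+1)\<close>.
\<close>

lemma one_minus_ln_sums:
  fixes w :: real
  assumes w: "0 < w" "w < 1"
  shows "(\<lambda>k. (if k = 0 then - 1 else 1 / real k - 1 / real (Suc k)) * w ^ k) sums ((1 - w) * ln (1 - w) / w)"
proof -
  have s: "summable (\<lambda>n. 1 / real (Suc n) * w ^ n)"
    by (rule summable_comparison_test'[of "\<lambda>n. w ^ n" 0]) (use w in \<open>auto simp: summable_geometric divide_le_eq mult_le_cancel_left1\<close>)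
  define L where "L = (\<Sum>n. 1 / real (Suc n) * w ^ n)"
  have L: "(\<lambda>n. 1 / real (Suc n) * w ^ n) sums L" unfolding L_def by (rule summable_sums[OF s])
  have "ln (1 - w) = (\<Sum>n. (-1) ^ n * (1 / real (n + 1)) * (1 - w - 1) ^ Suc n)"
    using w by (intro ln_series) auto
  also have "\<dots> = (\<Sum>n. - w * (1 / real (Suc n) * w ^ n))"
  proof (rule suminf_cong)
    fix n
    have "(-1) ^ n * (1 - w - 1) ^ Suc n = - w * ((-1) ^ n * (- w) ^ n)" by simp
    also have "(-1) ^ n * (- w) ^ n = ((-1) * (- w)) ^ n" by (rule power_mult_distrib[symmetric])
    finally have "(-1) ^ n * (1 - w - 1) ^ Suc n = - w * w ^ n" by simp
    then show "(-1) ^ n * (1 / real (n + 1)) * (1 - w - 1) ^ Suc n = - w * (1 / real (Suc n) * w ^ n)"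
      by (simp add: field_simps)
  qed
  also have "\<dots> = - w * L" unfolding L_def by (rule suminf_mult[OF s])
  finally have ln: "ln (1 - w) = - w * L" .
  have 1: "(\<lambda>k. if k = 0 then 0 else 1 / real k * w ^ k) sums (w * L)"
  proof -
    have "(\<lambda>n. (if Suc n = 0 then 0 else 1 / real (Suc n) * w ^ Suc n)) sums (w * L)"
      using sums_mult[OF L, of w] by (simp add: mult_ac)
    from sums_Suc_imp[OF _ this] show ?thesis by simp
  qed
  have "(\<lambda>k. (if k = 0 then 0 else 1 / real k * w ^ k) - 1 / real (Suc k) * w ^ k) sums (w * L - L)"
    by (rule sums_diff[OF 1 L])
  moreover have "(if k = 0 then 0 else 1 / real k * w ^ k) - 1 / real (Suc k) * w ^ k = (if k = 0 then - 1 else 1 / real k - 1 / real (Suc k)) * w ^ k" for k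
    by (simp add: left_diff_distrib)
  moreover have "w * L - L = (1 - w) * ln (1 - w) / w" using w by (simp add: ln field_simps)
  ultimately show ?thesis by simp
qed

lemma summable_one_minus_ln: "summable (\<lambda>k. \<bar>if k = 0 then - 1 else 1 / real k - 1 / real (Suc k)\<bar>)"
proof -
  have "(\<lambda>n. 1 / real (Suc n) - 1 / real (Suc (Suc n))) sums (1 / real (Suc 0) - 0)"
    using telescope_sums'[OF LIMSEQ_Suc[OF lim_1_over_n]] by simp
  then have "summable (\<lambda>n. \<bar>1 / real (Suc n) - 1 / real (Suc (Suc n))\<bar>)"
    by (simp add: sums_iff frac_le)
  then have "summable (\<lambda>n. \<bar>if Suc n = 0 then - 1 else 1 / real (Suc n) - 1 / real (Suc (Suc n))\<bar>)" by simp
  then show ?thesis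
    by (rule iffD1[OF summable_Suc_iff[of "\<lambda>k. \<bar>if k = 0 then - 1 else 1 / real k - 1 / real (Suc k)\<bar>"]])
qed

section \<open>The a priori estimate\<close>

text \<open>
  Here \<open>1 - w\<sigma> = (1-w)^(s+1) (1 + ln (1-w) / ln \<rho>)\<close> with \<open>w = lam/\<rho>\<close>. Both summands of \<open>1 - w\<sigma>\<close>
  are power series in \<open>w\<close> up to the factor \<open>1/ln \<rho>\<close>, and \<open>w\<sigma>\<close> is divisible by \<open>w\<close>: the first
  summand has constant term \<open>1\<close>, and \<open>ln (1-w)\<close> has none.
\<close>

lemma exists_quotient_symbol:
  fixes s lam :: real
  assumes p: "1 \<le> p" and s: "0 < s" and lam: "1 < lam"
  shows "\<exists>\<sigma> :: real^'n \<Rightarrow> real. Lp_multiplier p \<sigma> \<and>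
    (\<forall>\<xi>. \<xi> \<noteq> 0 \<longrightarrow> (1 - lam / rho lam \<xi>) * m_slog s \<xi> = shifted_symbol s lam \<xi> * (1 - lam / rho lam \<xi> * \<sigma> \<xi>))"
proof -
  define b where "b = (\<lambda>k. (-1) ^ k * (s gchoose k))"
  define d where "d = (\<lambda>k::nat. if k = 0 then - 1 else 1 / real k - 1 / real (Suc k))"
  have sb: "summable (\<lambda>k. \<bar>b k\<bar>)" unfolding b_def using summable_abs_gbinomial[OF s] by (simp add: abs_mult)
  have sb1: "summable (\<lambda>k. \<bar>- b (Suc k)\<bar>)"
    using iffD2[OF summable_Suc_iff[of "\<lambda>k. \<bar>b k\<bar>"] sb] by simp
  have sd: "summable (\<lambda>k. \<bar>d k\<bar>)" unfolding d_def by (rule summable_one_minus_ln)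
  \<comment> \<open>With \<open>b\<close> the coefficients of \<open>(1-w)^s\<close>, these are \<open>P1 = (1-w)^s\<close>, \<open>P2 = (1 - (1-w)^s) / w\<close> and
    \<open>P3 = (1-w) ln (1-w) / w\<close>.\<close>
  define P1 where "P1 = (\<lambda>\<xi>::real^'n. \<Sum>k. b k * (lam / rho lam \<xi>) ^ k)"
  define P2 where "P2 = (\<lambda>\<xi>::real^'n. \<Sum>k. - b (Suc k) * (lam / rho lam \<xi>) ^ k)"
  define P3 where "P3 = (\<lambda>\<xi>::real^'n. \<Sum>k. d k * (lam / rho lam \<xi>) ^ k)"
  define \<sigma> where "\<sigma> = (\<lambda>\<xi>. (P2 \<xi> + P1 \<xi>) - P1 \<xi> * P3 \<xi> * (1 / ln (rho lam \<xi>)))"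
  have lam0: "0 < lam" using lam by simp
  have m: "Lp_multiplier p P1" "Lp_multiplier p P2" "Lp_multiplier p P3"
    unfolding P1_def P2_def P3_def
    by (rule Lp_multiplier_power_series[OF p lam0 sb] Lp_multiplier_power_series[OF p lam0 sb1] Lp_multiplier_power_series[OF p lam0 sd])+
  have "Lp_multiplier p \<sigma>"
    unfolding \<sigma>_def
    by (intro Lp_multiplier_diff Lp_multiplier_add Lp_multiplier_mult Lp_multiplier_inverse_ln_rho p m lam)
  moreover have "(1 - lam / rho lam \<xi>) * m_slog s \<xi> = shifted_symbol s lam \<xi> * (1 - lam / rho lam \<xi> * \<sigma> \<xi>)"
    if \<xi>: "\<xi> \<noteq> 0" for \<xi> :: "real^'n"
  proof -
    define r where "r = 4 * pi\<^sup>2 * (norm \<xi>)\<^sup>2"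
    define \<rho> where "\<rho> = rho lam \<xi>"
    define w where "w = lam / \<rho>"
    have r: "0 < r" using \<xi> by (simp add: r_def)
    have \<rho>: "\<rho> = lam + r" by (simp add: \<rho>_def rho_def r_def)
    have w: "0 < w" "w < 1" using r lam by (auto simp: w_def \<rho>)
    have rw: "r = \<rho> * (1 - w)" using r lam by (simp add: w_def \<rho> field_simps)
    have \<rho>0: "0 < \<rho>" and ln\<rho>: "0 < ln \<rho>" using r lam by (auto simp: \<rho>)
    have P1: "P1 \<xi> = (1 - w) powr s"
      using one_minus_powr_sums[of w s] w unfolding P1_def b_def \<rho>_def[symmetric] w_def[symmetric] by (simp add: sums_iff)
    have P3: "w * P3 \<xi> = (1 - w) * ln (1 - w)"
      using one_minus_ln_sums[OF w] w unfolding P3_def d_def \<rho>_def[symmetric] w_def[symmetric] by (simp add: sums_iff)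
    have P2: "w * P2 \<xi> = 1 - P1 \<xi>"
    proof -
      have sm: "summable (\<lambda>k. b k * w ^ k)"
        using one_minus_powr_sums[of w s] w unfolding b_def by (simp add: sums_iff)
      have sm1: "summable (\<lambda>k. b (Suc k) * w ^ k)"
      proof (rule summable_comparison_test'[OF sb1, of 0])
        fix k
        have "\<bar>b (Suc k)\<bar> * w ^ k \<le> \<bar>b (Suc k)\<bar> * 1" using w by (intro mult_left_mono power_le_one) auto
        then show "norm (b (Suc k) * w ^ k) \<le> \<bar>- b (Suc k)\<bar>" using w by (simp add: abs_mult)
      qed
      have "P1 \<xi> = b 0 + (\<Sum>k. b (Suc k) * w ^ Suc k)"
        using suminf_split_head[OF sm] unfolding P1_def \<rho>_def[symmetric] w_def[symmetric] by simp
      also have "(\<Sum>k. b (Suc k) * w ^ Suc k) = w * (\<Sum>k. b (Suc k) * w ^ k)"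
        by (subst suminf_mult[OF sm1, symmetric]) (simp add: mult_ac)
      also have "(\<Sum>k. b (Suc k) * w ^ k) = - P2 \<xi>"
        unfolding P2_def \<rho>_def[symmetric] w_def[symmetric] using suminf_minus[OF sm1] by simp
      finally show ?thesis by (simp add: b_def)
    qed
    have "1 - w * \<sigma> \<xi> = 1 - w * P2 \<xi> - w * P1 \<xi> + P1 \<xi> * (w * P3 \<xi>) / ln \<rho>"
      unfolding \<sigma>_def \<rho>_def[symmetric] by (simp add: algebra_simps)
    also have "\<dots> = (1 - w) * P1 \<xi> * (ln \<rho> + ln (1 - w)) / ln \<rho>"
      unfolding P2 P3 using ln\<rho> by (simp add: field_simps)
    finally have "shifted_symbol s lam \<xi> * (1 - w * \<sigma> \<xi>)
       = \<rho> powr s * ln \<rho> * ((1 - w) * P1 \<xi> * (ln \<rho> + ln (1 - w)) / ln \<rho>)"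
      unfolding shifted_symbol_def by (simp add: \<rho>_def rho_def)
    also have "\<dots> = (1 - w) * (\<rho> powr s * (1 - w) powr s) * (ln \<rho> + ln (1 - w))"
      unfolding P1 using ln\<rho> by simp
    also have "\<rho> powr s * (1 - w) powr s = r powr s" unfolding rw using \<rho>0 w by (simp add: powr_mult)
    also have "ln \<rho> + ln (1 - w) = ln r" unfolding rw using \<rho>0 w by (simp add: ln_mult)
    also have "(1 - w) * r powr s * ln r = (1 - w) * m_slog s \<xi>"
      using \<xi> by (simp add: m_slog_def r_def)
    finally show ?thesis by (simp add: w_def \<rho>_def)
  qed
  ultimately show ?thesis by blast
qed

lemma inv_fourier_cong_off_0:
  assumes "\<And>\<xi>. \<xi> \<noteq> 0 \<Longrightarrow> f \<xi> = g \<xi>" and f: "f \<in> borel_measurable borel" and g: "g \<in> borel_measurable borel"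
  shows "inv_fourier f x = inv_fourier (g :: real^'n \<Rightarrow> complex) x"
proof -
  note [measurable] = f g
  show ?thesis
    unfolding inv_fourier_eq[OF f] inv_fourier_eq[OF g]
  proof (rule integral_cong_AE)
    show "AE \<xi> in lborel. f \<xi> * plane_wave x \<xi> = g \<xi> * plane_wave x \<xi>"
      using AE_lborel_singleton[of "0::real^'n"] by eventually_elim (simp add: assms(1))
  qed measurable
qed

text \<open>
  For an even symbol the two conventions for the Fourier transform of a distribution give the same
  multiplier operator.
\<close>

lemma fourier_even_multiplier:
  fixes \<phi> :: "real^'n \<Rightarrow> complex"
  assumes m[measurable]: "m \<in> borel_measurable borel" and even: "\<And>\<xi>. m (- \<xi>) = m \<xi>" and \<phi>: "\<phi> \<in> schwartz"
  shows "fourier (\<lambda>\<xi>. m \<xi> * inv_fourier \<phi> \<xi>) x = inv_fourier (\<lambda>\<xi>. m \<xi> * fourier \<phi> \<xi>) x"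
proof -
  note [measurable] = schwartzD(5)[OF \<phi>] schwartzD(5)[OF fourier_schwartz[OF \<phi>]]
  have "fourier (\<lambda>\<xi>. m \<xi> * inv_fourier \<phi> \<xi>) x = (LBINT \<xi>. m \<xi> * inv_fourier \<phi> \<xi> * plane_wave (- x) \<xi>)"
    by (subst fourier_eq) auto
  also have "\<dots> = (LBINT \<xi>. m (- \<xi>) * inv_fourier \<phi> (- \<xi>) * plane_wave (- x) (- \<xi>))"
    using lborel_integral_affine[of "\<lambda>\<xi>. m \<xi> * inv_fourier \<phi> \<xi> * plane_wave (- x) \<xi>" "-1" 0] by simp
  also have "\<dots> = (LBINT \<xi>. m \<xi> * fourier \<phi> \<xi> * plane_wave x \<xi>)"
    by (simp add: even fourier_eq_inv_fourier plane_wave_minus)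
  also have "\<dots> = inv_fourier (\<lambda>\<xi>. m \<xi> * fourier \<phi> \<xi>) x" by (subst inv_fourier_eq) auto
  finally show ?thesis .
qed

lemma m_slog_measurable [measurable]: "m_slog s \<in> borel_measurable borel"
  unfolding m_slog_def[abs_def] by measurable

lemma shifted_symbol_measurable [measurable]: "shifted_symbol s lam \<in> borel_measurable borel"
  unfolding shifted_symbol_def[abs_def] by measurable

lemma rho_slow: "(\<lambda>\<xi>::real^'n. complex_of_real (rho lam \<xi>)) \<in> slow"
proof -
  have "(\<lambda>\<xi>::real^'n. of_real lam + of_real (4 * pi\<^sup>2) * complex_of_real ((norm \<xi>)\<^sup>2)) \<in> slow"
    by (intro slow_add slow_mult slow_const slow_norm_sq)
  then show ?thesis by (simp add: rho_def)
qed

text \<open>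
  The formal identity \<open>M(D)u = A(D)f + B(D)u\<close> is the equation \<open>R(D)f = (Rm)(D)u\<close> multiplied by
  \<open>A0 \<rho>^N\<close>. What the hypothesis gives is that \<open>v = R(D)f - Q(D)u\<close>, where \<open>Q = R m\<close>, is a constant,
  possibly nonzero if \<open>p = \<infinity>\<close>. Applying \<open>A0(D)\<close> gives another constant \<open>a\<close>, and multiplying that
  by \<open>\<rho>^N\<close> amounts to multiplication by \<open>lam^N\<close>, as its spectrum is the origin. The resulting
  density of \<open>M(D)u\<close> is \<open>A(D)f + B(D)u - lam^N a\<close>.
\<close>

lemma a_priori_estimate:
  fixes s lam :: real and p :: ereal
  assumes s: "0 < s" and lam: "1 < lam" and p: "1 \<le> p"
  shows "\<exists>C>0. \<forall>u f :: real^'n \<Rightarrow> complex. u \<in> Lp_borel p \<longrightarrow> f \<in> Lp_borel p \<longrightarrow>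
     (\<forall>\<psi>\<in>schwartz_zero. \<langle>f, \<psi>\<rangle> = \<langle>u, m_slog s \<odot> \<psi>\<rangle>) \<longrightarrow>
     (\<exists>g\<in>Lp_borel p. Lp_norm p g \<le> C * (Lp_norm p f + Lp_norm p u) \<and>
       (\<forall>\<psi>\<in>schwartz. \<langle>u, shifted_symbol s lam \<odot> \<psi>\<rangle> = \<langle>g, \<psi>\<rangle>))"
proof -
  have lam0: "0 < lam" using lam by simp
  have rho_gt: "1 < rho lam \<xi>" for \<xi> :: "real^'n" using rho_ge[of lam \<xi>] lam by linarith
  obtain \<sigma> :: "real^'n \<Rightarrow> real" where \<sigma>: "Lp_multiplier p \<sigma>"
    and quot: "\<And>\<xi>. \<xi> \<noteq> 0 \<Longrightarrow> (1 - lam / rho lam \<xi>) * m_slog s \<xi> = shifted_symbol s lam \<xi> * (1 - lam / rho lam \<xi> * \<sigma> \<xi>)"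
    using exists_quotient_symbol[OF p s lam] by blast
  obtain N :: nat where N: "s + 1 \<le> real N" using real_arch_simple by blast
  \<comment> \<open>In terms of \<open>\<eta> = w\<sigma>\<close>: the identity is \<open>M = A m + B\<close> with \<open>A = (1-w) A0\<close> and \<open>A0\<close> a geometric
    sum, and \<open>M' = M \<rho>^(-N)\<close>, \<open>R = (1-w) \<rho>^(-N)\<close> and \<open>Q = M' (1-\<eta>) = R m\<close> are the symbols
    regularised by \<open>\<rho>^(-N)\<close>, all of them multipliers.\<close>
  define w where "w = (\<lambda>\<xi>::real^'n. lam * (1 / rho lam \<xi>))"
  define M where "M = (\<lambda>\<xi>::real^'n. shifted_symbol s lam \<xi>)"
  define M' where "M' = (\<lambda>\<xi>::real^'n. rho lam \<xi> powr (- (real N - 1 - s)) * (ln (rho lam \<xi>) / rho lam \<xi>))"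
  define \<eta> where "\<eta> = (\<lambda>\<xi>. w \<xi> * \<sigma> \<xi>)"
  define A0 where "A0 = (\<lambda>\<xi>. \<Sum>k<N. \<eta> \<xi> ^ k)"
  define A where "A = (\<lambda>\<xi>. (1 - w \<xi>) * A0 \<xi>)"
  define B where "B = (\<lambda>\<xi>. lam ^ N * (M' \<xi> * \<sigma> \<xi> ^ N))"
  define R where "R = (\<lambda>\<xi>. (1 - w \<xi>) * (1 / rho lam \<xi>) ^ N)"
  define Q where "Q = (\<lambda>\<xi>. M' \<xi> * (1 - \<eta> \<xi>))"
  have M_eq: "M \<xi> = M' \<xi> * rho lam \<xi> ^ N" for \<xi>
  proof -
    have pw: "rho lam \<xi> powr (- (real N - 1 - s)) / rho lam \<xi> * rho lam \<xi> ^ N = rho lam \<xi> powr s"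
    proof -
      have r: "0 < rho lam \<xi>" using rho_gt[of \<xi>] by simp
      have "rho lam \<xi> powr (- (real N - 1 - s)) * rho lam \<xi> ^ N = rho lam \<xi> powr (s + 1)"
        using r by (simp add: powr_realpow[symmetric] powr_add[symmetric])
      also have "\<dots> = rho lam \<xi> powr s * rho lam \<xi>" using r by (simp add: powr_add)
      finally show ?thesis using r by (simp add: field_simps)
    qed
    show ?thesis
      unfolding M_def M'_def shifted_symbol_def rho_def[symmetric] pw[symmetric] by simp
  qed
  have mw: "Lp_multiplier p w" unfolding w_def
    by (intro Lp_multiplier_cmult Lp_multiplier_inverse_rho p lam0)
  have mM': "Lp_multiplier p M'" unfolding M'_def
    by (intro Lp_multiplier_mult Lp_multiplier_rho_powr Lp_multiplier_ln_over_rho p lam0 lam) (use N in simp)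
  have m\<eta>: "Lp_multiplier p \<eta>" unfolding \<eta>_def by (intro Lp_multiplier_mult mw \<sigma>)
  have mA0: "Lp_multiplier p A0" unfolding A0_def by (intro Lp_multiplier_sum Lp_multiplier_power p m\<eta>) simp
  have mA: "Lp_multiplier p A" unfolding A_def by (intro Lp_multiplier_mult Lp_multiplier_diff Lp_multiplier_const p mw mA0)
  have mB: "Lp_multiplier p B" unfolding B_def by (intro Lp_multiplier_cmult Lp_multiplier_mult Lp_multiplier_power p mM' \<sigma>)
  have mR: "Lp_multiplier p R" unfolding R_def
    by (intro Lp_multiplier_mult Lp_multiplier_diff Lp_multiplier_const Lp_multiplier_power Lp_multiplier_inverse_rho p mw lam0)
  have mQ: "Lp_multiplier p Q" unfolding Q_def by (intro Lp_multiplier_mult Lp_multiplier_diff Lp_multiplier_const p mM' m\<eta>)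
  obtain CA TA where TA: "realizes p A CA TA" by (rule Lp_multiplierE[OF mA])
  obtain CB TB where TB: "realizes p B CB TB" by (rule Lp_multiplierE[OF mB])
  obtain C0 T0 where T0: "realizes p A0 C0 T0" by (rule Lp_multiplierE[OF mA0])
  obtain CR TR where TR: "realizes p R CR TR" by (rule Lp_multiplierE[OF mR])
  obtain CQ TQ where TQ: "realizes p Q CQ TQ" by (rule Lp_multiplierE[OF mQ])
  \<comment> \<open>The summand \<open>1\<close> makes the constant positive even if all operator bounds are zero.\<close>
  define C where "C = 4 * (CA + CB) + 4 * lam ^ N * C0 * (CR + CQ) + 1"
  have C_pos: "0 < C"
    unfolding C_def using realizesD(1)[OF TA] realizesD(1)[OF TB] realizesD(1)[OF T0] realizesD(1)[OF TR] realizesD(1)[OF TQ] lam0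
    by (intro add_nonneg_pos) auto
  show ?thesis
  proof (intro exI[of _ C] conjI C_pos allI impI)
    fix u f :: "real^'n \<Rightarrow> complex" assume u: "u \<in> Lp_borel p" and f: "f \<in> Lp_borel p"
      and eq: "\<forall>\<psi>\<in>schwartz_zero. \<langle>f, \<psi>\<rangle> = \<langle>u, m_slog s \<odot> \<psi>\<rangle>"
    have TRf: "TR f \<in> Lp_borel p" and TQu: "TQ u \<in> Lp_borel p" and TAf: "TA f \<in> Lp_borel p" and TBu: "TB u \<in> Lp_borel p"
      by (rule realizesD(2)[OF TR f] realizesD(2)[OF TQ u] realizesD(2)[OF TA f] realizesD(2)[OF TB u])+
    define v where "v = (\<lambda>x. TR f x + (-1) * TQ u x)"
    have v: "v \<in> Lp_borel p" unfolding v_def by (intro Lp_norm_add p TRf Lp_norm_scale TQu)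
    have v_pair: "\<langle>v, \<psi>\<rangle>
        = \<langle>f, R \<odot> \<psi>\<rangle> - \<langle>u, Q \<odot> \<psi>\<rangle>"
      if \<psi>: "\<psi> \<in> tests" for \<psi>
    proof -
      have "\<langle>v, \<psi>\<rangle> = (LBINT x. TR f x * inv_fourier \<psi> x - TQ u x * inv_fourier \<psi> x)"
        by (simp add: v_def left_diff_distrib)
      also have "\<dots> = \<langle>TR f, \<psi>\<rangle> - \<langle>TQ u, \<psi>\<rangle>"
        by (rule Bochner_Integration.integral_diff[OF pairing_tests_integrable[OF p TRf \<psi>] pairing_tests_integrable[OF p TQu \<psi>]])
      finally show ?thesis by (simp only: realizesD(4)[OF TR f \<psi>] realizesD(4)[OF TQ u \<psi>])
    qed
    have "\<exists>c. AE x in lborel. v x = c"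
    proof (rule constant_if_orthogonal_to_schwartz_zero[OF p v])
      fix \<psi> :: "real^'n \<Rightarrow> complex" assume \<psi>: "\<psi> \<in> schwartz_zero"
      have \<psi>t: "\<psi> \<in> tests" using \<psi> by (intro schwartz_tests) (simp add: schwartz_zero_def)
      \<comment> \<open>\<open>R\<close> is smooth and slowly increasing, hence \<open>R \<psi>\<close> is again flat at the origin and the
        equation applies to it.\<close>
      have iv: "(\<lambda>\<xi>::real^'n. complex_of_real (1 / rho lam \<xi>)) \<in> slow"
        unfolding rho_def by (rule slow_inverse_quadratic[OF lam0])
      have "(\<lambda>\<xi>::real^'n. (1 + of_real (- lam) * complex_of_real (1 / rho lam \<xi>)) * complex_of_real (1 / rho lam \<xi>) ^ N) \<in> slow"
        by (intro slow_mult slow_add slow_const slow_power iv)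
      then have Rs: "(\<lambda>\<xi>. complex_of_real (R \<xi>)) \<in> slow" by (simp add: R_def w_def)
      have z: "(R \<odot> \<psi>) \<in> schwartz_zero" by (rule slow_schwartz_zero[OF Rs \<psi>])
      then have zm: "(R \<odot> \<psi>) \<in> borel_measurable borel" by (intro schwartzD(5)) (simp add: schwartz_zero_def)
      have "inv_fourier (\<lambda>\<xi>. of_real (m_slog s \<xi>) * (of_real (R \<xi>) * \<psi> \<xi>)) x = inv_fourier (Q \<odot> \<psi>) x" for x
      proof (rule inv_fourier_cong_off_0)
        fix \<xi> :: "real^'n" assume "\<xi> \<noteq> 0"
        from quot[OF this] have q: "(1 - w \<xi>) * m_slog s \<xi> = M \<xi> * (1 - \<eta> \<xi>)" by (simp add: w_def M_def \<eta>_def)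
        have "m_slog s \<xi> * R \<xi> = ((1 - w \<xi>) * m_slog s \<xi>) * (1 / rho lam \<xi>) ^ N" by (simp add: R_def)
        also have "\<dots> = M' \<xi> * (1 - \<eta> \<xi>) * (rho lam \<xi> ^ N * (1 / rho lam \<xi>) ^ N)" unfolding q M_eq by simp
        also have "rho lam \<xi> ^ N * (1 / rho lam \<xi>) ^ N = 1"
          using rho_gt[of \<xi>] by (simp flip: power_mult_distrib)
        finally have "m_slog s \<xi> * R \<xi> = Q \<xi>" by (simp add: Q_def)
        then show "of_real (m_slog s \<xi>) * (of_real (R \<xi>) * \<psi> \<xi>) = of_real (Q \<xi>) * \<psi> \<xi>"
          by (simp flip: mult.assoc of_real_mult)
      next
        show "(\<lambda>\<xi>. of_real (m_slog s \<xi>) * (of_real (R \<xi>) * \<psi> \<xi>)) \<in> borel_measurable borel" using zm by measurable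
        show "(Q \<odot> \<psi>) \<in> borel_measurable borel" by (rule testsD(3)[OF Lp_multiplier_tests[OF mQ \<psi>t]])
      qed
      then show "\<langle>v, \<psi>\<rangle> = 0"
        using v_pair[OF \<psi>t] bspec[OF eq z] by simp
    qed
    then obtain c where c: "AE x in lborel. v x = c" by blast
    define a where "a = T0 v"
    have a: "a \<in> Lp_borel p" unfolding a_def by (rule realizesD(2)[OF T0 v])
    obtain c' where c': "AE x in lborel. a x = c'" using realizesD(5)[OF T0 v c] unfolding a_def by blast
    have a_const: "\<langle>a, \<theta>\<rangle> = c' * \<theta> 0" if \<theta>: "\<theta> \<in> schwartz" for \<theta>
    proof -
      note [measurable] = Lp_borel_measurable[OF a] schwartzD(5)[OF inv_fourier_schwartz[OF \<theta>]]
      have "\<langle>a, \<theta>\<rangle> = (LBINT x. c' * inv_fourier \<theta> x)"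
        using c' by (intro integral_cong_AE) auto
      then show ?thesis by (simp add: integral_inv_fourier[OF \<theta>])
    qed
    define h where "h = (\<lambda>x. TA f x + TB u x)"
    define g where "g = (\<lambda>x. h x + of_real (- (lam ^ N)) * a x)"
    have h: "h \<in> Lp_borel p" unfolding h_def by (rule Lp_norm_add(1)[OF p TAf TBu])
    have la: "(\<lambda>x. of_real (- (lam ^ N)) * a x) \<in> Lp_borel p" by (rule Lp_norm_scale(1)[OF p a])
    have g: "g \<in> Lp_borel p" unfolding g_def by (rule Lp_norm_add(1)[OF p h la])
    have norm_g: "Lp_norm p g \<le> C * (Lp_norm p f + Lp_norm p u)"
    proof -
      let ?f = "Lp_norm p f" and ?u = "Lp_norm p u"
      have f0: "0 \<le> ?f" and u0: "0 \<le> ?u" by (rule Lp_norm_nonneg)+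
      have hn: "Lp_norm p h \<le> 2 * (CA + CB) * (?f + ?u)"
      proof -
        have "Lp_norm p h \<le> 2 * (CA * ?f + CB * ?u)"
          unfolding h_def using Lp_norm_add(2)[OF p TAf TBu] realizesD(3)[OF TA f] realizesD(3)[OF TB u] by simp
        also have "\<dots> \<le> 2 * (CA + CB) * (?f + ?u)"
          using f0 u0 realizesD(1)[OF TA] realizesD(1)[OF TB] by (simp add: algebra_simps)
        finally show ?thesis .
      qed
      have vn: "Lp_norm p v \<le> 2 * (CR + CQ) * (?f + ?u)"
      proof -
        have "Lp_norm p v \<le> 2 * (CR * ?f + CQ * ?u)"
          unfolding v_def
          using Lp_norm_add(2)[OF p TRf Lp_norm_scale(1)[OF p TQu, of "-1"]] Lp_norm_scale(2)[OF p TQu, of "-1"]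
            realizesD(3)[OF TR f] realizesD(3)[OF TQ u] by simp
        also have "\<dots> \<le> 2 * (CR + CQ) * (?f + ?u)"
          using f0 u0 realizesD(1)[OF TR] realizesD(1)[OF TQ] by (simp add: algebra_simps)
        finally show ?thesis .
      qed
      have "Lp_norm p a \<le> C0 * (2 * (CR + CQ) * (?f + ?u))"
        unfolding a_def using realizesD(3)[OF T0 v] mult_left_mono[OF vn realizesD(1)[OF T0]] by linarith
      then have an: "lam ^ N * Lp_norm p a \<le> lam ^ N * (C0 * (2 * (CR + CQ) * (?f + ?u)))"
        using lam0 by (intro mult_left_mono) auto
      have "Lp_norm p g \<le> 2 * (Lp_norm p h + Lp_norm p (\<lambda>x. of_real (- (lam ^ N)) * a x))"
        unfolding g_def by (rule Lp_norm_add(2)[OF p h la])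
      also have "Lp_norm p (\<lambda>x. of_real (- (lam ^ N)) * a x) \<le> lam ^ N * Lp_norm p a"
        using Lp_norm_scale(2)[OF p a, of "of_real (- (lam ^ N))"] lam0 by (simp add: norm_power)
      finally have "Lp_norm p g \<le> 2 * (2 * (CA + CB) * (?f + ?u) + lam ^ N * (C0 * (2 * (CR + CQ) * (?f + ?u))))"
        using hn an by simp
      also have "\<dots> = (C - 1) * (?f + ?u)" by (simp add: C_def algebra_simps)
      also have "\<dots> \<le> C * (?f + ?u)" using f0 u0 by (intro mult_right_mono) auto
      finally show ?thesis .
    qed
    have "\<langle>u, M \<odot> \<psi>\<rangle> = \<langle>g, \<psi>\<rangle>"
      if \<psi>: "\<psi> \<in> schwartz" for \<psi>
    proof -
      \<comment> \<open>Testing \<open>A0(D) v\<close> against \<open>\<rho>^N \<psi>\<close> undoes the regularisation.\<close>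
      define \<theta> where "\<theta> = (\<lambda>\<xi>. complex_of_real (rho lam \<xi>) ^ N * \<psi> \<xi>)"
      have \<theta>: "\<theta> \<in> schwartz" unfolding \<theta>_def by (rule slow_schwartz[OF slow_power[OF rho_slow] \<psi>])
      have \<psi>t: "\<psi> \<in> tests" and \<theta>t: "\<theta> \<in> tests" by (rule schwartz_tests \<psi> \<theta>)+
      have M\<psi>: "of_real (M \<xi>) * \<psi> \<xi> = of_real (M' \<xi>) * \<theta> \<xi>" for \<xi>
        by (simp add: M_eq \<theta>_def)
      have Mt: "(M \<odot> \<psi>) \<in> tests" unfolding M\<psi> by (rule Lp_multiplier_tests[OF mM' \<theta>t])
      note Bt = Lp_multiplier_tests[OF mB \<psi>t]
      have r1: "rho lam \<xi> ^ N * (1 / rho lam \<xi>) ^ N = 1" for \<xi> :: "real^'n"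
        using rho_gt[of \<xi>] by (simp flip: power_mult_distrib)
      have RA: "of_real (R \<xi>) * (of_real (A0 \<xi>) * \<theta> \<xi>) = of_real (A \<xi>) * \<psi> \<xi>" for \<xi>
      proof -
        have "R \<xi> * A0 \<xi> * rho lam \<xi> ^ N = A \<xi> * (rho lam \<xi> ^ N * (1 / rho lam \<xi>) ^ N)"
          by (simp add: R_def A_def)
        then have "R \<xi> * A0 \<xi> * rho lam \<xi> ^ N = A \<xi>" unfolding r1 by simp
        then show ?thesis unfolding \<theta>_def by (simp flip: mult.assoc of_real_mult of_real_power)
      qed
      have QA: "of_real (Q \<xi>) * (of_real (A0 \<xi>) * \<theta> \<xi>) = of_real (M \<xi>) * \<psi> \<xi> + (-1) * (of_real (B \<xi>) * \<psi> \<xi>)" for \<xi>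
      proof -
        have geo: "(1 - \<eta> \<xi>) * A0 \<xi> = 1 - \<eta> \<xi> ^ N"
          unfolding A0_def by (rule one_diff_power_eq[symmetric])
        have "\<eta> \<xi> ^ N * rho lam \<xi> ^ N = lam ^ N * \<sigma> \<xi> ^ N * (rho lam \<xi> ^ N * (1 / rho lam \<xi>) ^ N)"
          unfolding \<eta>_def w_def power_mult_distrib by (simp add: mult_ac)
        then have \<eta>N: "\<eta> \<xi> ^ N * rho lam \<xi> ^ N = lam ^ N * \<sigma> \<xi> ^ N" unfolding r1 by simp
        have "Q \<xi> * A0 \<xi> * rho lam \<xi> ^ N = M' \<xi> * ((1 - \<eta> \<xi>) * A0 \<xi>) * rho lam \<xi> ^ N" by (simp add: Q_def)
        also have "\<dots> = M' \<xi> * rho lam \<xi> ^ N - M' \<xi> * (\<eta> \<xi> ^ N * rho lam \<xi> ^ N)"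
          unfolding geo by (simp add: algebra_simps)
        also have "\<dots> = M \<xi> - B \<xi>" unfolding \<eta>N by (simp add: M_eq B_def)
        finally have "Q \<xi> * A0 \<xi> * rho lam \<xi> ^ N = M \<xi> - B \<xi>" .
        then have "complex_of_real (Q \<xi> * A0 \<xi> * rho lam \<xi> ^ N) * \<psi> \<xi> = of_real (M \<xi> - B \<xi>) * \<psi> \<xi>" by (simp only:)
        then show ?thesis unfolding \<theta>_def by (simp add: left_diff_distrib mult.assoc)
      qed
      have "c' * \<theta> 0 = \<langle>a, \<theta>\<rangle>" by (rule a_const[OF \<theta>, symmetric])
      also have "\<dots> = \<langle>v, A0 \<odot> \<theta>\<rangle>"
        unfolding a_def by (rule realizesD(4)[OF T0 v \<theta>t])
      also have "\<dots> = \<langle>f, A \<odot> \<psi>\<rangle>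
          - (LBINT x. u x * inv_fourier (\<lambda>\<xi>. of_real (M \<xi>) * \<psi> \<xi> + (-1) * (of_real (B \<xi>) * \<psi> \<xi>)) x)"
        unfolding v_pair[OF Lp_multiplier_tests[OF mA0 \<theta>t]] RA QA ..
      also have "(LBINT x. u x * inv_fourier (\<lambda>\<xi>. of_real (M \<xi>) * \<psi> \<xi> + (-1) * (of_real (B \<xi>) * \<psi> \<xi>)) x)
          = (LBINT x. u x * inv_fourier (M \<odot> \<psi>) x - u x * inv_fourier (B \<odot> \<psi>) x)"
        unfolding inv_fourier_add[OF testsD(1)[OF Mt] testsD(1)[OF tests_cmult[OF Bt]]] inv_fourier_cmult[OF testsD(3)[OF Bt]]
        by (simp add: right_diff_distrib)
      also have "\<dots> = \<langle>u, M \<odot> \<psi>\<rangle> - \<langle>u, B \<odot> \<psi>\<rangle>"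
        by (rule Bochner_Integration.integral_diff[OF pairing_tests_integrable[OF p u Mt] pairing_tests_integrable[OF p u Bt]])
      also have "\<langle>f, A \<odot> \<psi>\<rangle> = \<langle>TA f, \<psi>\<rangle>"
        by (rule realizesD(4)[OF TA f \<psi>t, symmetric])
      also have "\<langle>u, B \<odot> \<psi>\<rangle> = \<langle>TB u, \<psi>\<rangle>"
        by (rule realizesD(4)[OF TB u \<psi>t, symmetric])
      finally have main: "\<langle>u, M \<odot> \<psi>\<rangle>
          = \<langle>TA f, \<psi>\<rangle> + \<langle>TB u, \<psi>\<rangle> - c' * \<theta> 0"
        by (simp add: algebra_simps)
      have "c' * \<theta> 0 = of_real (lam ^ N) * \<langle>a, \<psi>\<rangle>"
        unfolding a_const[OF \<psi>] by (simp add: \<theta>_def rho_def mult_ac)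
      moreover have "\<langle>g, \<psi>\<rangle> = (LBINT x. (TA f x * inv_fourier \<psi> x + TB u x * inv_fourier \<psi> x) - of_real (lam ^ N) * (a x * inv_fourier \<psi> x))"
        by (simp add: g_def h_def algebra_simps)
      ultimately show ?thesis
        unfolding main
        using pairing_tests_integrable[OF p TAf \<psi>t] pairing_tests_integrable[OF p TBu \<psi>t] pairing_tests_integrable[OF p a \<psi>t]
        by simp
    qed
    with g norm_g show "\<exists>g\<in>Lp_borel p. Lp_norm p g \<le> C * (Lp_norm p f + Lp_norm p u) \<and>
       (\<forall>\<psi>\<in>schwartz. \<langle>u, shifted_symbol s lam \<odot> \<psi>\<rangle> = \<langle>g, \<psi>\<rangle>)"
      unfolding M_def by blast
  qed
qed

text \<open>
  The norm on the potential space is defined through a chosen density; its value does not depend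
  on the choice.
\<close>

lemma Lp_density_unique:
  fixes g h :: "real^'n \<Rightarrow> complex"
  assumes p: "1 \<le> p" and g: "is_Lp_density p T g" and h: "is_Lp_density p T h"
  shows "Lp_norm p g = Lp_norm p h"
proof -
  have gL: "g \<in> Lp p" and hL: "h \<in> Lp p" using g h by (auto simp: is_Lp_density_def)
  obtain g' where g': "g' \<in> Lp_borel p" "AE x in lborel. g x = g' x" "Lp_norm p g' = Lp_norm p g" by (rule Lp_representative[OF gL])
  obtain h' where h': "h' \<in> Lp_borel p" "AE x in lborel. h x = h' x" "Lp_norm p h' = Lp_norm p h" by (rule Lp_representative[OF hL])
  note [measurable] = Lp_borel_measurable[OF g'(1)] Lp_borel_measurable[OF h'(1)]
  note i = Lp_schwartz_pairing_integrable[OF p]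
  have "AE x in lborel. g' x - h' x = 0"
  proof (rule AE_zero_if_orthogonal_to_schwartz)
    fix \<phi> :: "real^'n \<Rightarrow> complex" assume \<phi>: "\<phi> \<in> schwartz"
    show "integrable lborel (\<lambda>x. (g' x - h' x) * \<phi> x)" using i[OF g'(1) \<phi>] i[OF h'(1) \<phi>] by (simp add: left_diff_distrib)
    have "(LBINT x. g' x * \<phi> x) = (LBINT x. h' x * \<phi> x)"
      using g h \<phi> distr_of_borel[OF _ Lp_borel_measurable[OF g'(1)] g'(2) schwartzD(5)[OF \<phi>]] distr_of_borel[OF _ Lp_borel_measurable[OF h'(1)] h'(2) schwartzD(5)[OF \<phi>]] gL hL
      by (simp add: is_Lp_density_def Lp_def)
    then show "(LBINT x. (g' x - h' x) * \<phi> x) = 0" using i[OF g'(1) \<phi>] i[OF h'(1) \<phi>] by (simp add: left_diff_distrib)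
  qed measurable
  then have "AE x in lborel. g' x = h' x" by eventually_elim simp
  from Lp_norm_cong_AE(1)[OF this borel_imp_lebesgue[OF Lp_borel_measurable[OF g'(1)]] borel_imp_lebesgue[OF Lp_borel_measurable[OF h'(1)]]]
  show ?thesis using g'(3) h'(3) by simp
qed

theorem theorem1p9:
  fixes s lam :: real and p :: ereal
  assumes "s > 0" and "lam > 1" and "1 \<le> p"
  shows "\<exists>C>0. \<forall>u f :: real^'n \<Rightarrow> complex.
    u \<in> Lp p \<longrightarrow> f \<in> Lp p \<longrightarrow>
    is_frac_log_laplacian s (distr_of u) (distr_of f) \<longrightarrow>
    distr_of u \<in> potential_space p s lam \<and>
    potential_norm p s lam (distr_of u) \<le> C * (Lp_norm p f + Lp_norm p u)"
proof -
  obtain C where C: "C > 0" and est: "\<And>u f :: real^'n \<Rightarrow> complex. u \<in> Lp_borel p \<Longrightarrow> f \<in> Lp_borel p \<Longrightarrow>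
     (\<forall>\<psi>\<in>schwartz_zero. \<langle>f, \<psi>\<rangle> = \<langle>u, m_slog s \<odot> \<psi>\<rangle>) \<Longrightarrow>
     (\<exists>g\<in>Lp_borel p. Lp_norm p g \<le> C * (Lp_norm p f + Lp_norm p u) \<and>
       (\<forall>\<psi>\<in>schwartz. \<langle>u, shifted_symbol s lam \<odot> \<psi>\<rangle> = \<langle>g, \<psi>\<rangle>))"
    using a_priori_estimate[OF assms(1,2,3)] by blast
  show ?thesis
  proof (intro exI[of _ C] conjI C allI impI)
    fix u f :: "real^'n \<Rightarrow> complex" assume u: "u \<in> Lp p" and f: "f \<in> Lp p"
      and lap: "is_frac_log_laplacian s (distr_of u) (distr_of f)"
    have um: "u \<in> borel_measurable lebesgue" and fm: "f \<in> borel_measurable lebesgue" using u f by (auto simp: Lp_def)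
    obtain u' where u': "u' \<in> Lp_borel p" "AE x in lborel. u x = u' x" "Lp_norm p u' = Lp_norm p u" by (rule Lp_representative[OF u])
    obtain f' where f': "f' \<in> Lp_borel p" "AE x in lborel. f x = f' x" "Lp_norm p f' = Lp_norm p f" by (rule Lp_representative[OF f])
    note du = distr_of_borel[OF um Lp_borel_measurable[OF u'(1)] u'(2)] and df = distr_of_borel[OF fm Lp_borel_measurable[OF f'(1)] f'(2)]
    have "\<langle>f', \<psi>\<rangle> = \<langle>u', m_slog s \<odot> \<psi>\<rangle>"
      if \<psi>: "\<psi> \<in> schwartz_zero" for \<psi>
    proof -
      have [measurable]: "\<psi> \<in> borel_measurable borel" using \<psi> by (intro schwartzD(5)) (simp add: schwartz_zero_def)
      have "distr_of f (inv_fourier \<psi>) = distr_of u (inv_fourier (m_slog s \<odot> \<psi>))"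
        using lap \<psi> by (simp add: is_frac_log_laplacian_def fourier_distr_inf_def mult_distr_def)
      then show ?thesis by (subst (asm) du, measurable, subst (asm) df, measurable)
    qed
    with est[OF u'(1) f'(1)] obtain g where g: "g \<in> Lp_borel p" "Lp_norm p g \<le> C * (Lp_norm p f' + Lp_norm p u')"
      and gd: "\<And>\<psi>. \<psi> \<in> schwartz \<Longrightarrow> \<langle>u', shifted_symbol s lam \<odot> \<psi>\<rangle> = \<langle>g, \<psi>\<rangle>"
      by blast
    have dens: "is_Lp_density p (shifted_laplacian s lam (distr_of u)) g"
      unfolding is_Lp_density_def
    proof (intro conjI ballI)
      show "g \<in> Lp p" using g(1) by (simp add: Lp_borel_def)
      fix \<phi> :: "real^'n \<Rightarrow> complex" assume \<phi>: "\<phi> \<in> schwartz"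
      note F = fourier_schwartz[OF \<phi>]
      note [measurable] = schwartzD(5)[OF \<phi>] schwartzD(5)[OF F]
      let ?M = "\<lambda>\<xi>::real^'n. complex_of_real (shifted_symbol s lam \<xi>)"
      have fe: "fourier (\<lambda>\<xi>. ?M \<xi> * inv_fourier \<phi> \<xi>) = inv_fourier (\<lambda>\<xi>. ?M \<xi> * fourier \<phi> \<xi>)"
        by (intro ext fourier_even_multiplier \<phi>) (simp_all add: shifted_symbol_def)
      have "shifted_laplacian s lam (distr_of u) \<phi> = distr_of u (fourier (\<lambda>\<xi>. ?M \<xi> * inv_fourier \<phi> \<xi>))"
        by (simp add: shifted_laplacian_def fourier_multiplier_def inv_fourier_distr_def mult_distr_def fourier_distr_def)
      also have "\<dots> = \<langle>u', \<lambda>\<xi>. ?M \<xi> * fourier \<phi> \<xi>\<rangle>"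
        unfolding fe by (rule du) measurable
      also have "\<dots> = (LBINT x. g x * \<phi> x)"
        using gd[OF F] by (simp add: schwartz_inversion[OF \<phi>])
      also have "\<dots> = distr_of g \<phi>"
        by (rule distr_of_borel[OF borel_imp_lebesgue[OF Lp_borel_measurable[OF g(1)]] Lp_borel_measurable[OF g(1)] _ schwartzD(5)[OF \<phi>], symmetric]) simp
      finally show "shifted_laplacian s lam (distr_of u) \<phi> = distr_of g \<phi>" .
    qed
    show "distr_of u \<in> potential_space p s lam"
      unfolding potential_space_def using distr_of_in_dual[OF assms(3) u] dens by blast
    have "potential_norm p s lam (distr_of u) = Lp_norm p g"
      unfolding potential_norm_def by (rule Lp_density_unique[OF assms(3) someI[where P="is_Lp_density p (shifted_laplacian s lam (distr_of u))", OF dens] dens])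
    then show "potential_norm p s lam (distr_of u) \<le> C * (Lp_norm p f + Lp_norm p u)"
      using g(2) u'(3) f'(3) by simp
  qed
qed

end
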